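(* Let $\mathcal U$, $\mathcal U'$ be Hopf algebroids over $k$, and let $P$, $P'$ be SAYD modules over $\mathcal U$ and $\mathcal U'$ respectively. Let $C$ be a cocommutative $k$-coalgebra, $(\Psi,\psi):C\longrightarrow V(\mathcal U,\mathcal U')$ a measuring of Hopf algebroids and $\Omega:D\longrightarrow Vect_k(P,P')$ a $(C,\Psi,\psi)$-comodule measuring from $P$ to $P'$. For each $y\in D$, the family of maps ($n\ge0$) $$\overline\Omega^n(y):C^n(\mathcal U;P)\longrightarrow C^n(\mathcal U';P'),\qquad u^1\otimes\dots\otimes u^n\otimes p\mapsto y_{(1)}(u^1)\otimes\dots\otimes y_{(n)}(u^n)\otimes y_{(0)}(p)$$ gives a morphism of cocyclic modules. In particular, for each $y\in D$ there are induced morphisms on Hochschild and cyclic cohomologies $$\overline\Omega^\bullet_{hoc}(y):HH^\bullet(\mathcal U;P)\longrightarrow HH^\bullet(\mathcal U';P'),\qquad\overline\Omega^\bullet_{cy}(y):HC^\bullet(\mathcal U;P)\longrightarrow HC^\bullet(\mathcal U';P').$$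
   Context: $k$ is a field; $Vect_k(V,W)$ denotes the space of $k$-linear maps. Sweedler notation is used with summation suppressed; a right $C$-coaction is written $y\mapsto y_{(0)}\otimes y_{(1)}$, iterated $y_{(0)}\otimes y_{(1)}\otimes\dots\otimes y_{(n)}$. Left bialgebroid $(U,A_L,s_L,t_L,\Delta_L,\epsilon_L)$ over $k$ (write $A=A_L$): unital $k$-algebras $U,A$; $k$-algebra morphisms $s_L:A\to U$, $t_L:A^{op}\to U$ with commuting images; $U$ is an $(A,A)$-bimodule via $a\cdot u\cdot b=s_L(a)t_L(b)u$ and $U\otimes_{A_L}U$ is formed with this structure (so $t_L(a)u\otimes v=u\otimes s_L(a)v$); $(U,\Delta_L:U\to U\otimes_{A_L}U,\epsilon_L:U\to A_L)$ is a coalgebra in $(A,A)$-bimodules such that $\Delta_L$ takes values in $U\times_{A_L}U:=\{\sum u_i\otimes u_i' : \sum u_it_L(a)\otimes u'_i=\sum u_i\otimes u_i's_L(a)\ \forall a\in A\}$ (an algebra under factorwise multiplication), $\Delta_L:U\to U\times_{A_L}U$ is a unital algebra morphism, and $\epsilon_L(us_L(\epsilon_L(u')))=\epsilon_L(uu')=\epsilon_L(ut_L(\epsilon_L(u')))$. Hopf algebroid $\mathcal U=(U,A_L,s_L,t_L,\Delta_L,\epsilon_L,S)$: a left bialgebroid with an involutive ($S^2=\mathrm{id}$) anti-automorphism $S$ of the $k$-algebra $U$ with $S\circ t_L=s_L$ and, in $U\otimes_{A_L}U$ for all $u\in U$, $S(u_{(1)})_{(1)}u_{(2)}\otimes S(u_{(1)})_{(2)}=1_U\otimes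 S(u)$ and $S(u_{(2)})_{(1)}\otimes S(u_{(2)})_{(2)}u_{(1)}=S(u)\otimes 1_U$. Notation: $a\triangleright u\triangleleft b=s_L(a)t_L(b)u$, $a\blacktriangleright u\blacktriangleleft b=us_L(b)t_L(a)$. ${}_\blacktriangleright U\otimes_{A^{op}}U_\triangleleft$ is $U\otimes_kU$ modulo the relations $ut_L(a)\otimes v=u\otimes t_L(a)v$. The map $\beta(\mathcal U):{}_\blacktriangleright U\otimes_{A^{op}}U_\triangleleft\to U_\triangleleft\otimes_A{}_\triangleright U$, $u\otimes v\mapsto u_{(1)}\otimes u_{(2)}v$ is bijective for a Hopf algebroid, and one writes $u_+\otimes u_-:=\beta(\mathcal U)^{-1}(u\otimes_A1)$. SAYD module $P$ over $\mathcal U$: (1) a right $U$-module; (2) a left comodule over the $A$-coring $U$: a left $A$-module $(a,p)\mapsto ap$ with a left $A$-linear, coassociative and counital coaction $\Delta_P:P\to U_\triangleleft\otimes_AP$, $p\mapsto p_{(-1)}\otimes p_{(0)}$ (tensor relation $t_L(a)u\otimes p=u\otimes ap$); (3) $ps_L(a)t_L(b)=b\,\epsilon_L(p_{(-1)}s_L(a))p_{(0)}$ for $a,b\in A$; (4) $\Delta_P(pu)=u_-p_{(-1)}u_{+(1)}\otimes_Ap_{(0)}u_{+(2)}$; and (stability) $p_{(0)}p_{(-1)}=p$. Measuring of algebras: for $k$-algebras $R,R'$ and a $k$-coalgebra $C$ with counit $\epsilon_C$, a linear map $\psi:C\to Vect_k(R,R')$ with $\psi(x)(ab)=\psi(x_{(1)})(a)\psi(x_{(2)})(b)$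 and $\psi(x)(1_R)=\epsilon_C(x)1_{R'}$. Measuring of Hopf algebroids from $\mathcal U$ to $\mathcal U'$ by a cocommutative $k$-coalgebra $C$: a pair of algebra measurings $\Psi:C\to Vect_k(U,U')$, $\psi:C\to Vect_k(A_L,A'_L)$ such that for all $x\in C$: $\Psi(x)s_L=s_L'\psi(x)$, $\Psi(x)t_L=t'_L\psi(x)$, $\Psi(x)S=S'\Psi(x)$, $\psi(x)\epsilon_L=\epsilon_L'\Psi(x)$, and $\Delta'_L(\Psi(x)(u))=\Psi(x_{(1)})(u_{(1)})\otimes\Psi(x_{(2)})(u_{(2)})$ in $U'\otimes_{A'_L}U'$ for all $u\in U$. The map $(\Psi,\psi)$ takes values in $V(\mathcal U,\mathcal U'):=\{(F,f)\in Vect_k(U,U')\times Vect_k(A_L,A_L'): Fs_L=s_L'f,\ Ft_L=t_L'f,\ FS=S'F,\ f\epsilon_L=\epsilon_L'F\}$. $(C,\Psi,\psi)$-comodule measuring from $P$ to $P'$: a right $C$-comodule $D$ and a linear map $\Omega:D\to Vect_k(P,P')$ such that for all $y\in D$, $p\in P$, $u\in U$: $\Omega(y)(pu)=\Omega(y_{(0)})(p)\,\Psi(y_{(1)})(u)$, and $\Delta'_{P'}(\Omega(y)(p))=\Psi(y_{(1)})(p_{(-1)})\otimes_{A'}\Omega(y_{(0)})(p_{(0)})$. One writes $x(u)=\Psi(x)(u)$, $y(p)=\Omega(y)(p)$. Cocyclic module $C^\bullet(\mathcal U;P)$: $C^n(\mathcal U;P)=({}_\triangleright U_\triangleleft)^{\otimes_An}\otimes_AP$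 (relations $t_L(a)u\otimes v=u\otimes s_L(a)v$, $t_L(a)u\otimes p=u\otimes ap$). For $n\ge1$: $\delta_0(u^1\otimes\dots\otimes u^n\otimes p)=1\otimes u^1\otimes\dots\otimes u^n\otimes p$; $\delta_i(\dots)=u^1\otimes\dots\otimes\Delta_L(u^i)\otimes\dots\otimes u^n\otimes p$ for $1\le i\le n$; $\delta_{n+1}(\dots)=u^1\otimes\dots\otimes u^n\otimes p_{(-1)}\otimes p_{(0)}$; for $n=0$: $\delta_0(p)=1\otimes p$, $\delta_1(p)=p_{(-1)}\otimes p_{(0)}$. $\sigma_i(u^1\otimes\dots\otimes u^n\otimes p)=u^1\otimes\dots\otimes\epsilon_L(u^{i+1})\otimes\dots\otimes u^n\otimes p$, $0\le i\le n-1$, meaning that $\epsilon_L(u^{i+1})\in A$ is absorbed by the left $A$-action on the next tensor factor ($u^{i+2}$, or $p$ if $i=n-1$). $\tau_n(u^1\otimes\dots\otimes u^n\otimes p)=u^1_{-(1)}u^2\otimes\dots\otimes u^1_{-(n-1)}u^n\otimes u^1_{-(n)}p_{(-1)}\otimes p_{(0)}u^1_+$, $\tau_0=\mathrm{id}$. $HH^\bullet(\mathcal U;P)$ and $HC^\bullet(\mathcal U;P)$ are the Hochschild and cyclic cohomologies of this cocyclic module. *)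

theory Defs
  imports Complex_Main "HOL-Algebra.AbelCoset" "HOL-Algebra.Module" "HOL-Library.Poly_Mapping"
begin

text \<open>
  Conventions. The data (algebras, coalgebras, modules) live on types: \<open>k\<close>-algebras on types of
  sort \<open>{ring, monoid_mult}\<close> (so that the zero algebra is not excluded), vector spaces on types
  of sort \<open>ab_group_add\<close>, together with an explicit scalar multiplication by the field \<open>'k\<close>.
  The spaces constructed from them (tensor products, cochains, cohomology) are records
  \<^typ>\<open>('k, 'v) module\<close> with an explicit carrier; their ring multiplication is never used.
\<close>

section \<open>Vector spaces and quotients\<close>

definition type_space :: "('k \<Rightarrow> 'v \<Rightarrow> 'v) \<Rightarrow> ('k, 'v::ab_group_add) module" where
  "type_space sc = \<lparr>carrier = UNIV, mult = undefined, one = undefined, zero = 0, add = (+), smult = sc\<rparr>"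

definition free_scale :: "'k::field \<Rightarrow> ('x \<Rightarrow>\<^sub>0 'k) \<Rightarrow> ('x \<Rightarrow>\<^sub>0 'k)" where
  "free_scale c = Poly_Mapping.map ((*) c)"

definition free_space :: "'x set \<Rightarrow> ('k::field, 'x \<Rightarrow>\<^sub>0 'k) module" where
  "free_space X = \<lparr>carrier = {f. Poly_Mapping.keys f \<subseteq> X}, mult = undefined, one = undefined,
     zero = 0, add = (+), smult = free_scale\<rparr>"

definition quotient_space :: "('k, 'v) module \<Rightarrow> 'v set \<Rightarrow> ('k, 'v set) module" where
  "quotient_space M W = \<lparr>carrier = a_rcosets\<^bsub>M\<^esub> W, mult = undefined, one = undefined,
     zero = W, add = set_add M, smult = (\<lambda>c X. \<Union>x\<in>X. W +>\<^bsub>M\<^esub> (c \<odot>\<^bsub>M\<^esub> x))\<rparr>"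

definition k_linear :: "('k, 'v) module \<Rightarrow> ('k, 'w) module \<Rightarrow> ('v \<Rightarrow> 'w) \<Rightarrow> bool" where
  "k_linear M N f \<longleftrightarrow> f \<in> carrier M \<rightarrow> carrier N
     \<and> (\<forall>x\<in>carrier M. \<forall>y\<in>carrier M. f (x \<oplus>\<^bsub>M\<^esub> y) = f x \<oplus>\<^bsub>N\<^esub> f y)
     \<and> (\<forall>c. \<forall>x\<in>carrier M. f (c \<odot>\<^bsub>M\<^esub> x) = c \<odot>\<^bsub>N\<^esub> f x)"

section \<open>Tensor products\<close>

abbreviation gen :: "'g \<Rightarrow> ('g \<Rightarrow>\<^sub>0 'k::field)" where
  "gen g \<equiv> Poly_Mapping.single g 1"

text \<open>
  \<open>tensor2 scX scY ra la\<close> is \<open>X \<otimes>\<^sub>R Y\<close>, where \<open>ra a x\<close> is the right action of \<open>a \<in> R\<close> on \<open>X\<close> and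
  \<open>la a y\<close> the left action on \<open>Y\<close>: the free vector space on pairs modulo bilinearity and
  \<open>x\<cdot>a \<otimes> y = x \<otimes> a\<cdot>y\<close>.
\<close>

definition tensor2_rel ::
  "('k::field \<Rightarrow> 'x::ab_group_add \<Rightarrow> 'x) \<Rightarrow> ('k \<Rightarrow> 'y::ab_group_add \<Rightarrow> 'y) \<Rightarrow>
   ('a \<Rightarrow> 'x \<Rightarrow> 'x) \<Rightarrow> ('a \<Rightarrow> 'y \<Rightarrow> 'y) \<Rightarrow> ('x \<times> 'y \<Rightarrow>\<^sub>0 'k) set" where
  "tensor2_rel scX scY ra la = Modules.module.span free_scale
     (  {gen (x + x', y) - gen (x, y) - gen (x', y) | x x' y. True}
      \<union> {gen (x, y + y') - gen (x, y) - gen (x, y') | x y y'. True}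
      \<union> {gen (scX c x, y) - free_scale c (gen (x, y)) | c x y. True}
      \<union> {gen (x, scY c y) - free_scale c (gen (x, y)) | c x y. True}
      \<union> {gen (ra a x, y) - gen (x, la a y) | a x y. True})"

definition tensor2 ::
  "('k::field \<Rightarrow> 'x::ab_group_add \<Rightarrow> 'x) \<Rightarrow> ('k \<Rightarrow> 'y::ab_group_add \<Rightarrow> 'y) \<Rightarrow>
   ('a \<Rightarrow> 'x \<Rightarrow> 'x) \<Rightarrow> ('a \<Rightarrow> 'y \<Rightarrow> 'y) \<Rightarrow> ('k, ('x \<times> 'y \<Rightarrow>\<^sub>0 'k) set) module" where
  "tensor2 scX scY ra la = quotient_space (free_space UNIV) (tensor2_rel scX scY ra la)"

text \<open>
  \<open>tensor_pow n scX ra la scM lm\<close> is \<open>X \<otimes>\<^sub>R \<dots> \<otimes>\<^sub>R X \<otimes>\<^sub>R M\<close> with \<open>n\<close> factors \<open>X\<close>; the generator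
  \<open>x\<^sup>1 \<otimes> \<dots> \<otimes> x\<^sup>n \<otimes> m\<close> is the pair \<open>([x\<^sup>1, \<dots>, x\<^sup>n], m)\<close>. For \<open>n = 0\<close> only the linearity
  relations in \<open>m\<close> remain, so the space is \<open>M\<close>.
\<close>

definition tensor_pow_rel ::
  "nat \<Rightarrow> ('k::field \<Rightarrow> 'x::ab_group_add \<Rightarrow> 'x) \<Rightarrow> ('a \<Rightarrow> 'x \<Rightarrow> 'x) \<Rightarrow> ('a \<Rightarrow> 'x \<Rightarrow> 'x) \<Rightarrow>
   ('k \<Rightarrow> 'm::ab_group_add \<Rightarrow> 'm) \<Rightarrow> ('a \<Rightarrow> 'm \<Rightarrow> 'm) \<Rightarrow> ('x list \<times> 'm \<Rightarrow>\<^sub>0 'k) set" where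
  "tensor_pow_rel n scX ra la scM lm = Modules.module.span free_scale
     (  {gen (xs[i := x + x'], m) - gen (xs[i := x], m) - gen (xs[i := x'], m) | xs i x x' m.
           length xs = n \<and> i < n}
      \<union> {gen (xs[i := scX c x], m) - free_scale c (gen (xs[i := x], m)) | xs i c x m.
           length xs = n \<and> i < n}
      \<union> {gen (xs, m + m') - gen (xs, m) - gen (xs, m') | xs m m'. length xs = n}
      \<union> {gen (xs, scM c m) - free_scale c (gen (xs, m)) | xs c m. length xs = n}
      \<union> {gen (xs[i := ra a (xs ! i)], m) - gen (xs[Suc i := la a (xs ! Suc i)], m) | xs i a m.
           length xs = n \<and> Suc i < n}
      \<union> {gen (xs[i := ra a (xs ! i)], m) - gen (xs, lm a m) | xs i a m.
           length xs = n \<and> Suc i = n})"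

definition tensor_pow ::
  "nat \<Rightarrow> ('k::field \<Rightarrow> 'x::ab_group_add \<Rightarrow> 'x) \<Rightarrow> ('a \<Rightarrow> 'x \<Rightarrow> 'x) \<Rightarrow> ('a \<Rightarrow> 'x \<Rightarrow> 'x) \<Rightarrow>
   ('k \<Rightarrow> 'm::ab_group_add \<Rightarrow> 'm) \<Rightarrow> ('a \<Rightarrow> 'm \<Rightarrow> 'm) \<Rightarrow> ('k, ('x list \<times> 'm \<Rightarrow>\<^sub>0 'k) set) module" where
  "tensor_pow n scX ra la scM lm =
     quotient_space (free_space {(xs, m). length xs = n}) (tensor_pow_rel n scX ra la scM lm)"

text \<open>The class of a generator in a quotient \<open>T\<close> of a free space; \<open>\<zero>\<^bsub>T\<^esub>\<close> is the subspace of relations.\<close>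

definition tens :: "('k::field, ('g \<Rightarrow>\<^sub>0 'k) set) module \<Rightarrow> 'g \<Rightarrow> ('g \<Rightarrow>\<^sub>0 'k) set" where
  "tens T g = \<zero>\<^bsub>T\<^esub> +>\<^bsub>free_space UNIV\<^esub> gen g"

text \<open>
  Sweedler notation. For an element \<open>X\<close> of a tensor product, \<open>lift T X (\<lambda>(u, v). f u v)\<close> is the value
  in \<open>T\<close> of \<open>\<Sum> f u\<^sub>i v\<^sub>i\<close> for \<open>X = \<Sum> u\<^sub>i \<otimes> v\<^sub>i\<close>, i.e. the common value over all representatives of
  the coset \<open>X\<close>. In nested occurrences the order matters: every \<open>f\<close> below is balanced
  on its own, possibly only because of the Takeuchi condition on an inner \<open>lift\<close>.
\<close>

definition lift :: "('k::field, 'w) module \<Rightarrow> ('g \<Rightarrow>\<^sub>0 'k) set \<Rightarrow> ('g \<Rightarrow> 'w) \<Rightarrow> 'w" where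
  "lift T X f = the_elem
     ((\<lambda>x. \<Oplus>\<^bsub>T\<^esub>g\<in>Poly_Mapping.keys x. Poly_Mapping.lookup x g \<odot>\<^bsub>T\<^esub> f g) ` X)"

section \<open>Algebras, coalgebras and comodules\<close>

definition k_algebra :: "('k::field \<Rightarrow> 'r::{ring,monoid_mult} \<Rightarrow> 'r) \<Rightarrow> bool" where
  "k_algebra sc \<longleftrightarrow> vector_space sc
     \<and> (\<forall>c x y. sc c x * y = sc c (x * y) \<and> x * sc c y = sc c (x * y))"

record (overloaded) ('k, 'c) coalg =
  scC :: "'k::zero \<Rightarrow> 'c \<Rightarrow> 'c"
  coprodC :: "'c \<Rightarrow> ('c \<times> 'c \<Rightarrow>\<^sub>0 'k) set"
  counitC :: "'c \<Rightarrow> 'k"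

definition CC :: "('k::field, 'c::ab_group_add) coalg \<Rightarrow> ('k, ('c \<times> 'c \<Rightarrow>\<^sub>0 'k) set) module" where
  "CC C = tensor2 (scC C) (scC C) (scC C) (scC C)"

text \<open>\<open>C\<^sup>\<otimes>\<^sup>n \<otimes> D\<close> over \<open>k\<close>.\<close>

definition CnD :: "('k::field, 'c::ab_group_add) coalg \<Rightarrow> ('k \<Rightarrow> 'd::ab_group_add \<Rightarrow> 'd) \<Rightarrow> nat \<Rightarrow>
    ('k, ('c list \<times> 'd \<Rightarrow>\<^sub>0 'k) set) module" where
  "CnD C scD n = tensor_pow n (scC C) (scC C) (scC C) scD scD"

definition coalgebra :: "('k::field, 'c::ab_group_add) coalg \<Rightarrow> bool" where
  "coalgebra C \<longleftrightarrow> vector_space (scC C)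
     \<and> k_linear (type_space (scC C)) (CC C) (coprodC C)
     \<and> k_linear (type_space (scC C)) (type_space (*)) (counitC C)
     \<and> (\<forall>x. let T = CnD C (scC C) 2 in
          lift T (coprodC C x) (\<lambda>(a, b). lift T (coprodC C a) (\<lambda>(a', a''). tens T ([a', a''], b)))
        = lift T (coprodC C x) (\<lambda>(a, b). lift T (coprodC C b) (\<lambda>(b', b''). tens T ([a, b'], b''))))
     \<and> (\<forall>x. lift (type_space (scC C)) (coprodC C x) (\<lambda>(a, b). scC C (counitC C a) b) = x)
     \<and> (\<forall>x. lift (type_space (scC C)) (coprodC C x) (\<lambda>(a, b). scC C (counitC C b) a) = x)"

definition cocommutative :: "('k::field, 'c::ab_group_add) coalg \<Rightarrow> bool" where
  "cocommutative C \<longleftrightarrow>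
     (\<forall>x. lift (CC C) (coprodC C x) (\<lambda>(a, b). tens (CC C) (b, a)) = coprodC C x)"

record (overloaded) ('k, 'c, 'd) comod =
  scD :: "'k::zero \<Rightarrow> 'd \<Rightarrow> 'd"
  coactD :: "'d \<Rightarrow> ('d \<times> 'c \<Rightarrow>\<^sub>0 'k) set"

definition DC :: "('k::field, 'c::ab_group_add) coalg \<Rightarrow> ('k, 'c, 'd::ab_group_add) comod \<Rightarrow>
    ('k, ('d \<times> 'c \<Rightarrow>\<^sub>0 'k) set) module" where
  "DC C D = tensor2 (scD D) (scC C) (scD D) (scC C)"

text \<open>In the coassociativity law, \<open>d \<otimes> c \<otimes> c'\<close> is encoded as \<open>([c, c'], d)\<close>.\<close>

definition right_comodule ::
  "('k::field, 'c::ab_group_add) coalg \<Rightarrow> ('k, 'c, 'd::ab_group_add) comod \<Rightarrow> bool" where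
  "right_comodule C D \<longleftrightarrow> vector_space (scD D)
     \<and> k_linear (type_space (scD D)) (DC C D) (coactD D)
     \<and> (\<forall>y. let T = CnD C (scD D) 2 in
          lift T (coactD D y) (\<lambda>(d, c). lift T (coactD D d) (\<lambda>(d', c'). tens T ([c', c], d')))
        = lift T (coactD D y) (\<lambda>(d, c). lift T (coprodC C c) (\<lambda>(c', c''). tens T ([c', c''], d))))
     \<and> (\<forall>y. lift (type_space (scD D)) (coactD D y) (\<lambda>(d, c). scD D (counitC C c) d) = y)"

text \<open>
  The iterated coaction \<open>y\<^sub>(\<^sub>0\<^sub>) \<otimes> y\<^sub>(\<^sub>1\<^sub>) \<otimes> \<dots> \<otimes> y\<^sub>(\<^sub>n\<^sub>)\<close>, encoded as \<open>([y\<^sub>(\<^sub>1\<^sub>), \<dots>, y\<^sub>(\<^sub>n\<^sub>)], y\<^sub>(\<^sub>0\<^sub>))\<close>.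
\<close>

primrec iter_coact :: "('k::field, 'c::ab_group_add) coalg \<Rightarrow> ('k, 'c, 'd::ab_group_add) comod \<Rightarrow>
    nat \<Rightarrow> 'd \<Rightarrow> ('c list \<times> 'd \<Rightarrow>\<^sub>0 'k) set" where
  "iter_coact C D 0 y = tens (CnD C (scD D) 0) ([], y)"
| "iter_coact C D (Suc n) y = (let T = CnD C (scD D) (Suc n) in
     lift T (coactD D y) (\<lambda>(d, c). lift T (iter_coact C D n d) (\<lambda>(cs, d'). tens T (cs @ [c], d'))))"

section \<open>Hopf algebroids\<close>

record (overloaded) ('k, 'u, 'a) hopf =
  scU :: "'k::zero \<Rightarrow> 'u \<Rightarrow> 'u"
  scA :: "'k \<Rightarrow> 'a \<Rightarrow> 'a"
  src :: "'a \<Rightarrow> 'u"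
  tgt :: "'a \<Rightarrow> 'u"
  coprod :: "'u \<Rightarrow> ('u \<times> 'u \<Rightarrow>\<^sub>0 'k) set"
  counit :: "'u \<Rightarrow> 'a"
  antipode :: "'u \<Rightarrow> 'u"

type_synonym ('k, 'u) tensor_sq = "('k, ('u \<times> 'u \<Rightarrow>\<^sub>0 'k) set) module"

text \<open>\<open>U \<otimes>\<^sub>A U\<close> with \<open>t(a)u \<otimes> v = u \<otimes> s(a)v\<close>.\<close>

definition UU :: "('k::field, 'u::{ring,monoid_mult}, 'a) hopf \<Rightarrow> ('k, 'u) tensor_sq" where
  "UU H = tensor2 (scU H) (scU H) (\<lambda>a u. tgt H a * u) (\<lambda>a u. src H a * u)"

text \<open>\<open>U \<otimes>\<^bsub>A\<^sup>o\<^sup>p\<^esub> U\<close> with \<open>u t(a) \<otimes> v = u \<otimes> t(a)v\<close>.\<close>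

definition UopU :: "('k::field, 'u::{ring,monoid_mult}, 'a) hopf \<Rightarrow> ('k, 'u) tensor_sq" where
  "UopU H = tensor2 (scU H) (scU H) (\<lambda>a u. u * tgt H a) (\<lambda>a u. tgt H a * u)"

text \<open>The \<open>(n+1)\<close>-fold tensor power \<open>U \<otimes>\<^sub>A \<dots> \<otimes>\<^sub>A U\<close>; the last factor is the second component.\<close>

definition UnU :: "('k::field, 'u::{ring,monoid_mult}, 'a) hopf \<Rightarrow> nat \<Rightarrow>
    ('k, ('u list \<times> 'u \<Rightarrow>\<^sub>0 'k) set) module" where
  "UnU H n = tensor_pow n (scU H) (\<lambda>a u. tgt H a * u) (\<lambda>a u. src H a * u)
     (scU H) (\<lambda>a u. src H a * u)"

definition left_bialgebroid ::
  "('k::field, 'u::{ring,monoid_mult}, 'a::{ring,monoid_mult}) hopf \<Rightarrow> bool" where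
  "left_bialgebroid H \<longleftrightarrow>
     (let s = src H; t = tgt H; \<Delta> = coprod H; \<epsilon> = counit H; U = type_space (scU H);
          A = type_space (scA H); T = UU H in
       k_algebra (scU H) \<and> k_algebra (scA H)
     \<and> k_linear A U s \<and> s 1 = 1 \<and> (\<forall>a b. s (a * b) = s a * s b)
     \<and> k_linear A U t \<and> t 1 = 1 \<and> (\<forall>a b. t (a * b) = t b * t a)
     \<and> (\<forall>a b. s a * t b = t b * s a)
     \<and> k_linear U T \<Delta>
     \<and> (\<forall>a b u. \<Delta> (s a * t b * u) = lift T (\<Delta> u) (\<lambda>(u1, u2). tens T (s a * u1, t b * u2)))
     \<and> k_linear U A \<epsilon>
     \<and> (\<forall>a b u. \<epsilon> (s a * t b * u) = a * \<epsilon> u * b)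
     \<and> (\<forall>u. lift (UnU H 2) (\<Delta> u) (\<lambda>(u1, u2). lift (UnU H 2) (\<Delta> u1) (\<lambda>(v, w). tens (UnU H 2) ([v, w], u2)))
          = lift (UnU H 2) (\<Delta> u) (\<lambda>(u1, u2). lift (UnU H 2) (\<Delta> u2) (\<lambda>(v, w). tens (UnU H 2) ([u1, v], w))))
     \<and> (\<forall>u. lift U (\<Delta> u) (\<lambda>(u1, u2). s (\<epsilon> u1) * u2) = u)
     \<and> (\<forall>u. lift U (\<Delta> u) (\<lambda>(u1, u2). t (\<epsilon> u2) * u1) = u)
     \<and> (\<forall>u a. lift T (\<Delta> u) (\<lambda>(u1, u2). tens T (u1 * t a, u2))
            = lift T (\<Delta> u) (\<lambda>(u1, u2). tens T (u1, u2 * s a)))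
     \<and> \<Delta> 1 = tens T (1, 1)
     \<and> (\<forall>u v. \<Delta> (u * v) = lift T (\<Delta> v) (\<lambda>(v1, v2). lift T (\<Delta> u) (\<lambda>(u1, u2). tens T (u1 * v1, u2 * v2))))
     \<and> (\<forall>u v. \<epsilon> (u * s (\<epsilon> v)) = \<epsilon> (u * v) \<and> \<epsilon> (u * t (\<epsilon> v)) = \<epsilon> (u * v)))"

definition hopf_algebroid ::
  "('k::field, 'u::{ring,monoid_mult}, 'a::{ring,monoid_mult}) hopf \<Rightarrow> bool" where
  "hopf_algebroid H \<longleftrightarrow> left_bialgebroid H
     \<and> (let S = antipode H; \<Delta> = coprod H; T = UU H in
       k_linear (type_space (scU H)) (type_space (scU H)) S
     \<and> S 1 = 1 \<and> (\<forall>u v. S (u * v) = S v * S u) \<and> (\<forall>u. S (S u) = u)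
     \<and> (\<forall>a. S (tgt H a) = src H a)
     \<and> (\<forall>u. lift T (\<Delta> u) (\<lambda>(u1, u2). lift T (\<Delta> (S u1)) (\<lambda>(v, w). tens T (v * u2, w)))
          = tens T (1, S u))
     \<and> (\<forall>u. lift T (\<Delta> u) (\<lambda>(u1, u2). lift T (\<Delta> (S u2)) (\<lambda>(v, w). tens T (v, w * u1)))
          = tens T (S u, 1)))"

definition hopf_beta :: "('k::field, 'u::{ring,monoid_mult}, 'a) hopf \<Rightarrow>
    ('u \<times> 'u \<Rightarrow>\<^sub>0 'k) set \<Rightarrow> ('u \<times> 'u \<Rightarrow>\<^sub>0 'k) set" where
  "hopf_beta H X = lift (UU H) X
     (\<lambda>(u, v). lift (UU H) (coprod H u) (\<lambda>(u1, u2). tens (UU H) (u1, u2 * v)))"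

text \<open>\<open>u\<^sub>+ \<otimes> u\<^sub>-\<close>\<close>

definition translation :: "('k::field, 'u::{ring,monoid_mult}, 'a) hopf \<Rightarrow>
    'u \<Rightarrow> ('u \<times> 'u \<Rightarrow>\<^sub>0 'k) set" where
  "translation H u = inv_into (carrier (UopU H)) (hopf_beta H) (tens (UU H) (u, 1))"

text \<open>\<open>u\<^sub>(\<^sub>1\<^sub>) \<otimes> \<dots> \<otimes> u\<^sub>(\<^sub>n\<^sub>+\<^sub>1\<^sub>)\<close>\<close>

primrec iter_coprod :: "('k::field, 'u::{ring,monoid_mult}, 'a) hopf \<Rightarrow> nat \<Rightarrow>
    'u \<Rightarrow> ('u list \<times> 'u \<Rightarrow>\<^sub>0 'k) set" where
  "iter_coprod H 0 u = tens (UnU H 0) ([], u)"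
| "iter_coprod H (Suc n) u = (let T = UnU H (Suc n) in
     lift T (coprod H u) (\<lambda>(u1, u2). lift T (iter_coprod H n u2) (\<lambda>(vs, v). tens T (u1 # vs, v))))"

section \<open>SAYD modules\<close>

record (overloaded) ('k, 'u, 'a, 'p) saydm =
  scP :: "'k::zero \<Rightarrow> 'p \<Rightarrow> 'p"
  act :: "'p \<Rightarrow> 'u \<Rightarrow> 'p"
  lact :: "'a \<Rightarrow> 'p \<Rightarrow> 'p"
  coact :: "'p \<Rightarrow> ('u \<times> 'p \<Rightarrow>\<^sub>0 'k) set"

text \<open>\<open>C\<^sup>n(U; P)\<close>; \<open>C\<^sup>2(U; P)\<close> also serves as \<open>U \<otimes>\<^sub>A U \<otimes>\<^sub>A P\<close> in the coassociativity law of \<open>P\<close>.\<close>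

definition Cn :: "('k::field, 'u::{ring,monoid_mult}, 'a) hopf \<Rightarrow>
    ('k, 'u, 'a, 'p::ab_group_add) saydm \<Rightarrow> nat \<Rightarrow> ('k, ('u list \<times> 'p \<Rightarrow>\<^sub>0 'k) set) module" where
  "Cn H P n = tensor_pow n (scU H) (\<lambda>a u. tgt H a * u) (\<lambda>a u. src H a * u) (scP P) (lact P)"

definition UP :: "('k::field, 'u::{ring,monoid_mult}, 'a) hopf \<Rightarrow>
    ('k, 'u, 'a, 'p::ab_group_add) saydm \<Rightarrow> ('k, ('u \<times> 'p \<Rightarrow>\<^sub>0 'k) set) module" where
  "UP H P = tensor2 (scU H) (scP P) (\<lambda>a u. tgt H a * u) (lact P)"

text \<open>
  In the anti-Yetter--Drinfeld condition
  \<open>\<Delta>(pu) = u\<^sub>- p\<^sub>(\<^sub>-\<^sub>1\<^sub>) u\<^sub>+\<^sub>(\<^sub>1\<^sub>) \<otimes> p\<^sub>(\<^sub>0\<^sub>) u\<^sub>+\<^sub>(\<^sub>2\<^sub>)\<close> the right-hand side depends on how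
  \<open>u\<^sub>+\<^sub>(\<^sub>1\<^sub>) \<otimes> u\<^sub>+\<^sub>(\<^sub>2\<^sub>) \<otimes> u\<^sub>-\<close> and \<open>p\<^sub>(\<^sub>-\<^sub>1\<^sub>) \<otimes> p\<^sub>(\<^sub>0\<^sub>)\<close> are jointly represented: for a fixed representative of
  either of them the expression is in general not balanced in the other. It is evaluated on the
  representatives given by the identity
  \<open>u\<^sub>+\<^sub>(\<^sub>1\<^sub>) \<otimes> u\<^sub>+\<^sub>(\<^sub>2\<^sub>) \<otimes> u\<^sub>- = u\<^sub>(\<^sub>1\<^sub>) \<otimes> u\<^sub>(\<^sub>2\<^sub>)\<^sub>+ \<otimes> u\<^sub>(\<^sub>2\<^sub>)\<^sub>-\<close>, where it is well defined: for fixed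
  \<open>u\<^sub>(\<^sub>1\<^sub>), u\<^sub>(\<^sub>2\<^sub>)\<close> it is balanced in \<open>p\<^sub>(\<^sub>-\<^sub>1\<^sub>) \<otimes> p\<^sub>(\<^sub>0\<^sub>)\<close> since \<open>t(a)v\<^sub>+ \<otimes> v\<^sub>- = v\<^sub>+ \<otimes> v\<^sub>- t(a)\<close>, and then in
  \<open>u\<^sub>(\<^sub>1\<^sub>) \<otimes> u\<^sub>(\<^sub>2\<^sub>)\<close> since \<open>p\<^sub>(\<^sub>-\<^sub>1\<^sub>)t(a) \<otimes> p\<^sub>(\<^sub>0\<^sub>) = p\<^sub>(\<^sub>-\<^sub>1\<^sub>) \<otimes> p\<^sub>(\<^sub>0\<^sub>)s(a)\<close>.
\<close>

definition sayd_module :: "('k::field, 'u::{ring,monoid_mult}, 'a::{ring,monoid_mult}) hopf \<Rightarrow>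
    ('k, 'u, 'a, 'p::ab_group_add) saydm \<Rightarrow> bool" where
  "sayd_module H P \<longleftrightarrow>
     (let s = src H; t = tgt H; \<epsilon> = counit H; \<Delta>P = coact P; V = type_space (scP P);
          T = UP H P; T2 = Cn H P 2 in
       vector_space (scP P)
     \<and> (\<forall>u. k_linear V V (\<lambda>p. act P p u)) \<and> (\<forall>p. k_linear (type_space (scU H)) V (act P p))
     \<and> (\<forall>p. act P p 1 = p) \<and> (\<forall>p u v. act P (act P p u) v = act P p (u * v))
     \<and> (\<forall>a. k_linear V V (lact P a)) \<and> (\<forall>p. k_linear (type_space (scA H)) V (\<lambda>a. lact P a p))
     \<and> (\<forall>p. lact P 1 p = p) \<and> (\<forall>p a b. lact P a (lact P b p) = lact P (a * b) p)
     \<and> k_linear V T \<Delta>P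
     \<and> (\<forall>a p. \<Delta>P (lact P a p) = lift T (\<Delta>P p) (\<lambda>(q, p0). tens T (s a * q, p0)))
     \<and> (\<forall>p. lift T2 (\<Delta>P p) (\<lambda>(q, p0). lift T2 (coprod H q) (\<lambda>(q1, q2). tens T2 ([q1, q2], p0)))
          = lift T2 (\<Delta>P p) (\<lambda>(q, p0). lift T2 (\<Delta>P p0) (\<lambda>(q', p00). tens T2 ([q, q'], p00))))
     \<and> (\<forall>p. lift V (\<Delta>P p) (\<lambda>(q, p0). lact P (\<epsilon> q) p0) = p)
     \<and> (\<forall>p a b. act P p (s a * t b) = lact P b (lift V (\<Delta>P p) (\<lambda>(q, p0). lact P (\<epsilon> (q * s a)) p0)))
     \<and> (\<forall>p u. \<Delta>P (act P p u) =
          lift T (coprod H u) (\<lambda>(u1, u2). lift T (\<Delta>P p) (\<lambda>(q, p0).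
            lift T (translation H u2) (\<lambda>(u2p, u2m). tens T (u2m * q * u1, act P p0 u2p)))))
     \<and> (\<forall>p. lift V (\<Delta>P p) (\<lambda>(q, p0). act P p0 q) = p))"

section \<open>Measurings\<close>

definition algebra_measuring :: "('k::field, 'c::ab_group_add) coalg \<Rightarrow>
    ('k \<Rightarrow> 'r::{ring,monoid_mult} \<Rightarrow> 'r) \<Rightarrow> ('k \<Rightarrow> 'r'::{ring,monoid_mult} \<Rightarrow> 'r') \<Rightarrow>
    ('c \<Rightarrow> 'r \<Rightarrow> 'r') \<Rightarrow> bool" where
  "algebra_measuring C scR scR' \<psi> \<longleftrightarrow>
       (\<forall>x. k_linear (type_space scR) (type_space scR') (\<psi> x))
     \<and> (\<forall>a. k_linear (type_space (scC C)) (type_space scR') (\<lambda>x. \<psi> x a))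
     \<and> (\<forall>x a b. \<psi> x (a * b) = lift (type_space scR') (coprodC C x) (\<lambda>(x1, x2). \<psi> x1 a * \<psi> x2 b))
     \<and> (\<forall>x. \<psi> x 1 = scR' (counitC C x) 1)"

definition hopf_measuring :: "('k::field, 'c::ab_group_add) coalg \<Rightarrow>
    ('k, 'u::{ring,monoid_mult}, 'a::{ring,monoid_mult}) hopf \<Rightarrow>
    ('k, 'v::{ring,monoid_mult}, 'b::{ring,monoid_mult}) hopf \<Rightarrow>
    ('c \<Rightarrow> 'u \<Rightarrow> 'v) \<Rightarrow> ('c \<Rightarrow> 'a \<Rightarrow> 'b) \<Rightarrow> bool" where
  "hopf_measuring C H H' \<Psi> \<psi> \<longleftrightarrow>
       algebra_measuring C (scU H) (scU H') \<Psi>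
     \<and> algebra_measuring C (scA H) (scA H') \<psi>
     \<and> (\<forall>x a. \<Psi> x (src H a) = src H' (\<psi> x a))
     \<and> (\<forall>x a. \<Psi> x (tgt H a) = tgt H' (\<psi> x a))
     \<and> (\<forall>x u. \<Psi> x (antipode H u) = antipode H' (\<Psi> x u))
     \<and> (\<forall>x u. \<psi> x (counit H u) = counit H' (\<Psi> x u))
     \<and> (\<forall>x u. coprod H' (\<Psi> x u) = lift (UU H') (coprod H u)
          (\<lambda>(u1, u2). lift (UU H') (coprodC C x) (\<lambda>(x1, x2). tens (UU H') (\<Psi> x1 u1, \<Psi> x2 u2))))"

definition comodule_measuring ::
  "('k::field, 'c::ab_group_add) coalg \<Rightarrow> ('k, 'c, 'd::ab_group_add) comod \<Rightarrow>
   ('k, 'u::{ring,monoid_mult}, 'a) hopf \<Rightarrow> ('k, 'v::{ring,monoid_mult}, 'b) hopf \<Rightarrow>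
   ('k, 'u, 'a, 'p::ab_group_add) saydm \<Rightarrow> ('k, 'v, 'b, 'q::ab_group_add) saydm \<Rightarrow>
   ('c \<Rightarrow> 'u \<Rightarrow> 'v) \<Rightarrow> ('d \<Rightarrow> 'p \<Rightarrow> 'q) \<Rightarrow> bool" where
  "comodule_measuring C D H H' P P' \<Psi> \<Omega> \<longleftrightarrow>
       right_comodule C D
     \<and> (\<forall>y. k_linear (type_space (scP P)) (type_space (scP P')) (\<Omega> y))
     \<and> (\<forall>p. k_linear (type_space (scD D)) (type_space (scP P')) (\<lambda>y. \<Omega> y p))
     \<and> (\<forall>y p u. \<Omega> y (act P p u) =
          lift (type_space (scP P')) (coactD D y) (\<lambda>(y0, y1). act P' (\<Omega> y0 p) (\<Psi> y1 u)))
     \<and> (\<forall>y p. coact P' (\<Omega> y p) = lift (UP H' P') (coact P p)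
          (\<lambda>(q, p0). lift (UP H' P') (coactD D y) (\<lambda>(y0, y1). tens (UP H' P') (\<Psi> y1 q, \<Omega> y0 p0))))"

section \<open>Cocyclic modules and their cohomologies\<close>

text \<open>
  \<open>coface n i : C\<^sup>n \<rightarrow> C\<^sup>n\<^sup>+\<^sup>1\<close> for \<open>i \<le> n + 1\<close>, \<open>codegen n i : C\<^sup>n\<^sup>+\<^sup>1 \<rightarrow> C\<^sup>n\<close> for \<open>i \<le> n\<close>,
  \<open>cyc n : C\<^sup>n \<rightarrow> C\<^sup>n\<close>.
\<close>

record ('k, 'v) cocyclic =
  level :: "nat \<Rightarrow> ('k, 'v) module"
  coface :: "nat \<Rightarrow> nat \<Rightarrow> 'v \<Rightarrow> 'v"
  codegen :: "nat \<Rightarrow> nat \<Rightarrow> 'v \<Rightarrow> 'v"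
  cyc :: "nat \<Rightarrow> 'v \<Rightarrow> 'v"

definition cocyclic_morphism ::
  "('k, 'v) cocyclic \<Rightarrow> ('k, 'w) cocyclic \<Rightarrow> (nat \<Rightarrow> 'v \<Rightarrow> 'w) \<Rightarrow> bool" where
  "cocyclic_morphism M N f \<longleftrightarrow>
       (\<forall>n. k_linear (level M n) (level N n) (f n))
     \<and> (\<forall>n i x. i \<le> Suc n \<longrightarrow> x \<in> carrier (level M n) \<longrightarrow>
          f (Suc n) (coface M n i x) = coface N n i (f n x))
     \<and> (\<forall>n i x. i \<le> n \<longrightarrow> x \<in> carrier (level M (Suc n)) \<longrightarrow>
          f n (codegen M n i x) = codegen N n i (f (Suc n) x))
     \<and> (\<forall>n x. x \<in> carrier (level M n) \<longrightarrow> f n (cyc M n x) = cyc N n (f n x))"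

definition cocycles :: "(nat \<Rightarrow> ('k, 'v) module) \<Rightarrow> (nat \<Rightarrow> 'v \<Rightarrow> 'v) \<Rightarrow> nat \<Rightarrow> 'v set" where
  "cocycles X d n = {x \<in> carrier (X n). d n x = \<zero>\<^bsub>X (Suc n)\<^esub>}"

definition coboundaries :: "(nat \<Rightarrow> ('k, 'v) module) \<Rightarrow> (nat \<Rightarrow> 'v \<Rightarrow> 'v) \<Rightarrow> nat \<Rightarrow> 'v set" where
  "coboundaries X d n = (case n of 0 \<Rightarrow> {\<zero>\<^bsub>X 0\<^esub>} | Suc m \<Rightarrow> d m ` carrier (X m))"

definition cohomology ::
  "(nat \<Rightarrow> ('k, 'v) module) \<Rightarrow> (nat \<Rightarrow> 'v \<Rightarrow> 'v) \<Rightarrow> nat \<Rightarrow> ('k, 'v set) module" where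
  "cohomology X d n = quotient_space ((X n)\<lparr>carrier := cocycles X d n\<rparr>) (coboundaries X d n)"

definition cohomology_class ::
  "(nat \<Rightarrow> ('k, 'v) module) \<Rightarrow> (nat \<Rightarrow> 'v \<Rightarrow> 'v) \<Rightarrow> nat \<Rightarrow> 'v \<Rightarrow> 'v set" where
  "cohomology_class X d n z = coboundaries X d n +>\<^bsub>X n\<^esub> z"

definition induces_on_cohomology ::
  "(nat \<Rightarrow> ('k, 'v) module) \<Rightarrow> (nat \<Rightarrow> 'v \<Rightarrow> 'v) \<Rightarrow> (nat \<Rightarrow> ('k, 'w) module) \<Rightarrow> (nat \<Rightarrow> 'w \<Rightarrow> 'w) \<Rightarrow>
   (nat \<Rightarrow> 'v \<Rightarrow> 'w) \<Rightarrow> bool" where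
  "induces_on_cohomology X d Y e f \<longleftrightarrow>
     (\<forall>n. \<exists>F. k_linear (cohomology X d n) (cohomology Y e n) F
        \<and> (\<forall>z\<in>cocycles X d n. f n z \<in> cocycles Y e n
             \<and> F (cohomology_class X d n z) = cohomology_class Y e n (f n z)))"

definition hoch_d :: "('k::field, 'v) cocyclic \<Rightarrow> nat \<Rightarrow> 'v \<Rightarrow> 'v" where
  "hoch_d M n x = (\<Oplus>\<^bsub>level M (Suc n)\<^esub>i\<in>{..Suc n}. (- 1) ^ i \<odot>\<^bsub>level M (Suc n)\<^esub> coface M n i x)"

text \<open>
  Cyclic cohomology (over an arbitrary field) is the cohomology of the total complex of the cyclic
  bicomplex: all columns are \<open>C\<^sup>\<bullet>\<close>; with \<open>\<lambda>\<^sub>n = (-1)\<^sup>n \<tau>\<^sub>n\<close>, the vertical differential is \<open>b\<close> on even and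
  \<open>-b'\<close> on odd columns, the horizontal one is \<open>1 - \<lambda>\<close> from even to odd and \<open>1 + \<lambda> + \<dots> + \<lambda>\<^sup>n\<close> from odd
  to even columns.
\<close>

definition hoch_d' :: "('k::field, 'v) cocyclic \<Rightarrow> nat \<Rightarrow> 'v \<Rightarrow> 'v" where
  "hoch_d' M n x = (\<Oplus>\<^bsub>level M (Suc n)\<^esub>i\<in>{..n}. (- 1) ^ i \<odot>\<^bsub>level M (Suc n)\<^esub> coface M n i x)"

definition signed_cyc :: "('k::field, 'v) cocyclic \<Rightarrow> nat \<Rightarrow> 'v \<Rightarrow> 'v" where
  "signed_cyc M n x = (- 1) ^ n \<odot>\<^bsub>level M n\<^esub> cyc M n x"

definition cyc_vert :: "('k::field, 'v) cocyclic \<Rightarrow> nat \<Rightarrow> nat \<Rightarrow> 'v \<Rightarrow> 'v" where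
  "cyc_vert M p q x = (if even p then hoch_d M q x else (- 1) \<odot>\<^bsub>level M (Suc q)\<^esub> hoch_d' M q x)"

definition cyc_horiz :: "('k::field, 'v) cocyclic \<Rightarrow> nat \<Rightarrow> nat \<Rightarrow> 'v \<Rightarrow> 'v" where
  "cyc_horiz M p q x = (if even p then x \<oplus>\<^bsub>level M q\<^esub> (- 1) \<odot>\<^bsub>level M q\<^esub> signed_cyc M q x
     else (\<Oplus>\<^bsub>level M q\<^esub>i\<in>{..q}. (signed_cyc M q ^^ i) x))"

text \<open>An element of \<open>Tot\<^sup>n\<close> is a family \<open>(x\<^sub>q)\<^sub>q\<^sub>\<le>\<^sub>n\<close> with \<open>x\<^sub>q \<in> C\<^sup>q\<close> in column \<open>n - q\<close>.\<close>

definition cyc_tot :: "('k, 'v) cocyclic \<Rightarrow> nat \<Rightarrow> ('k, nat \<Rightarrow> 'v) module" where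
  "cyc_tot M n = \<lparr>carrier = (\<Pi>\<^sub>E q\<in>{..n}. carrier (level M q)), mult = undefined, one = undefined,
     zero = (\<lambda>q\<in>{..n}. \<zero>\<^bsub>level M q\<^esub>), add = (\<lambda>x y. \<lambda>q\<in>{..n}. x q \<oplus>\<^bsub>level M q\<^esub> y q),
     smult = (\<lambda>c x. \<lambda>q\<in>{..n}. c \<odot>\<^bsub>level M q\<^esub> x q)\<rparr>"

definition cyc_tot_d :: "('k::field, 'v) cocyclic \<Rightarrow> nat \<Rightarrow> (nat \<Rightarrow> 'v) \<Rightarrow> (nat \<Rightarrow> 'v)" where
  "cyc_tot_d M n x = (\<lambda>q\<in>{..Suc n}.
       (if q = 0 then \<zero>\<^bsub>level M q\<^esub> else cyc_vert M (Suc n - q) (q - 1) (x (q - 1)))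
     \<oplus>\<^bsub>level M q\<^esub>
       (if q = Suc n then \<zero>\<^bsub>level M q\<^esub> else cyc_horiz M (n - q) q (x q)))"

definition induces_on_HH ::
  "('k::field, 'v) cocyclic \<Rightarrow> ('k, 'w) cocyclic \<Rightarrow> (nat \<Rightarrow> 'v \<Rightarrow> 'w) \<Rightarrow> bool" where
  "induces_on_HH M N f \<longleftrightarrow>
     induces_on_cohomology (level M) (hoch_d M) (level N) (hoch_d N) f"

definition induces_on_HC ::
  "('k::field, 'v) cocyclic \<Rightarrow> ('k, 'w) cocyclic \<Rightarrow> (nat \<Rightarrow> 'v \<Rightarrow> 'w) \<Rightarrow> bool" where
  "induces_on_HC M N f \<longleftrightarrow>
     induces_on_cohomology (cyc_tot M) (cyc_tot_d M) (cyc_tot N) (cyc_tot_d N)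
       (\<lambda>n x. \<lambda>q\<in>{..n}. f q (x q))"

section \<open>The cocyclic module of a Hopf algebroid with coefficients\<close>

definition hopf_coface :: "('k::field, 'u::{ring,monoid_mult}, 'a) hopf \<Rightarrow>
    ('k, 'u, 'a, 'p::ab_group_add) saydm \<Rightarrow> nat \<Rightarrow> nat \<Rightarrow>
    ('u list \<times> 'p \<Rightarrow>\<^sub>0 'k) set \<Rightarrow> ('u list \<times> 'p \<Rightarrow>\<^sub>0 'k) set" where
  "hopf_coface H P n i X = (let T = Cn H P (Suc n) in lift T X (\<lambda>(us, p).
     if i = 0 then tens T (1 # us, p)
     else if i \<le> n then lift T (coprod H (us ! (i - 1)))
       (\<lambda>(v, w). tens T (take (i - 1) us @ [v, w] @ drop i us, p))
     else lift T (coact P p) (\<lambda>(q, p0). tens T (us @ [q], p0))))"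

definition hopf_codegen :: "('k::field, 'u::{ring,monoid_mult}, 'a) hopf \<Rightarrow>
    ('k, 'u, 'a, 'p::ab_group_add) saydm \<Rightarrow> nat \<Rightarrow> nat \<Rightarrow>
    ('u list \<times> 'p \<Rightarrow>\<^sub>0 'k) set \<Rightarrow> ('u list \<times> 'p \<Rightarrow>\<^sub>0 'k) set" where
  "hopf_codegen H P n i X = (let T = Cn H P n in lift T X (\<lambda>(us, p).
     if i < n then tens T
       (take i us @ [src H (counit H (us ! i)) * us ! Suc i] @ drop (Suc (Suc i)) us, p)
     else tens T (take n us, lact P (counit H (us ! n)) p)))"

definition hopf_cyc :: "('k::field, 'u::{ring,monoid_mult}, 'a) hopf \<Rightarrow>
    ('k, 'u, 'a, 'p::ab_group_add) saydm \<Rightarrow> nat \<Rightarrow>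
    ('u list \<times> 'p \<Rightarrow>\<^sub>0 'k) set \<Rightarrow> ('u list \<times> 'p \<Rightarrow>\<^sub>0 'k) set" where
  "hopf_cyc H P n X = (if n = 0 then X else (let T = Cn H P n in lift T X (\<lambda>(us, p).
     lift T (coact P p) (\<lambda>(q, p0). lift T (translation H (hd us)) (\<lambda>(up, um).
       lift T (iter_coprod H (n - 1) um) (\<lambda>(vs, v).
         tens T (map2 (*) vs (tl us) @ [v * q], act P p0 up)))))))"

definition hopf_cocyclic :: "('k::field, 'u::{ring,monoid_mult}, 'a) hopf \<Rightarrow>
    ('k, 'u, 'a, 'p::ab_group_add) saydm \<Rightarrow> ('k, ('u list \<times> 'p \<Rightarrow>\<^sub>0 'k) set) cocyclic" where
  "hopf_cocyclic H P = \<lparr>level = Cn H P, coface = hopf_coface H P, codegen = hopf_codegen H P,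
     cyc = hopf_cyc H P\<rparr>"

text \<open>\<open>y\<^sub>(\<^sub>1\<^sub>)(u\<^sup>1) \<otimes> \<dots> \<otimes> y\<^sub>(\<^sub>n\<^sub>)(u\<^sup>n) \<otimes> y\<^sub>(\<^sub>0\<^sub>)(p)\<close>\<close>

definition Omega_gen :: "('k::field, 'c::ab_group_add) coalg \<Rightarrow> ('k, 'c, 'd::ab_group_add) comod \<Rightarrow>
    ('k, 'v::{ring,monoid_mult}, 'b) hopf \<Rightarrow> ('k, 'v, 'b, 'q::ab_group_add) saydm \<Rightarrow>
    ('c \<Rightarrow> 'u \<Rightarrow> 'v) \<Rightarrow> ('d \<Rightarrow> 'p \<Rightarrow> 'q) \<Rightarrow> 'd \<Rightarrow> nat \<Rightarrow> 'u list \<Rightarrow> 'p \<Rightarrow> ('v list \<times> 'q \<Rightarrow>\<^sub>0 'k) set" where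
  "Omega_gen C D H' P' \<Psi> \<Omega> y n us p = (let T = Cn H' P' n in
     lift T (iter_coact C D n y) (\<lambda>(ys, y0). tens T (map2 \<Psi> ys us, \<Omega> y0 p)))"

definition Omega_bar :: "('k::field, 'c::ab_group_add) coalg \<Rightarrow> ('k, 'c, 'd::ab_group_add) comod \<Rightarrow>
    ('k, 'v::{ring,monoid_mult}, 'b) hopf \<Rightarrow> ('k, 'v, 'b, 'q::ab_group_add) saydm \<Rightarrow>
    ('c \<Rightarrow> 'u \<Rightarrow> 'v) \<Rightarrow> ('d \<Rightarrow> 'p \<Rightarrow> 'q) \<Rightarrow> 'd \<Rightarrow> nat \<Rightarrow>
    ('u list \<times> 'p \<Rightarrow>\<^sub>0 'k) set \<Rightarrow> ('v list \<times> 'q \<Rightarrow>\<^sub>0 'k) set" where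
  "Omega_bar C D H' P' \<Psi> \<Omega> y n X = lift (Cn H' P' n) X
     (\<lambda>(us, p). Omega_gen C D H' P' \<Psi> \<Omega> y n us p)"

end

theory Submission
  imports Defs
begin

text \<open>
  Since \<open>C\<close> is cocommutative, the legs \<open>y\<^sub>(\<^sub>1\<^sub>), \<dots>, y\<^sub>(\<^sub>n\<^sub>)\<close> of \<open>y \<in> D\<close> can be split off one at a time and in
  any order, and applying the coproduct to a leg amounts to splitting off one more leg. Hence the laws
  \<open>x(uv) = x\<^sub>(\<^sub>1\<^sub>)(u) x\<^sub>(\<^sub>2\<^sub>)(v)\<close>, \<open>\<Delta>'(x(u)) = x\<^sub>(\<^sub>1\<^sub>)(u\<^sub>(\<^sub>1\<^sub>)) \<otimes> x\<^sub>(\<^sub>2\<^sub>)(u\<^sub>(\<^sub>2\<^sub>))\<close> and their analogues for \<open>\<Omega>\<close> allow both sides of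
  each compatibility to be expanded into the same sum with one leg for every element of \<open>U\<close> that occurs.
  For \<open>\<tau>\<close> this requires \<open>x(u)\<^sub>+ \<otimes> x(u)\<^sub>- = x\<^sub>(\<^sub>1\<^sub>)(u\<^sub>+) \<otimes> x\<^sub>(\<^sub>2\<^sub>)(u\<^sub>-)\<close>. The antipode axioms give
  \<open>u\<^sub>+ \<otimes> u\<^sub>- = S(S(u)\<^sub>(\<^sub>2\<^sub>)) \<otimes> S(u)\<^sub>(\<^sub>1\<^sub>)\<close>, which involves only \<open>S\<close> and \<open>\<Delta>\<close>, and a measuring respects both.
\<close>

section \<open>Vector spaces given by records\<close>

text \<open>The obstacle is that a Sweedler expression is a nested \<open>lift\<close>, and
  \<open>lift\<close> is meaningful only if its body is balanced over the tensor product at hand.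
  Some bodies, such as those for the coproduct of a product and for \<tau>, are balanced only after
  an inner sum has been carried out. Therefore every element of a tensor product is replaced once
  and for all by a linearly chosen representative. Then \<open>lift\<close> becomes a finite sum
  \<open>lincomb\<close> over it, such sums can be interchanged freely, and balancedness matters
  only when one representative is traded for another. Identities are proved after applying an
  arbitrary balanced map into an arbitrary vector space. The class map \<open>tn\<close> is one such
  map, so nothing is lost, and the same lemma then also rewrites a part of a larger expression. Each
  compatibility with \<delta>, \<sigma>, \<tau> becomes an identity between functions of a list of
  factors, within reach of induction on the list or on the position in it.\<close>

locale vsp = abelian_group M for M :: "('k::field, 'v) module" (structure) +
  assumes smult_closed: "x \<in> carrier M \<Longrightarrow> c \<odot> x \<in> carrier M"
    and smult_l_distr: "x \<in> carrier M \<Longrightarrow> (a + b) \<odot> x = a \<odot> x \<oplus> b \<odot> x"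
    and smult_r_distr: "\<lbrakk>x \<in> carrier M; y \<in> carrier M\<rbrakk> \<Longrightarrow> a \<odot> (x \<oplus> y) = a \<odot> x \<oplus> a \<odot> y"
    and smult_assoc: "x \<in> carrier M \<Longrightarrow> (a * b) \<odot> x = a \<odot> (b \<odot> x)"
    and smult_one: "x \<in> carrier M \<Longrightarrow> 1 \<odot> x = x"

definition subsp :: "('k, 'v) module \<Rightarrow> 'v set \<Rightarrow> bool" where
  "subsp M W \<longleftrightarrow> W \<subseteq> carrier M \<and> \<zero>\<^bsub>M\<^esub> \<in> W
     \<and> (\<forall>x\<in>W. \<forall>y\<in>W. x \<oplus>\<^bsub>M\<^esub> y \<in> W) \<and> (\<forall>c. \<forall>x\<in>W. c \<odot>\<^bsub>M\<^esub> x \<in> W)"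

context vsp
begin

lemma smult_zero_left: "x \<in> carrier M \<Longrightarrow> 0 \<odot> x = \<zero>"
  using smult_l_distr[of x 0 0] smult_closed[of x 0] by (metis add.l_cancel_one' add_0)

lemma smult_zero_right: "c \<odot> \<zero> = \<zero>"
  using smult_r_distr[of \<zero> \<zero> c] smult_closed[of \<zero> c] by (metis add.l_cancel_one' l_zero zero_closed)

lemma smult_minus_one: "x \<in> carrier M \<Longrightarrow> (- 1) \<odot> x = \<ominus> x"
  using smult_l_distr[of x "- 1" 1] smult_zero_left[of x] smult_closed[of x] smult_one[of x]
  by (metis add.inv_equality add.left_inverse)

lemma coset_eq: "W +> x = (\<lambda>w. w \<oplus> x) ` W"
  by (auto simp: a_r_coset_def r_coset_def)

text \<open>Cohomology divides a space whose carrier has been cut down to the cocycles. A coset only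
  uses addition, so the smaller carrier changes which cosets occur but not what they are; hence the
  \<open>Z\<close> here and in the lemmas below.\<close>

lemma rcosets_eq: "a_rcosets\<^bsub>M\<lparr>carrier := Z\<rparr>\<^esub> W = (\<lambda>x. W +> x) ` Z"
  by (auto simp: A_RCOSETS_defs a_r_coset_def r_coset_def)

lemma subsp_minus: "subsp M W \<Longrightarrow> x \<in> W \<Longrightarrow> \<ominus> x \<in> W"
  by (metis subsp_def smult_minus_one subsetD)

lemma coset_eqI:
  assumes W: "subsp M W" and w: "w \<in> W" and y: "y \<in> carrier M"
  shows "W +> (w \<oplus> y) = W +> y"
proof -
  have sub: "W \<subseteq> carrier M" using W by (simp add: subsp_def)
  have "v \<oplus> (w \<oplus> y) \<in> W +> y" if "v \<in> W" for v
    using that W w y sub by (auto simp: coset_eq subsp_def a_assoc[symmetric] subset_iff)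
  moreover have "v \<oplus> y \<in> W +> (w \<oplus> y)" if "v \<in> W" for v
  proof -
    have "v \<oplus> y = (v \<oplus> \<ominus> w) \<oplus> (w \<oplus> y)"
      using that w y sub by (simp add: a_assoc subset_iff r_neg1)
    moreover have "v \<oplus> \<ominus> w \<in> W"
      using that w W subsp_minus[OF W w] by (simp add: subsp_def)
    ultimately show ?thesis by (auto simp: coset_eq)
  qed
  ultimately show ?thesis by (auto simp: coset_eq)
qed

lemma mem_coset_self: "subsp M W \<Longrightarrow> x \<in> carrier M \<Longrightarrow> x \<in> W +> x"
  by (force simp: coset_eq subsp_def)

lemma coset_add:
  assumes W: "subsp M W" and x: "x \<in> carrier M" and y: "y \<in> carrier M"
  shows "set_add (M\<lparr>carrier := Z\<rparr>) (W +> x) (W +> y) = W +> (x \<oplus> y)"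
proof -
  have sub: "W \<subseteq> carrier M" using W by (simp add: subsp_def)
  have 1: "(v \<oplus> x) \<oplus> (w \<oplus> y) = (v \<oplus> w) \<oplus> (x \<oplus> y)" if "v \<in> W" "w \<in> W" for v w
    using that x y sub by (simp add: a_ac subset_iff)
  have 2: "v \<oplus> (x \<oplus> y) = (v \<oplus> x) \<oplus> (\<zero> \<oplus> y)" if "v \<in> W" for v
    using that x y sub by (simp add: a_ac subset_iff)
  have "set_add (M\<lparr>carrier := Z\<rparr>) (W +> x) (W +> y) = (\<Union>v\<in>W. \<Union>w\<in>W. {(v \<oplus> x) \<oplus> (w \<oplus> y)})"
    by (auto simp: set_add_def set_mult_def coset_eq)
  also have "\<dots> = W +> (x \<oplus> y)"
  proof (intro equalityI subsetI)
    fix z assume "z \<in> (\<Union>v\<in>W. \<Union>w\<in>W. {(v \<oplus> x) \<oplus> (w \<oplus> y)})"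
    then obtain v w where "v \<in> W" "w \<in> W" "z = (v \<oplus> x) \<oplus> (w \<oplus> y)" by blast
    then show "z \<in> W +> (x \<oplus> y)" using 1 W by (simp add: coset_eq subsp_def)
  next
    fix z assume "z \<in> W +> (x \<oplus> y)"
    then obtain v where "v \<in> W" "z = v \<oplus> (x \<oplus> y)" by (auto simp: coset_eq)
    moreover have "\<zero> \<in> W" using W by (simp add: subsp_def)
    ultimately show "z \<in> (\<Union>v\<in>W. \<Union>w\<in>W. {(v \<oplus> x) \<oplus> (w \<oplus> y)})" using 2 by blast
  qed
  finally show ?thesis .
qed

lemma coset_smult:
  assumes W: "subsp M W" and x: "x \<in> carrier M"
  shows "(\<Union>z\<in>W +> x. W +>\<^bsub>M\<lparr>carrier := Z\<rparr>\<^esub> (c \<odot> z)) = W +> (c \<odot> x)"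
proof -
  have eq: "W +>\<^bsub>M\<lparr>carrier := Z\<rparr>\<^esub> z = W +> z" for z
    by (simp add: a_r_coset_def r_coset_def)
  have *: "W +> (c \<odot> z) = W +> (c \<odot> x)" if "z \<in> W +> x" for z
  proof -
    from that obtain w where w: "w \<in> W" "z = w \<oplus> x" by (auto simp: coset_eq)
    then have "c \<odot> z = c \<odot> w \<oplus> c \<odot> x" using W x by (auto simp: subsp_def smult_r_distr)
    then show ?thesis using coset_eqI[OF W, of "c \<odot> w" "c \<odot> x"] w W x
      by (simp add: subsp_def smult_closed)
  qed
  have "(\<Union>z\<in>W +> x. W +>\<^bsub>M\<lparr>carrier := Z\<rparr>\<^esub> (c \<odot> z)) = (\<Union>z\<in>W +> x. W +> (c \<odot> x))"
    unfolding eq by (intro SUP_cong refl *)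
  also have "\<dots> = W +> (c \<odot> x)" using mem_coset_self[OF W x] by blast
  finally show ?thesis .
qed

lemma quotient_carrier: "carrier (quotient_space (M\<lparr>carrier := Z\<rparr>) W) = (\<lambda>x. W +> x) ` Z"
  by (simp add: quotient_space_def rcosets_eq)

lemma quotient_add:
  assumes "subsp M W" "x \<in> carrier M" "y \<in> carrier M"
  shows "(W +> x) \<oplus>\<^bsub>quotient_space (M\<lparr>carrier := Z\<rparr>) W\<^esub> (W +> y) = W +> (x \<oplus> y)"
  by (simp add: quotient_space_def coset_add assms)

lemma quotient_smult:
  assumes "subsp M W" "x \<in> carrier M"
  shows "c \<odot>\<^bsub>quotient_space (M\<lparr>carrier := Z\<rparr>) W\<^esub> (W +> x) = W +> (c \<odot> x)"
  by (simp add: quotient_space_def coset_smult assms)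

lemma vsp_quotient:
  assumes Z: "subsp M Z" and W: "subsp M W"
  shows "vsp (quotient_space (M\<lparr>carrier := Z\<rparr>) W)"
proof -
  let ?Q = "quotient_space (M\<lparr>carrier := Z\<rparr>) W"
  have ZM: "z \<in> Z \<Longrightarrow> z \<in> carrier M" for z using Z by (auto simp: subsp_def)
  note c = quotient_carrier[of Z W]
  have z: "\<zero>\<^bsub>?Q\<^esub> = W +> \<zero>"
    using W by (auto simp: quotient_space_def coset_eq subsp_def image_iff subset_iff)
  have a: "(W +> x) \<oplus>\<^bsub>?Q\<^esub> (W +> y) = W +> (x \<oplus> y)" if "x \<in> Z" "y \<in> Z" for x y
    using that ZM by (simp add: quotient_add[OF W])
  have s: "k \<odot>\<^bsub>?Q\<^esub> (W +> x) = W +> (k \<odot> x)" if "x \<in> Z" for x k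
    using that ZM by (simp add: quotient_smult[OF W])
  have Z0: "\<zero> \<in> Z" and Za: "\<And>x y. x \<in> Z \<Longrightarrow> y \<in> Z \<Longrightarrow> x \<oplus> y \<in> Z"
    and Zs: "\<And>c x. x \<in> Z \<Longrightarrow> c \<odot> x \<in> Z" using Z by (auto simp: subsp_def)
  have "abelian_group ?Q"
  proof (rule abelian_groupI)
    fix X assume "X \<in> carrier ?Q"
    then obtain x where x: "x \<in> Z" "X = W +> x" by (auto simp: c)
    then have "\<ominus> x \<in> Z" using Z by (simp add: subsp_minus)
    then show "\<exists>Y\<in>carrier ?Q. Y \<oplus>\<^bsub>?Q\<^esub> X = \<zero>\<^bsub>?Q\<^esub>"
      using x ZM by (auto simp: c z a l_neg intro!: bexI[of _ "\<ominus> x"])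
  qed (auto simp: c z a Z0 Za ZM a_ac l_zero)
  then show ?thesis
    unfolding vsp_def vsp_axioms_def
    by (auto simp: c s a Z0 Za Zs ZM smult_l_distr smult_r_distr smult_assoc smult_one)
qed

text \<open>The bridge from sums in a record to sums on a type. Additivity is asked for on the
  carrier only, which is all that \<open>nf\<close> offers.\<close>

lemma finsum_hom:
  assumes add: "\<And>x y. x \<in> carrier M \<Longrightarrow> y \<in> carrier M \<Longrightarrow> h (x \<oplus> y) = h x + h y"
    and A: "finite A" and f: "\<And>g. g \<in> A \<Longrightarrow> f g \<in> carrier M"
  shows "(h (finsum M f A) :: 'b::ab_group_add) = (\<Sum>g\<in>A. h (f g))"
proof -
  have "h \<zero> = 0" using add[of \<zero> \<zero>] by simp
  with A f show ?thesis
    by (induction A rule: finite_induct) (auto simp: finsum_insert finsum_closed add Pi_def)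
qed

end

lemma vsp_type_space:
  assumes "vector_space sc"
  shows "vsp (type_space sc)"
proof -
  interpret vector_space sc by (fact assms)
  have "abelian_group (type_space sc)"
  proof (rule abelian_groupI)
    fix x assume "x \<in> carrier (type_space sc)"
    show "\<exists>y\<in>carrier (type_space sc). y \<oplus>\<^bsub>type_space sc\<^esub> x = \<zero>\<^bsub>type_space sc\<^esub>"
      by (rule bexI[of _ "- x"]) (simp_all add: type_space_def)
  qed (simp_all add: type_space_def add_ac)
  then show ?thesis
    unfolding vsp_def vsp_axioms_def
    by (simp add: type_space_def scale_left_distrib scale_right_distrib)
qed

abbreviation lin :: "('k \<Rightarrow> 'v \<Rightarrow> 'v) \<Rightarrow> ('k \<Rightarrow> 'w \<Rightarrow> 'w) \<Rightarrow> ('v::ab_group_add \<Rightarrow> 'w::ab_group_add) \<Rightarrow> bool" where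
  "lin s1 s2 f \<equiv> k_linear (type_space s1) (type_space s2) f"

lemma lin_iff: "lin s1 s2 f \<longleftrightarrow> (\<forall>x y. f (x + y) = f x + f y) \<and> (\<forall>c x. f (s1 c x) = s2 c (f x))"
  by (simp add: k_linear_def type_space_def)

lemma lin_add: "lin s1 s2 f \<Longrightarrow> f (x + y) = f x + f y"
  and lin_scale: "lin s1 s2 f \<Longrightarrow> f (s1 c x) = s2 c (f x)"
  by (simp_all add: lin_iff)

lemma lin_zero: "lin s1 s2 f \<Longrightarrow> f 0 = 0"
  by (metis add_cancel_right_right lin_add)

lemma lin_diff: "lin s1 s2 f \<Longrightarrow> f (x - y) = f x - f y"
  by (metis add_diff_cancel_right' diff_add_cancel lin_add)

lemma lin_sum: "lin s1 s2 f \<Longrightarrow> f (sum g A) = (\<Sum>a\<in>A. f (g a))"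
  by (induction A rule: infinite_finite_induct) (auto simp: lin_zero lin_add)

lemma lin_id: "lin s s (\<lambda>x. x)"
  by (simp add: lin_iff)

lemma lin_compose: "lin s1 s2 f \<Longrightarrow> lin s2 s3 g \<Longrightarrow> lin s1 s3 (\<lambda>x. g (f x))"
  by (simp add: lin_iff)

section \<open>Linear combinations\<close>

text \<open>The linear extension of \<open>f\<close> to the free space, that is, what
  \<open>lift\<close> computes on one representative when the target is a type.\<close>

definition lincomb :: "('k::field \<Rightarrow> 'w \<Rightarrow> 'w) \<Rightarrow> ('g \<Rightarrow> 'w::ab_group_add) \<Rightarrow> ('g \<Rightarrow>\<^sub>0 'k) \<Rightarrow> 'w" where
  "lincomb sc f x = (\<Sum>g\<in>Poly_Mapping.keys x. sc (Poly_Mapping.lookup x g) (f g))"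

lemma lookup_free_scale: "Poly_Mapping.lookup (free_scale c x) g = c * Poly_Mapping.lookup x g"
  by (simp add: free_scale_def Poly_Mapping.map.rep_eq when_def)

lemma vector_space_free: "vector_space free_scale"
  by unfold_locales
    (auto intro!: poly_mapping_eqI simp: lookup_free_scale lookup_add algebra_simps)

lemma keys_free_scale: "Poly_Mapping.keys (free_scale c x) \<subseteq> Poly_Mapping.keys x"
  by (auto simp: in_keys_iff lookup_free_scale)

context
  fixes sc :: "'k::field \<Rightarrow> 'w \<Rightarrow> 'w::ab_group_add"
  assumes V: "vector_space sc"
begin

interpretation V: vector_space sc by (fact V)

lemma lincomb_superset:
  assumes "finite A" "Poly_Mapping.keys x \<subseteq> A"
  shows "lincomb sc f x = (\<Sum>g\<in>A. sc (Poly_Mapping.lookup x g) (f g))"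
  unfolding lincomb_def using assms
  by (intro sum.mono_neutral_left) (auto simp: in_keys_iff)

lemma lincomb_lin: "lin free_scale sc (lincomb sc f)"
  unfolding lin_iff
proof (intro conjI allI)
  fix x y :: "'g \<Rightarrow>\<^sub>0 'k" and f :: "'g \<Rightarrow> 'w" and c
  let ?A = "Poly_Mapping.keys x \<union> Poly_Mapping.keys y"
  show "lincomb sc f (x + y) = lincomb sc f x + lincomb sc f y"
    using keys_add[of x y]
    by (simp add: lincomb_superset[where A = ?A] lookup_add V.scale_left_distrib sum.distrib)
  show "lincomb sc f (free_scale c x) = sc c (lincomb sc f x)"
    using keys_free_scale[of c x]
    by (simp add: lincomb_superset[where A = "Poly_Mapping.keys x"] lookup_free_scale V.scale_sum_right)
qed

lemma lincomb_gen: "lincomb sc f (gen g) = f g"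
  by (simp add: lincomb_def)

text \<open>Sums over fixed representatives are finite double sums, so they commute without any
  balancedness of \<open>F\<close>.\<close>

lemma lincomb_swap:
  "lincomb sc (\<lambda>g. lincomb sc (F g) y) x = lincomb sc (\<lambda>h. lincomb sc (\<lambda>g. F g h) x) y"
  unfolding lincomb_def V.scale_sum_right
  by (subst sum.swap) (simp add: mult.commute)

lemma lin_lincomb_fun:
  assumes "\<And>g. lin s1 sc (\<lambda>x. F x g)"
  shows "lin s1 sc (\<lambda>x. lincomb sc (F x) z)"
proof -
  have "F (x + y) g = F x g + F y g" "F (s1 c x) g = sc c (F x g)" for x y c g
    using assms[of g] by (simp_all add: lin_iff)
  then show ?thesis unfolding lin_iff lincomb_def
    by (simp add: V.scale_right_distrib sum.distrib V.scale_sum_right mult.commute)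
qed

lemma lin_lincomb_arg: "lin s1 free_scale z \<Longrightarrow> lin s1 sc (\<lambda>x. lincomb sc f (z x))"
  by (rule lin_compose[OF _ lincomb_lin])

end

lemma lincomb_cong:
  "x = x' \<Longrightarrow> (\<And>g. g \<in> Poly_Mapping.keys x' \<Longrightarrow> f g = f' g) \<Longrightarrow> lincomb sc f x = lincomb sc f' x'"
  by (auto simp: lincomb_def intro: sum.cong)

lemma lincomb_comp: "lin s1 s2 h \<Longrightarrow> h (lincomb s1 f x) = lincomb s2 (\<lambda>g. h (f g)) x"
  by (simp add: lincomb_def lin_sum lin_scale)

lemma lincomb_lincomb:
  "vector_space sc \<Longrightarrow> lincomb sc f (lincomb free_scale h x) = lincomb sc (\<lambda>g. lincomb sc f (h g)) x"
  by (rule lincomb_comp[OF lincomb_lin])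

lemma lincomb_free_gen: "lincomb free_scale gen x = (x :: 'g \<Rightarrow>\<^sub>0 'k::field)"
proof (rule poly_mapping_eqI)
  fix g
  have "lin free_scale (*) (\<lambda>x :: 'g \<Rightarrow>\<^sub>0 'k. Poly_Mapping.lookup x g)"
    by (simp add: lin_iff lookup_add lookup_free_scale)
  then have "Poly_Mapping.lookup (lincomb free_scale gen x) g
      = lincomb (*) (\<lambda>h. Poly_Mapping.lookup (gen h) g) x"
    by (rule lincomb_comp)
  also have "\<dots> = Poly_Mapping.lookup x g"
    by (auto simp: lincomb_def lookup_single when_def in_keys_iff if_distrib cong: if_cong)
  finally show "Poly_Mapping.lookup (lincomb free_scale gen x) g = Poly_Mapping.lookup x g" .
qed

section \<open>Normal forms in quotients of free spaces\<close>

lemma vsp_free_space: "vsp (free_space X :: ('k::field, _) module)"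
proof -
  interpret vector_space "free_scale :: 'k \<Rightarrow> ('a \<Rightarrow>\<^sub>0 'k) \<Rightarrow> _" by (rule vector_space_free)
  have add: "Poly_Mapping.keys (x + y) \<subseteq> X"
    if "Poly_Mapping.keys x \<subseteq> X" "Poly_Mapping.keys y \<subseteq> X" for x y :: "'a \<Rightarrow>\<^sub>0 'k"
    using that keys_add[of x y] by blast
  have "abelian_group (free_space X :: ('k, _) module)"
  proof (rule abelian_groupI)
    fix x assume "x \<in> carrier (free_space X :: ('k, _) module)"
    then show "\<exists>y\<in>carrier (free_space X). y \<oplus>\<^bsub>free_space X\<^esub> x = \<zero>\<^bsub>free_space X :: ('k, _) module\<^esub>"
      by (intro bexI[of _ "- x"]) (simp_all add: free_space_def)
  qed (simp_all add: free_space_def add_ac add)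
  then show ?thesis
    unfolding vsp_def vsp_axioms_def using keys_free_scale
    by (fastforce simp: free_space_def scale_left_distrib scale_right_distrib)
qed

text \<open>The subspace of relations is no separate argument: it is the zero of \<open>T\<close>,
  which is also where \<open>tens\<close> finds it.\<close>

definition fquot :: "'g set \<Rightarrow> ('k::field, ('g \<Rightarrow>\<^sub>0 'k) set) module \<Rightarrow> bool" where
  "fquot X T \<longleftrightarrow> T = quotient_space (free_space X) \<zero>\<^bsub>T\<^esub> \<and> subsp (free_space X) \<zero>\<^bsub>T\<^esub>"

text \<open>
  Every coset of \<open>W\<close> has a distinguished representative, its image under a linear projection with
  kernel \<open>W\<close>. Replacing cosets by these turns computations in tensor products into computations
  with linear maps between vector spaces carried by types.
\<close>

definition proj :: "('g \<Rightarrow>\<^sub>0 'k::field) set \<Rightarrow> ('g \<Rightarrow>\<^sub>0 'k) \<Rightarrow> ('g \<Rightarrow>\<^sub>0 'k)" where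
  "proj W = (SOME \<pi>. lin free_scale free_scale \<pi> \<and> (\<forall>x. \<pi> x - x \<in> W) \<and> (\<forall>x\<in>W. \<pi> x = 0))"

definition nf :: "('k::field, ('g \<Rightarrow>\<^sub>0 'k) set) module \<Rightarrow> ('g \<Rightarrow>\<^sub>0 'k) set \<Rightarrow> ('g \<Rightarrow>\<^sub>0 'k)" where
  "nf T X = proj \<zero>\<^bsub>T\<^esub> (SOME x. x \<in> X)"

text \<open>The condition for the linear extension of \<open>f\<close> to factor through the
  quotient \<open>T\<close>.\<close>

definition kills :: "('k::field, ('g \<Rightarrow>\<^sub>0 'k) set) module \<Rightarrow> ('k \<Rightarrow> 'w \<Rightarrow> 'w) \<Rightarrow> ('g \<Rightarrow> 'w::ab_group_add) \<Rightarrow> bool" where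
  "kills T sc f \<longleftrightarrow> (\<forall>w\<in>\<zero>\<^bsub>T\<^esub>. lincomb sc f w = 0)"

abbreviation tn :: "('k::field, ('g \<Rightarrow>\<^sub>0 'k) set) module \<Rightarrow> 'g \<Rightarrow> ('g \<Rightarrow>\<^sub>0 'k)" where
  "tn T g \<equiv> nf T (tens T g)"

text \<open>A basis \<open>B\<close> of \<open>W\<close> is extended to a basis of the whole free
  space; \<pi> kills \<open>B\<close> and fixes the other basis vectors. Both properties then spread
  from the bases by linearity.\<close>

lemma proj_exists:
  fixes W :: "('g \<Rightarrow>\<^sub>0 'k::field) set"
  assumes W: "Modules.module.subspace free_scale W"
  shows "\<exists>\<pi>. lin free_scale free_scale \<pi> \<and> (\<forall>x. \<pi> x - x \<in> W) \<and> (\<forall>x\<in>W. \<pi> x = 0)"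
proof -
  interpret F: vector_space "free_scale :: 'k \<Rightarrow> ('g \<Rightarrow>\<^sub>0 'k) \<Rightarrow> _" by (rule vector_space_free)
  interpret vector_space_pair "free_scale :: 'k \<Rightarrow> ('g \<Rightarrow>\<^sub>0 'k) \<Rightarrow> _" "free_scale :: 'k \<Rightarrow> ('g \<Rightarrow>\<^sub>0 'k) \<Rightarrow> _"
    by unfold_locales
  obtain B where B: "B \<subseteq> W" "F.independent B" "W \<subseteq> F.span B"
    using F.maximal_independent_subset[of W] by blast
  obtain \<pi> where lin: "Vector_Spaces.linear free_scale free_scale \<pi>"
    and \<pi>: "\<And>b. b \<in> F.extend_basis B \<Longrightarrow> \<pi> b = (if b \<in> B then 0 else b)"
    using linear_independent_extend[OF F.independent_extend_basis[OF B(2)], of "\<lambda>b. if b \<in> B then 0 else b"]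
    by blast
  interpret p: Vector_Spaces.linear free_scale free_scale \<pi> by (fact lin)
  have "\<pi> x - x \<in> W" for x
  proof -
    have "x \<in> F.span (F.extend_basis B)" using F.span_extend_basis[OF B(2)] by simp
    then show ?thesis
    proof (induction rule: F.span_induct_alt)
      case base
      show ?case using F.subspace_0[OF W] by (simp add: p.zero)
    next
      case (step c x y)
      have "\<pi> x - x \<in> W"
        using \<pi>[OF step(1)] F.subspace_0[OF W] F.subspace_neg[OF W] B(1) by auto
      then have "free_scale c (\<pi> x - x) + (\<pi> y - y) \<in> W"
        using step W by (simp add: F.subspace_add F.subspace_scale)
      then show ?case by (simp add: p.add p.scale F.scale_right_diff_distrib algebra_simps)
    qed
  qed
  moreover have "\<pi> x = 0" if "x \<in> W" for x
  proof -
    have "x \<in> F.span B" using that B by blast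
    then show ?thesis
      using \<pi> F.extend_basis_superset[OF B(2)]
      by (induction rule: F.span_induct_alt) (auto simp: p.zero p.add p.scale)
  qed
  moreover have "lin free_scale free_scale \<pi>" by (simp add: lin_iff p.add p.scale)
  ultimately show ?thesis by blast
qed

context
  fixes X :: "'g set" and T :: "('k::field, ('g \<Rightarrow>\<^sub>0 'k) set) module"
  assumes T: "fquot X T"
begin

lemma fquot_zero_keys: "w \<in> \<zero>\<^bsub>T\<^esub> \<Longrightarrow> Poly_Mapping.keys w \<subseteq> X"
  using T by (auto simp: fquot_def subsp_def free_space_def)

lemma fquot_zero_subspace: "Modules.module.subspace free_scale \<zero>\<^bsub>T\<^esub>"
proof -
  interpret F: vector_space "free_scale :: 'k \<Rightarrow> ('g \<Rightarrow>\<^sub>0 'k) \<Rightarrow> _" by (rule vector_space_free)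
  show ?thesis using T by (auto simp: F.subspace_def fquot_def subsp_def free_space_def)
qed

lemma proj_lin: "lin free_scale free_scale (proj \<zero>\<^bsub>T\<^esub>)"
  and proj_diff: "proj \<zero>\<^bsub>T\<^esub> x - x \<in> \<zero>\<^bsub>T\<^esub>"
  and proj_zero: "x \<in> \<zero>\<^bsub>T\<^esub> \<Longrightarrow> proj \<zero>\<^bsub>T\<^esub> x = 0"
  using someI_ex[OF proj_exists[OF fquot_zero_subspace]] unfolding proj_def by blast+

lemma vsp_fquot: "vsp T"
proof -
  have "T = quotient_space ((free_space X)\<lparr>carrier := carrier (free_space X)\<rparr>) \<zero>\<^bsub>T\<^esub>"
    using T unfolding fquot_def by simp
  moreover have "subsp (free_space X) (carrier (free_space X :: ('k, _) module))"
  proof -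
    interpret F: vsp "free_space X :: ('k, _) module" by (rule vsp_free_space)
    show ?thesis by (simp add: subsp_def F.smult_closed)
  qed
  ultimately show ?thesis using vsp.vsp_quotient[OF vsp_free_space] T
    by (metis fquot_def)
qed

lemma coset_mem: "y \<in> \<zero>\<^bsub>T\<^esub> +>\<^bsub>free_space Y\<^esub> x \<longleftrightarrow> y - x \<in> \<zero>\<^bsub>T\<^esub>"
  by (auto simp: a_r_coset_def r_coset_def free_space_def) (metis diff_add_cancel)

text \<open>Only the addition of the free space enters a coset. So \<open>tens\<close>, formed in
  the free space on all generators, lands in quotients of smaller free spaces as well.\<close>

lemma coset_indep: "\<zero>\<^bsub>T\<^esub> +>\<^bsub>free_space Y\<^esub> x = \<zero>\<^bsub>T\<^esub> +>\<^bsub>free_space Z\<^esub> x"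
  by (auto simp: coset_mem)

lemma carrier_fquot: "carrier T = {\<zero>\<^bsub>T\<^esub> +>\<^bsub>free_space UNIV\<^esub> x | x. Poly_Mapping.keys x \<subseteq> X}"
proof -
  have "carrier T = carrier (quotient_space (free_space X) \<zero>\<^bsub>T\<^esub>)"
    using T unfolding fquot_def by metis
  also have "\<dots> = (\<Union>x\<in>{x. Poly_Mapping.keys x \<subseteq> X}. {\<zero>\<^bsub>T\<^esub> +>\<^bsub>free_space X\<^esub> x})"
    unfolding quotient_space_def by (simp add: A_RCOSETS_def') (simp add: free_space_def)
  also have "\<dots> = {\<zero>\<^bsub>T\<^esub> +>\<^bsub>free_space UNIV\<^esub> x | x. Poly_Mapping.keys x \<subseteq> X}"
    unfolding coset_indep[of X _ UNIV] by blast
  finally show ?thesis .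
qed

lemma carrier_fquotE:
  assumes "A \<in> carrier T"
  obtains x where "Poly_Mapping.keys x \<subseteq> X" "A = \<zero>\<^bsub>T\<^esub> +>\<^bsub>free_space Y\<^esub> x"
  using assms unfolding carrier_fquot coset_indep[of UNIV _ Y] by blast

lemma fquot_sub: "subsp (free_space X) \<zero>\<^bsub>T\<^esub>"
  using T unfolding fquot_def by (rule conjunct2)

lemma add_fquot: "A \<oplus>\<^bsub>T\<^esub> B = set_add (free_space X) A B"
proof -
  have "add T = add (quotient_space (free_space X) \<zero>\<^bsub>T\<^esub>)" using T unfolding fquot_def by metis
  then show ?thesis by (simp add: quotient_space_def)
qed

lemma smult_fquot: "c \<odot>\<^bsub>T\<^esub> A = (\<Union>z\<in>A. \<zero>\<^bsub>T\<^esub> +>\<^bsub>free_space X\<^esub> (c \<odot>\<^bsub>free_space X\<^esub> z))"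
proof -
  have "smult T = smult (quotient_space (free_space X) \<zero>\<^bsub>T\<^esub>)" using T unfolding fquot_def by metis
  then show ?thesis by (simp add: quotient_space_def)
qed

lemma zero_sub_diff: "x \<in> \<zero>\<^bsub>T\<^esub> \<Longrightarrow> y \<in> \<zero>\<^bsub>T\<^esub> \<Longrightarrow> x - y \<in> \<zero>\<^bsub>T\<^esub>"
  and zero_sub_add: "x \<in> \<zero>\<^bsub>T\<^esub> \<Longrightarrow> y \<in> \<zero>\<^bsub>T\<^esub> \<Longrightarrow> x + y \<in> \<zero>\<^bsub>T\<^esub>"
  and zero_sub_0: "0 \<in> \<zero>\<^bsub>T\<^esub>"
proof -
  interpret F: vector_space "free_scale :: 'k \<Rightarrow> ('g \<Rightarrow>\<^sub>0 'k) \<Rightarrow> _" by (rule vector_space_free)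
  show "x \<in> \<zero>\<^bsub>T\<^esub> \<Longrightarrow> y \<in> \<zero>\<^bsub>T\<^esub> \<Longrightarrow> x - y \<in> \<zero>\<^bsub>T\<^esub>"
    "x \<in> \<zero>\<^bsub>T\<^esub> \<Longrightarrow> y \<in> \<zero>\<^bsub>T\<^esub> \<Longrightarrow> x + y \<in> \<zero>\<^bsub>T\<^esub>" "0 \<in> \<zero>\<^bsub>T\<^esub>"
    using fquot_zero_subspace F.subspace_diff F.subspace_add F.subspace_0 by blast+
qed

text \<open>The choice hidden in \<open>nf\<close> is harmless, since \<open>proj\<close> vanishes
  on the difference of two representatives.\<close>

lemma nf_coset: "nf T (\<zero>\<^bsub>T\<^esub> +>\<^bsub>free_space Y\<^esub> x) = proj \<zero>\<^bsub>T\<^esub> x"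
proof -
  have "x \<in> \<zero>\<^bsub>T\<^esub> +>\<^bsub>free_space Y\<^esub> x" using zero_sub_0 by (simp add: coset_mem)
  then have "(SOME y. y \<in> \<zero>\<^bsub>T\<^esub> +>\<^bsub>free_space Y\<^esub> x) - x \<in> \<zero>\<^bsub>T\<^esub>"
    by (metis coset_mem someI)
  from proj_zero[OF this] show ?thesis
    by (simp add: nf_def lin_diff[OF proj_lin])
qed

lemma nf_mem: "A \<in> carrier T \<Longrightarrow> nf T A \<in> A"
  using proj_diff by (auto simp: carrier_fquot nf_coset coset_mem)

lemma carrier_mem_keys: "A \<in> carrier T \<Longrightarrow> x \<in> A \<Longrightarrow> Poly_Mapping.keys x \<subseteq> X"
proof -
  assume "A \<in> carrier T" "x \<in> A"
  then obtain y where "Poly_Mapping.keys y \<subseteq> X" "x - y \<in> \<zero>\<^bsub>T\<^esub>" by (auto simp: carrier_fquot coset_mem)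
  then show ?thesis using keys_add[of "x - y" y] fquot_zero_keys[of "x - y"] by auto
qed

lemma nf_keys: "A \<in> carrier T \<Longrightarrow> g \<in> Poly_Mapping.keys (nf T A) \<Longrightarrow> g \<in> X"
  using carrier_mem_keys nf_mem by blast

lemma carrier_eq_coset: "A \<in> carrier T \<Longrightarrow> x \<in> A \<Longrightarrow> A = \<zero>\<^bsub>T\<^esub> +>\<^bsub>free_space UNIV\<^esub> x"
proof -
  assume "A \<in> carrier T" "x \<in> A"
  then obtain y where y: "A = \<zero>\<^bsub>T\<^esub> +>\<^bsub>free_space UNIV\<^esub> y" "x - y \<in> \<zero>\<^bsub>T\<^esub>"
    by (auto simp: carrier_fquot coset_mem)
  have "z - y \<in> \<zero>\<^bsub>T\<^esub> \<longleftrightarrow> z - x \<in> \<zero>\<^bsub>T\<^esub>" for z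
    using zero_sub_diff[of "z - y" "x - y"] zero_sub_add[of "z - x" "x - y"] y(2) by auto
  then show ?thesis unfolding y(1) by (auto simp: coset_mem)
qed

lemma nf_inj: "A \<in> carrier T \<Longrightarrow> B \<in> carrier T \<Longrightarrow> nf T A = nf T B \<Longrightarrow> A = B"
  by (metis carrier_eq_coset nf_mem)

lemma tens_carrier: "g \<in> X \<Longrightarrow> tens T g \<in> carrier T"
  unfolding carrier_fquot tens_def by (intro CollectI exI[of _ "gen g"]) simp

lemma nf_add: "A \<in> carrier T \<Longrightarrow> B \<in> carrier T \<Longrightarrow> nf T (A \<oplus>\<^bsub>T\<^esub> B) = nf T A + nf T B"
proof -
  assume A: "A \<in> carrier T" and B: "B \<in> carrier T"
  obtain x where x: "Poly_Mapping.keys x \<subseteq> X" "A = \<zero>\<^bsub>T\<^esub> +>\<^bsub>free_space X\<^esub> x"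
    using carrier_fquotE[OF A] .
  obtain y where y: "Poly_Mapping.keys y \<subseteq> X" "B = \<zero>\<^bsub>T\<^esub> +>\<^bsub>free_space X\<^esub> y"
    using carrier_fquotE[OF B] .
  have "A \<oplus>\<^bsub>T\<^esub> B = \<zero>\<^bsub>T\<^esub> +>\<^bsub>free_space X\<^esub> (x + y)"
    using vsp.coset_add[OF vsp_free_space fquot_sub, of x y "carrier (free_space X)"] x y
    by (simp add: add_fquot) (simp add: free_space_def)
  then show ?thesis by (simp add: nf_coset x y lin_add[OF proj_lin])
qed

lemma nf_smult: "A \<in> carrier T \<Longrightarrow> nf T (c \<odot>\<^bsub>T\<^esub> A) = free_scale c (nf T A)"
proof -
  assume A: "A \<in> carrier T"
  obtain x where x: "Poly_Mapping.keys x \<subseteq> X" "A = \<zero>\<^bsub>T\<^esub> +>\<^bsub>free_space X\<^esub> x"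
    using carrier_fquotE[OF A] .
  have "c \<odot>\<^bsub>T\<^esub> A = \<zero>\<^bsub>T\<^esub> +>\<^bsub>free_space X\<^esub> (free_scale c x)"
    using vsp.coset_smult[OF vsp_free_space fquot_sub, of x "carrier (free_space X)" c] x
    by (simp add: smult_fquot) (simp add: free_space_def)
  then show ?thesis by (simp add: nf_coset x lin_scale[OF proj_lin])
qed

text \<open>\<open>x\<close> and its normal form differ by a relation, which \<open>f\<close> cannot
  see.\<close>

lemma kills_nf:
  assumes "vector_space sc" "kills T sc f"
  shows "lincomb sc f (nf T (\<zero>\<^bsub>T\<^esub> +>\<^bsub>free_space Y\<^esub> x)) = lincomb sc f x"
proof -
  have "lincomb sc f (proj \<zero>\<^bsub>T\<^esub> x - x) = 0" using proj_diff assms(2) unfolding kills_def by blast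
  then show ?thesis by (simp add: nf_coset lin_diff[OF lincomb_lin[OF assms(1)]])
qed

lemma kills_tn: "vector_space sc \<Longrightarrow> kills T sc f \<Longrightarrow> lincomb sc f (tn T g) = f g"
  by (simp add: tens_def kills_nf lincomb_gen)

lemma kills_carrier:
  "vector_space sc \<Longrightarrow> kills T sc f \<Longrightarrow> A \<in> carrier T \<Longrightarrow> x \<in> A \<Longrightarrow> lincomb sc f x = lincomb sc f (nf T A)"
  by (metis carrier_eq_coset kills_nf)

text \<open>The linear extension of \<open>tn T\<close> is \<open>proj\<close> itself, and
  \<open>proj\<close> vanishes on relations. This makes the class map the universal example of a
  balanced map.\<close>

lemma kills_tn_self: "kills T free_scale (tn T)"
  unfolding kills_def
proof
  fix w assume "w \<in> \<zero>\<^bsub>T\<^esub>"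
  have "lincomb free_scale (tn T) w = proj \<zero>\<^bsub>T\<^esub> (lincomb free_scale gen w)"
    by (simp add: lincomb_comp[OF proj_lin] tens_def nf_coset)
  then show "lincomb free_scale (tn T) w = 0"
    using \<open>w \<in> \<zero>\<^bsub>T\<^esub>\<close> by (simp add: lincomb_free_gen proj_zero)
qed

lemma k_linear_nf: "k_linear (type_space sc) T f \<Longrightarrow> lin sc free_scale (\<lambda>x. nf T (f x))"
  and k_linear_carrier: "k_linear (type_space sc) T f \<Longrightarrow> f x \<in> carrier T"
  by (auto simp: k_linear_def type_space_def nf_add nf_smult Pi_def)

end

lemma the_elem_const: "A \<noteq> {} \<Longrightarrow> (\<And>x. x \<in> A \<Longrightarrow> F x = v) \<Longrightarrow> the_elem (F ` A) = v"
  by (metis (no_types, lifting) image_cong image_constant_conv the_elem_eq)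

text \<open>If \<open>f\<close> kills the relations, all representatives give the same value, so the
  set under \<open>the_elem\<close> is a singleton and the normal form may be taken as
  representative.\<close>

lemma lift_type_space:
  assumes S: "fquot X S" and A: "A \<in> carrier S" and V: "vector_space sc" and f: "kills S sc f"
  shows "lift (type_space sc) A f = lincomb sc f (nf S A)"
  unfolding lift_def
proof (rule the_elem_const)
  interpret vsp "type_space sc" by (rule vsp_type_space[OF V])
  fix x assume "x \<in> A"
  have "(\<Oplus>\<^bsub>type_space sc\<^esub>g\<in>Poly_Mapping.keys x. Poly_Mapping.lookup x g \<odot>\<^bsub>type_space sc\<^esub> f g) = lincomb sc f x"
    unfolding lincomb_def
    using finsum_hom[of "\<lambda>x. x" "Poly_Mapping.keys x" "\<lambda>g. Poly_Mapping.lookup x g \<odot>\<^bsub>type_space sc\<^esub> f g"]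
    by (simp add: type_space_def)
  then show "(\<Oplus>\<^bsub>type_space sc\<^esub>g\<in>Poly_Mapping.keys x. Poly_Mapping.lookup x g \<odot>\<^bsub>type_space sc\<^esub> f g)
      = lincomb sc f (nf S A)"
    using kills_carrier[OF S V f A \<open>x \<in> A\<close>] by simp
qed (use nf_mem[OF S A] in blast)

text \<open>The sums now live in the record \<open>T\<close>. They are compared after
  \<open>nf\<close>, which is additive and injective on the carrier.\<close>

lemma lift_fquot:
  assumes S: "fquot X S" and A: "A \<in> carrier S" and T: "fquot Y T"
    and cl: "\<And>g. g \<in> X \<Longrightarrow> f g \<in> carrier T"
    and f: "kills S free_scale (\<lambda>g. nf T (f g))"
  shows lift_carrier: "lift T A f \<in> carrier T"
    and nf_lift: "nf T (lift T A f) = lincomb free_scale (\<lambda>g. nf T (f g)) (nf S A)"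
proof -
  interpret vsp T by (rule vsp_fquot[OF T])
  let ?F = "\<lambda>x. \<Oplus>\<^bsub>T\<^esub>g\<in>Poly_Mapping.keys x. Poly_Mapping.lookup x g \<odot>\<^bsub>T\<^esub> f g"
  have mem: "?F x \<in> carrier T" and nf: "nf T (?F x) = lincomb free_scale (\<lambda>g. nf T (f g)) (nf S A)"
    if "x \<in> A" for x
  proof -
    have k: "f g \<in> carrier T" if "g \<in> Poly_Mapping.keys x" for g
      using carrier_mem_keys[OF S A \<open>x \<in> A\<close>] that cl by blast
    then show "?F x \<in> carrier T" by (auto intro!: finsum_closed smult_closed)
    have "nf T (?F x) = (\<Sum>g\<in>Poly_Mapping.keys x. nf T (Poly_Mapping.lookup x g \<odot>\<^bsub>T\<^esub> f g))"
      using k by (intro finsum_hom nf_add[OF T] smult_closed) auto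
    also have "\<dots> = lincomb free_scale (\<lambda>g. nf T (f g)) x"
      unfolding lincomb_def using k by (intro sum.cong) (auto simp: nf_smult[OF T])
    finally show "nf T (?F x) = lincomb free_scale (\<lambda>g. nf T (f g)) (nf S A)"
      using kills_carrier[OF S vector_space_free f A that] by simp
  qed
  have "lift T A f = ?F (nf S A)"
    unfolding lift_def
  proof (rule the_elem_const)
    show "A \<noteq> {}" using nf_mem[OF S A] by blast
    fix x assume "x \<in> A"
    then show "?F x = ?F (nf S A)"
      by (intro nf_inj[OF T] mem) (simp_all only: nf nf_mem[OF S A])
  qed
  then show "lift T A f \<in> carrier T" "nf T (lift T A f) = lincomb free_scale (\<lambda>g. nf T (f g)) (nf S A)"
    using mem nf nf_mem[OF S A] by auto
qed


section \<open>Balanced maps\<close>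

definition bal2 ::
  "('k::field \<Rightarrow> 'x::ab_group_add \<Rightarrow> 'x) \<Rightarrow> ('k \<Rightarrow> 'y::ab_group_add \<Rightarrow> 'y) \<Rightarrow>
   ('a \<Rightarrow> 'x \<Rightarrow> 'x) \<Rightarrow> ('a \<Rightarrow> 'y \<Rightarrow> 'y) \<Rightarrow> ('k \<Rightarrow> 'w::ab_group_add \<Rightarrow> 'w) \<Rightarrow> ('x \<Rightarrow> 'y \<Rightarrow> 'w) \<Rightarrow> bool" where
  "bal2 scX scY ra la sc f \<longleftrightarrow> (\<forall>y. lin scX sc (\<lambda>x. f x y)) \<and> (\<forall>x. lin scY sc (f x))
     \<and> (\<forall>a x y. f (ra a x) y = f x (la a y))"

text \<open>A slot is addressed by a split \<open>as @ x # bs\<close> and not by a list update,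
  because the inductions peel off the head of the list.\<close>

definition multilin ::
  "nat \<Rightarrow> ('k::field \<Rightarrow> 'x::ab_group_add \<Rightarrow> 'x) \<Rightarrow> ('k \<Rightarrow> 'm::ab_group_add \<Rightarrow> 'm) \<Rightarrow>
   ('k \<Rightarrow> 'w::ab_group_add \<Rightarrow> 'w) \<Rightarrow> ('x list \<Rightarrow> 'm \<Rightarrow> 'w) \<Rightarrow> bool" where
  "multilin n scX scM sc f \<longleftrightarrow>
       (\<forall>as bs m. Suc (length as + length bs) = n \<longrightarrow> lin scX sc (\<lambda>x. f (as @ x # bs) m))
     \<and> (\<forall>xs. length xs = n \<longrightarrow> lin scM sc (f xs))"

definition baln ::
  "nat \<Rightarrow> ('k::field \<Rightarrow> 'x::ab_group_add \<Rightarrow> 'x) \<Rightarrow> ('a \<Rightarrow> 'x \<Rightarrow> 'x) \<Rightarrow> ('a \<Rightarrow> 'x \<Rightarrow> 'x) \<Rightarrow>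
   ('k \<Rightarrow> 'm::ab_group_add \<Rightarrow> 'm) \<Rightarrow> ('a \<Rightarrow> 'm \<Rightarrow> 'm) \<Rightarrow>
   ('k \<Rightarrow> 'w::ab_group_add \<Rightarrow> 'w) \<Rightarrow> ('x list \<Rightarrow> 'm \<Rightarrow> 'w) \<Rightarrow> bool" where
  "baln n scX ra la scM lm sc f \<longleftrightarrow> multilin n scX scM sc f
     \<and> (\<forall>as bs x x' a m. length as + length bs + 2 = n \<longrightarrow>
          f (as @ ra a x # x' # bs) m = f (as @ x # la a x' # bs) m)
     \<and> (\<forall>as x a m. Suc (length as) = n \<longrightarrow> f (as @ [ra a x]) m = f (as @ [x]) (lm a m))"

lemma bal2_lin1: "bal2 scX scY ra la sc f \<Longrightarrow> lin s scX g \<Longrightarrow> lin s sc (\<lambda>x. f (g x) y)"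
  and bal2_lin2: "bal2 scX scY ra la sc f \<Longrightarrow> lin s scY h \<Longrightarrow> lin s sc (\<lambda>y. f x (h y))"
  and bal2_move: "bal2 scX scY ra la sc f \<Longrightarrow> f (ra a x) y = f x (la a y)"
  by (simp_all add: bal2_def lin_iff)

lemma multilin_slot: "multilin n scX scM sc f \<Longrightarrow> Suc (length as + length bs) = n \<Longrightarrow> lin s scX g \<Longrightarrow>
    lin s sc (\<lambda>x. f (as @ g x # bs) m)"
  and multilin_hd: "multilin n scX scM sc f \<Longrightarrow> Suc (length bs) = n \<Longrightarrow> lin s scX g \<Longrightarrow>
    lin s sc (\<lambda>x. f (g x # bs) m)"
  and multilin_last: "multilin n scX scM sc f \<Longrightarrow> length xs = n \<Longrightarrow> lin s scM h \<Longrightarrow>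
    lin s sc (\<lambda>m. f xs (h m))"
  unfolding multilin_def
  by (simp_all add: lin_iff) (metis append_Nil list.size(3) add_0)

lemma multilin_Cons:
  fixes f :: "'x::ab_group_add list \<Rightarrow> 'm::ab_group_add \<Rightarrow> 'w::ab_group_add"
  assumes "multilin (Suc n) scX scM sc f"
  shows "multilin n scX scM sc (\<lambda>xs. f (x # xs))"
  unfolding multilin_def
proof (intro conjI allI impI)
  fix as bs :: "'x list" and m assume "Suc (length as + length bs) = n"
  then show "lin scX sc (\<lambda>y. f (x # as @ y # bs) m)"
    using multilin_slot[OF assms _ lin_id, of "x # as" bs m] by simp
next
  fix xs :: "'x list" assume "length xs = n"
  then show "lin scM sc (f (x # xs))"
    using multilin_last[OF assms _ lin_id, of "x # xs"] by simp
qed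

lemma baln_multilin: "baln n scX ra la scM lm sc f \<Longrightarrow> multilin n scX scM sc f"
  and baln_move: "baln n scX ra la scM lm sc f \<Longrightarrow> length as + length bs + 2 = n \<Longrightarrow>
    f (as @ ra a x # x' # bs) m = f (as @ x # la a x' # bs) m"
  and baln_move_last: "baln n scX ra la scM lm sc f \<Longrightarrow> Suc (length as) = n \<Longrightarrow>
    f (as @ [ra a x]) m = f (as @ [x]) (lm a m)"
  by (simp_all add: baln_def)

text \<open>Freezing the first factor leaves a balanced map of the others; the inductions on the
  tensor degree rest on this.\<close>

lemma baln_Cons:
  fixes f :: "'x::ab_group_add list \<Rightarrow> 'm::ab_group_add \<Rightarrow> 'w::ab_group_add"
  assumes "baln (Suc n) scX ra la scM lm sc f"
  shows "baln n scX ra la scM lm sc (\<lambda>xs. f (x # xs))"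
  unfolding baln_def
proof (intro conjI allI impI)
  show "multilin n scX scM sc (\<lambda>xs. f (x # xs))" by (rule multilin_Cons[OF baln_multilin[OF assms]])
next
  fix as bs :: "'x list" and y z a m assume "length as + length bs + 2 = n"
  then show "f (x # as @ ra a y # z # bs) m = f (x # as @ y # la a z # bs) m"
    using baln_move[OF assms, of "x # as" bs a y z m] by simp
next
  fix as :: "'x list" and y a m assume "Suc (length as) = n"
  then show "f (x # as @ [ra a y]) m = f (x # as @ [y]) (lm a m)"
    using baln_move_last[OF assms, of "x # as" a y m] by simp
qed

lemma fquotI:
  fixes W :: "('g \<Rightarrow>\<^sub>0 'k::field) set"
  assumes "W \<subseteq> {f. Poly_Mapping.keys f \<subseteq> X}" "Modules.module.subspace free_scale W"
  shows "fquot X (quotient_space (free_space X) W)"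
proof -
  interpret F: vector_space "free_scale :: 'k \<Rightarrow> ('g \<Rightarrow>\<^sub>0 'k) \<Rightarrow> _" by (rule vector_space_free)
  have "\<zero>\<^bsub>quotient_space (free_space X) W\<^esub> = W" by (simp add: quotient_space_def)
  then show ?thesis
    using assms by (simp add: fquot_def F.subspace_def subsp_def) (simp add: free_space_def)
qed

lemma fquot_tensor2: "fquot UNIV (tensor2 scX scY ra la :: ('k::field, ('x::ab_group_add \<times> 'y::ab_group_add \<Rightarrow>\<^sub>0 'k) set) module)"
proof -
  interpret F: vector_space "free_scale :: 'k \<Rightarrow> ('x \<times> 'y \<Rightarrow>\<^sub>0 'k) \<Rightarrow> _" by (rule vector_space_free)
  show ?thesis unfolding tensor2_def by (rule fquotI) (simp_all add: tensor2_rel_def)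
qed

lemma keys_subspace: "Modules.module.subspace free_scale {f :: 'g \<Rightarrow>\<^sub>0 'k::field. Poly_Mapping.keys f \<subseteq> X}"
proof -
  interpret F: vector_space "free_scale :: 'k \<Rightarrow> ('g \<Rightarrow>\<^sub>0 'k) \<Rightarrow> _" by (rule vector_space_free)
  show ?thesis
    unfolding F.subspace_def
  proof (intro conjI ballI allI)
    fix x y c assume "x \<in> {f :: 'g \<Rightarrow>\<^sub>0 'k. Poly_Mapping.keys f \<subseteq> X}"
    then have x: "Poly_Mapping.keys x \<subseteq> X" by simp
    show "free_scale c x \<in> {f. Poly_Mapping.keys f \<subseteq> X}" using keys_free_scale[of c x] x by simp
    assume "y \<in> {f :: 'g \<Rightarrow>\<^sub>0 'k. Poly_Mapping.keys f \<subseteq> X}"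
    then show "x + y \<in> {f. Poly_Mapping.keys f \<subseteq> X}" using keys_add[of x y] x by auto
  qed simp
qed

lemma fquot_tensor_pow: "fquot {(xs, m). length xs = n}
  (tensor_pow n scX ra la scM lm :: ('k::field, ('x::ab_group_add list \<times> 'm::ab_group_add \<Rightarrow>\<^sub>0 'k) set) module)"
proof -
  interpret F: vector_space "free_scale :: 'k \<Rightarrow> ('x list \<times> 'm \<Rightarrow>\<^sub>0 'k) \<Rightarrow> _" by (rule vector_space_free)
  define U :: "('x list \<times> 'm \<Rightarrow>\<^sub>0 'k) set"
    where "U = {f. Poly_Mapping.keys f \<subseteq> {(xs, m). length xs = n}}"
  have S: "F.subspace U" unfolding U_def by (rule keys_subspace)
  have g: "gen (xs, m) \<in> U" if "length xs = n" for xs m using that by (simp add: U_def)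
  show ?thesis unfolding tensor_pow_def
  proof (rule fquotI)
    have "tensor_pow_rel n scX ra la scM lm \<subseteq> U"
      unfolding tensor_pow_rel_def
      by (rule F.span_minimal[OF _ S])
        (auto intro!: F.subspace_diff[OF S] F.subspace_scale[OF S] g)
    then show "tensor_pow_rel n scX ra la scM lm \<subseteq> {f. Poly_Mapping.keys f \<subseteq> {(xs, m). length xs = n}}"
      by (simp add: U_def)
  qed (simp add: tensor_pow_rel_def)
qed

lemma kills_span:
  fixes sc :: "'k::field \<Rightarrow> 'w \<Rightarrow> 'w::ab_group_add"
  assumes V: "vector_space sc" and T: "\<zero>\<^bsub>T\<^esub> = Modules.module.span free_scale S"
    and S: "\<And>s. s \<in> S \<Longrightarrow> lincomb sc f s = 0"
  shows "kills T sc f"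
  unfolding kills_def T
proof
  interpret F: vector_space "free_scale :: 'k \<Rightarrow> ('a \<Rightarrow>\<^sub>0 'k) \<Rightarrow> _" by (rule vector_space_free)
  interpret V: vector_space sc by (rule V)
  note L = lincomb_lin[OF V, of f]
  fix w assume "w \<in> F.span S"
  then show "lincomb sc f w = 0"
    by (induction rule: F.span_induct_alt) (simp_all add: lin_zero[OF L] lin_add[OF L] lin_scale[OF L] S)
qed

lemma kills_tensor2:
  assumes V: "vector_space sc" and f: "bal2 scX scY ra la sc f"
  shows "kills (tensor2 scX scY ra la) sc (\<lambda>(x, y). f x y)"
proof -
  have z: "\<zero>\<^bsub>tensor2 scX scY ra la\<^esub> = tensor2_rel scX scY ra la"
    by (simp add: tensor2_def quotient_space_def)
  show ?thesis
    by (rule kills_span[OF V z[unfolded tensor2_rel_def]]) (use f in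
      \<open>auto simp: lin_diff[OF lincomb_lin[OF V]] lin_scale[OF lincomb_lin[OF V]] lincomb_gen[OF V] bal2_def lin_iff\<close>)
qed


lemma kills_tensor_pow:
  assumes V: "vector_space sc" and f: "baln n scX ra la scM lm sc f"
  shows "kills (tensor_pow n scX ra la scM lm) sc (\<lambda>(xs, m). f xs m)"
proof -
  have z: "\<zero>\<^bsub>tensor_pow n scX ra la scM lm\<^esub> = tensor_pow_rel n scX ra la scM lm"
    by (simp add: tensor_pow_def quotient_space_def)
  \<comment> \<open>The relations of \<open>tensor_pow\<close> are written with list updates; this
    and the next facts restate the properties of \<open>f\<close>, given for splits of a list, in
    that form.\<close>
  have slot: "lin scX sc (\<lambda>x. f (xs[i := x]) m)" if "length xs = n" "i < n" for xs i m
    using multilin_slot[OF baln_multilin[OF f] _ lin_id, of "take i xs" "drop (Suc i) xs" m] that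
    by (simp add: upd_conv_take_nth_drop)
  have last: "lin scM sc (f xs)" if "length xs = n" for xs
    using multilin_last[OF baln_multilin[OF f] that lin_id] .
  have move: "f (xs[i := ra a (xs ! i)]) m = f (xs[Suc i := la a (xs ! Suc i)]) m"
    if l: "length xs = n" "Suc i < n" for xs i a m
  proof -
    have "xs = take i xs @ xs ! i # xs ! Suc i # drop (Suc (Suc i)) xs" "length (take i xs) = i"
      using l by (simp_all add: Cons_nth_drop_Suc)
    then obtain as x x' bs where xs: "xs = as @ x # x' # bs" "length as = i" by blast
    show ?thesis
      using baln_move[OF f, of as bs a x x' m] l(1) unfolding xs(1) xs(2)[symmetric]
      by (simp add: nth_append list_update_append)
  qed
  have move_last: "f (xs[i := ra a (xs ! i)]) m = f xs (lm a m)"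
    if l: "length xs = n" "Suc i = n" for xs i a m
  proof -
    obtain as x where xs: "xs = as @ [x]" "length as = i"
      using l by (metis length_Suc_conv_rev)
    show ?thesis
      using baln_move_last[OF f, of as a x m] l unfolding xs(1) xs(2)[symmetric] by simp
  qed
  note L = lin_add[OF lincomb_lin[OF V]] lin_diff[OF lincomb_lin[OF V]] lin_scale[OF lincomb_lin[OF V]] lincomb_gen[OF V]
  show ?thesis
  proof (rule kills_span[OF V z[unfolded tensor_pow_rel_def]])
    fix s assume "s \<in> {gen (xs[i := x + x'], m) - gen (xs[i := x], m) - gen (xs[i := x'], m) | xs i x x' m.
           length xs = n \<and> i < n}
      \<union> {gen (xs[i := scX c x], m) - free_scale c (gen (xs[i := x], m)) | xs i c x m.
           length xs = n \<and> i < n}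
      \<union> {gen (xs, m + m') - gen (xs, m) - gen (xs, m') | xs m m'. length xs = n}
      \<union> {gen (xs, scM c m) - free_scale c (gen (xs, m)) | xs c m. length xs = n}
      \<union> {gen (xs[i := ra a (xs ! i)], m) - gen (xs[Suc i := la a (xs ! Suc i)], m) | xs i a m.
           length xs = n \<and> Suc i < n}
      \<union> {gen (xs[i := ra a (xs ! i)], m) - gen (xs, lm a m) | xs i a m.
           length xs = n \<and> Suc i = n}"
    then show "lincomb sc (\<lambda>(xs, m). f xs m) s = 0"
    proof (elim UnE CollectE exE conjE, goal_cases)
      case (1 xs i x x' m)
      show ?case unfolding 1(1) using lin_add[OF slot[OF 1(2,3)]] by (simp add: L)
    next
      case (2 xs i c x m)
      show ?case unfolding 2(1) using lin_scale[OF slot[OF 2(2,3)]] by (simp add: L)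
    next
      case (3 xs m m')
      show ?case unfolding 3(1) using lin_add[OF last[OF 3(2)]] by (simp add: L)
    next
      case (4 xs c m)
      show ?case unfolding 4(1) using lin_scale[OF last[OF 4(2)]] by (simp add: L)
    next
      case (5 xs i a m)
      show ?case unfolding 5(1) using move[OF 5(2,3)] by (simp add: L)
    next
      case (6 xs i a m)
      show ?case unfolding 6(1) using move_last[OF 6(2,3)] by (simp add: L)
    qed
  qed
qed

text \<open>Each law to be shown says that \<open>tn T\<close> vanishes on one of the generators of
  the relations, which \<open>kills_tn_self\<close> provides.\<close>

lemma bal2_tn:
  fixes scX :: "'k::field \<Rightarrow> 'x::ab_group_add \<Rightarrow> 'x" and scY :: "'k \<Rightarrow> 'y::ab_group_add \<Rightarrow> 'y"
    and ra :: "'a \<Rightarrow> 'x \<Rightarrow> 'x" and la :: "'a \<Rightarrow> 'y \<Rightarrow> 'y"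
  defines "T \<equiv> tensor2 scX scY ra la"
  shows "bal2 scX scY ra la free_scale (\<lambda>x y. tn T (x, y))"
proof -
  interpret F: vector_space "free_scale :: 'k \<Rightarrow> ('x \<times> _ \<Rightarrow>\<^sub>0 'k) \<Rightarrow> _" by (rule vector_space_free)
  note V = vector_space_free
  have "kills T free_scale (tn T)" unfolding T_def by (rule kills_tn_self[OF fquot_tensor2])
  then have k: "lincomb free_scale (tn T) w = 0" if "w \<in> tensor2_rel scX scY ra la" for w
    using that by (simp add: kills_def T_def tensor2_def quotient_space_def)
  note L = lin_add[OF lincomb_lin[OF V]] lin_diff[OF lincomb_lin[OF V]] lin_scale[OF lincomb_lin[OF V]] lincomb_gen[OF V]
  show ?thesis
    unfolding bal2_def lin_iff
  proof (intro conjI allI)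
    fix x x' y c
    have "gen (x + x', y) - gen (x, y) - gen (x', y) \<in> tensor2_rel scX scY ra la"
      unfolding tensor2_rel_def by (rule F.span_base) blast
    from k[OF this] show "tn T (x + x', y) = tn T (x, y) + tn T (x', y)"
      by (simp add: L algebra_simps)
    have "gen (scX c x, y) - free_scale c (gen (x, y)) \<in> tensor2_rel scX scY ra la"
      unfolding tensor2_rel_def by (rule F.span_base) blast
    from k[OF this] show "tn T (scX c x, y) = free_scale c (tn T (x, y))"
      by (simp add: L algebra_simps)
  next
    fix x y y' c
    have "gen (x, y + y') - gen (x, y) - gen (x, y') \<in> tensor2_rel scX scY ra la"
      unfolding tensor2_rel_def by (rule F.span_base) blast
    from k[OF this] show "tn T (x, y + y') = tn T (x, y) + tn T (x, y')"
      by (simp add: L algebra_simps)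
    have "gen (x, scY c y) - free_scale c (gen (x, y)) \<in> tensor2_rel scX scY ra la"
      unfolding tensor2_rel_def by (rule F.span_base) blast
    from k[OF this] show "tn T (x, scY c y) = free_scale c (tn T (x, y))"
      by (simp add: L algebra_simps)
  next
    fix a x y
    have "gen (ra a x, y) - gen (x, la a y) \<in> tensor2_rel scX scY ra la"
      unfolding tensor2_rel_def by (rule F.span_base) blast
    from k[OF this] show "tn T (ra a x, y) = tn T (x, la a y)"
      by (simp add: L algebra_simps)
  qed
qed

lemma baln_tn:
  fixes scX :: "'k::field \<Rightarrow> 'x::ab_group_add \<Rightarrow> 'x" and scM :: "'k \<Rightarrow> 'm::ab_group_add \<Rightarrow> 'm"
    and ra la :: "'a \<Rightarrow> 'x \<Rightarrow> 'x" and lm :: "'a \<Rightarrow> 'm \<Rightarrow> 'm" and n :: nat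
  defines "T \<equiv> tensor_pow n scX ra la scM lm"
  shows "baln n scX ra la scM lm free_scale (\<lambda>xs m. tn T (xs, m))"
proof -
  interpret F: vector_space "free_scale :: 'k \<Rightarrow> ('x list \<times> _ \<Rightarrow>\<^sub>0 'k) \<Rightarrow> _" by (rule vector_space_free)
  note V = vector_space_free
  have "kills T free_scale (tn T)" unfolding T_def by (rule kills_tn_self[OF fquot_tensor_pow])
  then have k: "lincomb free_scale (tn T) w = 0" if "w \<in> tensor_pow_rel n scX ra la scM lm" for w
    using that by (simp add: kills_def T_def tensor_pow_def quotient_space_def)
  note L = lin_add[OF lincomb_lin[OF V]] lin_diff[OF lincomb_lin[OF V]] lin_scale[OF lincomb_lin[OF V]] lincomb_gen[OF V]
  show ?thesis
    unfolding baln_def multilin_def lin_iff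
  proof (intro conjI allI impI)
    fix as bs :: "'x list" and m x x' c assume n: "Suc (length as + length bs) = n"
    have "gen ((as @ x # bs)[length as := x + x'], m) - gen ((as @ x # bs)[length as := x], m) - gen ((as @ x # bs)[length as := x'], m)
      \<in> tensor_pow_rel n scX ra la scM lm"
      unfolding tensor_pow_rel_def using n by (intro F.span_base UnI1 CollectI exI[of _ "as @ x # bs"] exI[of _ "length as"] exI[of _ x] exI[of _ x'] exI[of _ c] exI[of _ m]) (simp_all)
    from k[OF this] show "tn T (as @ (x + x') # bs, m) = tn T (as @ x # bs, m) + tn T (as @ x' # bs, m)"
      by (simp add: L algebra_simps)
    have "gen ((as @ x # bs)[length as := scX c x], m) - free_scale c (gen ((as @ x # bs)[length as := x], m))
      \<in> tensor_pow_rel n scX ra la scM lm"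
      unfolding tensor_pow_rel_def using n by (intro F.span_base UnI1 UnI2 CollectI exI[of _ "as @ x # bs"] exI[of _ "length as"] exI[of _ x] exI[of _ x'] exI[of _ c] exI[of _ m]) (simp_all)
    from k[OF this] show "tn T (as @ scX c x # bs, m) = free_scale c (tn T (as @ x # bs, m))"
      by (simp add: L)
  next
    fix xs :: "'x list" and m m' c assume n: "length xs = n"
    have "gen (xs, m + m') - gen (xs, m) - gen (xs, m') \<in> tensor_pow_rel n scX ra la scM lm"
      unfolding tensor_pow_rel_def by (rule F.span_base) (use n in blast)
    from k[OF this] show "tn T (xs, m + m') = tn T (xs, m) + tn T (xs, m')"
      by (simp add: L algebra_simps)
    have "gen (xs, scM c m) - free_scale c (gen (xs, m)) \<in> tensor_pow_rel n scX ra la scM lm"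
      unfolding tensor_pow_rel_def by (rule F.span_base) (use n in blast)
    from k[OF this] show "tn T (xs, scM c m) = free_scale c (tn T (xs, m))"
      by (simp add: L algebra_simps)
  next
    fix as bs :: "'x list" and x x' a m assume n: "length as + length bs + 2 = n"
    let ?xs = "as @ x # x' # bs"
    have "gen (?xs[length as := ra a (?xs ! length as)], m) - gen (?xs[Suc (length as) := la a (?xs ! Suc (length as))], m)
      \<in> tensor_pow_rel n scX ra la scM lm"
      unfolding tensor_pow_rel_def using n
      by (intro F.span_base UnI1 UnI2 CollectI exI[of _ "?xs"] exI[of _ "length as"] exI[of _ a] exI[of _ m]) simp_all
    from k[OF this] show "tn T (as @ ra a x # x' # bs, m) = tn T (as @ x # la a x' # bs, m)"
      by (simp add: L list_update_append nth_append)
  next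
    fix as :: "'x list" and x a m assume n: "Suc (length as) = n"
    let ?xs = "as @ [x]"
    have "gen (?xs[length as := ra a (?xs ! length as)], m) - gen (?xs, lm a m)
      \<in> tensor_pow_rel n scX ra la scM lm"
      unfolding tensor_pow_rel_def using n
      by (intro F.span_base UnI2 CollectI exI[of _ "?xs"] exI[of _ "length as"] exI[of _ a] exI[of _ m]) simp_all
    from k[OF this] show "tn T (as @ [ra a x], m) = tn T (as @ [x], lm a m)"
      by (simp add: L)
  qed
qed

section \<open>Sweedler sums\<close>

lemma lincomb_lincomb2:
  assumes "vector_space sc"
  shows "lincomb sc f (lincomb free_scale (\<lambda>(a, b). h a b) x) = lincomb sc (\<lambda>(a, b). lincomb sc f (h a b)) x"
  by (simp add: lincomb_lincomb[OF assms] split_def)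

lemma lincomb_swap2:
  assumes "vector_space sc"
  shows "lincomb sc (\<lambda>(a, b). lincomb sc (\<lambda>(c, d). F a b c d) y) x
    = lincomb sc (\<lambda>(c, d). lincomb sc (\<lambda>(a, b). F a b c d) x) y"
  using lincomb_swap[OF assms, of "\<lambda>g h. F (fst g) (snd g) (fst h) (snd h)"] by (simp add: split_def)

lemma lincomb_comp2: "lin s1 s2 h \<Longrightarrow> h (lincomb s1 (\<lambda>(a, b). f a b) x) = lincomb s2 (\<lambda>(a, b). h (f a b)) x"
  by (simp add: lincomb_comp split_def)

lemma lin_lincomb2:
  "vector_space sc \<Longrightarrow> (\<And>a b. lin s1 sc (\<lambda>x. F x a b)) \<Longrightarrow> lin s1 sc (\<lambda>x. lincomb sc (\<lambda>(a, b). F x a b) z)"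
  unfolding split_def by (rule lin_lincomb_fun)

lemma lincomb_cong2:
  "x = x' \<Longrightarrow> (\<And>a b. (a, b) \<in> Poly_Mapping.keys x' \<Longrightarrow> f a b = f' a b) \<Longrightarrow>
    lincomb sc (\<lambda>(a, b). f a b) x = lincomb sc (\<lambda>(a, b). f' a b) x'"
  by (rule lincomb_cong) auto

lemma lincomb_tn2:
  assumes "vector_space sc" "bal2 scX scY ra la sc f"
  shows "lincomb sc (\<lambda>(x, y). f x y) (tn (tensor2 scX scY ra la) (x, y)) = f x y"
  by (subst kills_tn[OF fquot_tensor2 assms(1) kills_tensor2[OF assms]]) simp

lemma lincomb_tnn:
  assumes "vector_space sc" "baln n scX ra la scM lm sc f"
  shows "lincomb sc (\<lambda>(x, y). f x y) (tn (tensor_pow n scX ra la scM lm) (x, y)) = f x y"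
  by (subst kills_tn[OF fquot_tensor_pow assms(1) kills_tensor_pow[OF assms]]) simp

text \<open>Nested \<open>lift\<close> expressions are translated from the inside out: the
  balancedness of an outer one is stated for the normal form which this lemma has produced for the
  inner one.\<close>

lemma nf_lift2:
  assumes A: "A \<in> carrier (tensor2 scX scY ra la)" and T: "fquot Y T"
    and cl: "\<And>x y. h x y \<in> carrier T"
    and bal: "bal2 scX scY ra la free_scale (\<lambda>x y. nf T (h x y))"
  shows "lift T A (\<lambda>(x, y). h x y) \<in> carrier T"
    and "nf T (lift T A (\<lambda>(x, y). h x y)) = lincomb free_scale (\<lambda>(x, y). nf T (h x y)) (nf (tensor2 scX scY ra la) A)"
proof -
  have eq: "(\<lambda>g. nf T (case g of (x, y) \<Rightarrow> h x y)) = (\<lambda>(x, y). nf T (h x y))" by auto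
  have k: "kills (tensor2 scX scY ra la) free_scale (\<lambda>g. nf T (case g of (x, y) \<Rightarrow> h x y))"
    unfolding eq by (rule kills_tensor2[OF vector_space_free bal])
  show "lift T A (\<lambda>(x, y). h x y) \<in> carrier T"
    by (rule lift_carrier[OF fquot_tensor2 A T _ k]) (use cl in auto)
  show "nf T (lift T A (\<lambda>(x, y). h x y)) = lincomb free_scale (\<lambda>(x, y). nf T (h x y)) (nf (tensor2 scX scY ra la) A)"
    by (subst nf_lift[OF fquot_tensor2 A T _ k]) (use cl in \<open>auto simp: eq\<close>)
qed

lemma lift2_type_space:
  assumes A: "A \<in> carrier (tensor2 scX scY ra la)" and V: "vector_space sc"
    and bal: "bal2 scX scY ra la sc h"
  shows "lift (type_space sc) A (\<lambda>(x, y). h x y) = lincomb sc (\<lambda>(x, y). h x y) (nf (tensor2 scX scY ra la) A)"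
  by (rule lift_type_space[OF fquot_tensor2 A V kills_tensor2[OF V bal]])

lemma nf_liftn:
  assumes A: "A \<in> carrier (tensor_pow n scX ra la scM lm)" and T: "fquot Y T"
    and cl: "\<forall>x y. length x = n \<longrightarrow> h x y \<in> carrier T"
    and bal: "baln n scX ra la scM lm free_scale (\<lambda>x y. nf T (h x y))"
  shows "lift T A (\<lambda>(x, y). h x y) \<in> carrier T"
    and "nf T (lift T A (\<lambda>(x, y). h x y)) = lincomb free_scale (\<lambda>(x, y). nf T (h x y)) (nf (tensor_pow n scX ra la scM lm) A)"
proof -
  have eq: "(\<lambda>g. nf T (case g of (x, y) \<Rightarrow> h x y)) = (\<lambda>(x, y). nf T (h x y))" by auto
  have k: "kills (tensor_pow n scX ra la scM lm) free_scale (\<lambda>g. nf T (case g of (x, y) \<Rightarrow> h x y))"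
    unfolding eq by (rule kills_tensor_pow[OF vector_space_free bal])
  show "lift T A (\<lambda>(x, y). h x y) \<in> carrier T"
    by (rule lift_carrier[OF fquot_tensor_pow A T _ k]) (use cl in auto)
  show "nf T (lift T A (\<lambda>(x, y). h x y)) = lincomb free_scale (\<lambda>(x, y). nf T (h x y)) (nf (tensor_pow n scX ra la scM lm) A)"
    by (subst nf_lift[OF fquot_tensor_pow A T _ k]) (use cl in \<open>auto simp: eq\<close>)
qed

lemma bal2_bilinear:
  "(\<And>y. lin scX sc (\<lambda>x. f x y)) \<Longrightarrow> (\<And>x. lin scY sc (\<lambda>y. f x y)) \<Longrightarrow> bal2 scX scY scX scY sc f"
  by (simp add: bal2_def lin_iff)

text \<open>Over the ground field balancedness is automatic: the scalar is pulled out of one slot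
  and pushed into the next.\<close>

lemma baln_multilinear:
  fixes f :: "'x::ab_group_add list \<Rightarrow> 'm::ab_group_add \<Rightarrow> 'w::ab_group_add"
  assumes "multilin n scX scM sc f"
  shows "baln n scX scX scX scM scM sc f"
  unfolding baln_def
proof (intro conjI allI impI)
  fix as bs :: "'x list" and x x' a m assume n: "length as + length bs + 2 = n"
  show "f (as @ scX a x # x' # bs) m = f (as @ x # scX a x' # bs) m"
    using lin_scale[OF multilin_slot[OF assms _ lin_id, of as "x' # bs" m], of a x]
      lin_scale[OF multilin_slot[OF assms _ lin_id, of "as @ [x]" bs m], of a x'] n by simp
next
  fix as :: "'x list" and x a m assume n: "Suc (length as) = n"
  show "f (as @ [scX a x]) m = f (as @ [x]) (scM a m)"
    using lin_scale[OF multilin_slot[OF assms _ lin_id, of as "[]" m], of a x]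
      lin_scale[OF multilin_last[OF assms _ lin_id, of "as @ [x]"], of a m] n by simp
qed (fact assms)

lemma multilin_2:
  fixes F :: "'x::ab_group_add \<Rightarrow> 'x \<Rightarrow> 'm::ab_group_add \<Rightarrow> 'w::ab_group_add"
  assumes "\<And>b m. lin scX sc (\<lambda>a. F a b m)" "\<And>a m. lin scX sc (\<lambda>b. F a b m)" "\<And>a b. lin scM sc (\<lambda>m. F a b m)"
  shows "multilin 2 scX scM sc (\<lambda>xs m. F (xs ! 0) (xs ! 1) m)"
  unfolding multilin_def
proof (intro conjI allI impI)
  fix as bs :: "'x list" and m assume "Suc (length as + length bs) = 2"
  then consider b where "as = []" "bs = [b]" | a where "as = [a]" "bs = []"
    by (cases as; cases bs) auto
  then show "lin scX sc (\<lambda>x. F ((as @ x # bs) ! 0) ((as @ x # bs) ! 1) m)"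
    by cases (use assms in \<open>auto simp: lin_iff\<close>)
qed (use assms in \<open>auto simp: lin_iff\<close>)

lemma multilin_snoc:
  fixes f :: "'x::ab_group_add list \<Rightarrow> 'm::ab_group_add \<Rightarrow> 'w::ab_group_add"
  assumes "multilin (Suc n) scX scM sc f"
  shows "multilin n scX scM sc (\<lambda>xs. f (xs @ [x]))"
  unfolding multilin_def
proof (intro conjI allI impI)
  fix as bs :: "'x list" and m assume "Suc (length as + length bs) = n"
  then show "lin scX sc (\<lambda>y. f ((as @ y # bs) @ [x]) m)"
    using multilin_slot[OF assms _ lin_id, of as "bs @ [x]" m] by simp
qed (use multilin_last[OF assms _ lin_id] in simp)

lemma multilin_snoc_slot:
  "multilin (Suc n) scX scM sc f \<Longrightarrow> length xs = n \<Longrightarrow> lin s scX g \<Longrightarrow> lin s sc (\<lambda>x. f (xs @ [g x]) m)"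
  by (rule multilin_slot[where n = "Suc n" and bs = "[]"]) simp_all

lemma multilin_map2:
  fixes \<Psi> :: "'x::ab_group_add \<Rightarrow> 'u \<Rightarrow> 'v::ab_group_add"
  assumes G: "multilin (length us) sv scM sc G" and \<Psi>: "\<And>u. lin scX sv (\<lambda>x. \<Psi> x u)"
  shows "multilin (length us) scX scM sc (\<lambda>xs. G (map2 \<Psi> xs us))"
  unfolding multilin_def
proof (intro conjI allI impI)
  fix as bs :: "'x list" and m assume n: "Suc (length as + length bs) = length us"
  have us: "us = take (length as) us @ us ! length as # drop (Suc (length as)) us"
    using n by (intro id_take_nth_drop) simp
  have "map2 \<Psi> (as @ x # bs) us = map2 \<Psi> as (take (length as) us) @ \<Psi> x (us ! length as) #
      map2 \<Psi> bs (drop (Suc (length as)) us)" for x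
    by (subst us, subst zip_append) (use n in simp_all)
  then show "lin scX sc (\<lambda>x. G (map2 \<Psi> (as @ x # bs) us) m)"
    using multilin_slot[OF G _ \<Psi>] n by simp
qed (use multilin_last[OF G _ lin_id] in simp)

lemma length_nf_keys:
  assumes "A \<in> carrier (tensor_pow n scX ra la scM lm)" "(xs, m) \<in> Poly_Mapping.keys (nf (tensor_pow n scX ra la scM lm) A)"
  shows "length xs = n"
  using nf_keys[OF fquot_tensor_pow assms] by simp

text \<open>All keys of a normal form are lists of length \<open>n\<close>, so \<open>F\<close> may
  be replaced by zero on other lists before linearity is checked.\<close>

lemma lin_lincombn:
  assumes V: "vector_space sc" and A: "A \<in> carrier (tensor_pow n scX ra la scM lm)"
    and F: "\<And>a b. length a = n \<Longrightarrow> lin s1 sc (\<lambda>x. F x a b)"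
  shows "lin s1 sc (\<lambda>x. lincomb sc (\<lambda>(a, b). F x a b) (nf (tensor_pow n scX ra la scM lm) A))"
proof -
  interpret V: vector_space sc by (rule V)
  have "lin s1 sc (\<lambda>x. if length a = n then F x a b else 0)" for a b
    using F[of a b] by (cases "length a = n") (simp_all add: lin_iff)
  then have "lin s1 sc (\<lambda>x. lincomb sc (\<lambda>(a, b). if length a = n then F x a b else 0) (nf (tensor_pow n scX ra la scM lm) A))"
    by (rule lin_lincomb2[OF V])
  also have "(\<lambda>x. lincomb sc (\<lambda>(a, b). if length a = n then F x a b else 0) (nf (tensor_pow n scX ra la scM lm) A))
      = (\<lambda>x. lincomb sc (\<lambda>(a, b). F x a b) (nf (tensor_pow n scX ra la scM lm) A))"
    by (intro ext lincomb_cong2 refl) (simp add: length_nf_keys[OF A])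
  finally show ?thesis .
qed

section \<open>Comodules over cocommutative coalgebras\<close>

context
  fixes C :: "('k::field, 'c::ab_group_add) coalg"
  assumes C: "coalgebra C"
begin

lemma coprodC_carrier: "coprodC C x \<in> carrier (CC C)"
  using C k_linear_carrier[OF fquot_tensor2] unfolding coalgebra_def CC_def by blast

lemma lin_coprodC: "lin (scC C) free_scale (\<lambda>x. nf (CC C) (coprodC C x))"
  using C k_linear_nf[OF fquot_tensor2] unfolding coalgebra_def CC_def by blast

lemma coalgebra_lin_counit: "lin (scC C) (*) (counitC C)"
  using C by (simp add: coalgebra_def)

lemma multilin_tn_CnD: "multilin n (scC C) sD free_scale (\<lambda>xs m. tn (CnD C sD n) (xs, m))"
  unfolding CnD_def by (rule baln_multilin[OF baln_tn])

lemma lin_tn_CnD2: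
  "lin (scC C) free_scale (\<lambda>a. tn (CnD C sD 2) ([a, b], m))"
  "lin (scC C) free_scale (\<lambda>b. tn (CnD C sD 2) ([a, b], m))"
  "lin sD free_scale (\<lambda>m. tn (CnD C sD 2) ([a, b], m))"
  using multilin_slot[OF multilin_tn_CnD _ lin_id, of "[]" "[b]" 2]
    multilin_slot[OF multilin_tn_CnD _ lin_id, of "[a]" "[]" 2]
    multilin_last[OF multilin_tn_CnD _ lin_id, of "[a, b]" 2] by simp_all

text \<open>Both sides of a coassociativity law, for the tensor \<open>\<tau>\<close> that encodes \<open>d \<otimes> c \<otimes> c'\<close>.\<close>

lemma nf_coassociativity:
  fixes sD :: "'k \<Rightarrow> 'd \<Rightarrow> 'd::ab_group_add"
  assumes T: "fquot X T" and \<rho>: "\<And>y. \<rho> y \<in> carrier (tensor2 sD (scC C) sD (scC C))"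
    and lin_\<rho>: "lin sD free_scale (\<lambda>y. nf (tensor2 sD (scC C) sD (scC C)) (\<rho> y))"
    and t: "\<And>d c c'. \<tau> d c c' \<in> carrier T"
    and l: "\<And>c c'. lin sD free_scale (\<lambda>d. nf T (\<tau> d c c'))" "\<And>d c'. lin (scC C) free_scale (\<lambda>c. nf T (\<tau> d c c'))"
      "\<And>d c. lin (scC C) free_scale (\<lambda>c'. nf T (\<tau> d c c'))"
  shows "lift T (\<rho> y) (\<lambda>(d, c). lift T (\<rho> d) (\<lambda>(d', c'). \<tau> d' c' c)) \<in> carrier T"
    and "lift T (\<rho> y) (\<lambda>(d, c). lift T (coprodC C c) (\<lambda>(c', c''). \<tau> d c' c'')) \<in> carrier T"
    and "nf T (lift T (\<rho> y) (\<lambda>(d, c). lift T (\<rho> d) (\<lambda>(d', c'). \<tau> d' c' c)))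
      = lincomb free_scale (\<lambda>(d, c). lincomb free_scale (\<lambda>(d', c'). nf T (\<tau> d' c' c))
          (nf (tensor2 sD (scC C) sD (scC C)) (\<rho> d))) (nf (tensor2 sD (scC C) sD (scC C)) (\<rho> y))"
    and "nf T (lift T (\<rho> y) (\<lambda>(d, c). lift T (coprodC C c) (\<lambda>(c', c''). \<tau> d c' c'')))
      = lincomb free_scale (\<lambda>(d, c). lincomb free_scale (\<lambda>(c', c''). nf T (\<tau> d c' c''))
          (nf (CC C) (coprodC C c))) (nf (tensor2 sD (scC C) sD (scC C)) (\<rho> y))"
proof -
  note Vf = vector_space_free
  have i1: "bal2 sD (scC C) sD (scC C) free_scale (\<lambda>d' c'. nf T (\<tau> d' c' c))" for c
    by (intro bal2_bilinear l)
  have i2: "bal2 (scC C) (scC C) (scC C) (scC C) free_scale (\<lambda>c' c''. nf T (\<tau> d c' c''))" for d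
    by (intro bal2_bilinear l)
  note n1 = nf_lift2[OF \<rho> T t i1] and n2 = nf_lift2[OF coprodC_carrier[unfolded CC_def] T t i2, folded CC_def]
  have o1: "bal2 sD (scC C) sD (scC C) free_scale (\<lambda>d c. nf T (lift T (\<rho> d) (\<lambda>(d', c'). \<tau> d' c' c)))"
    unfolding n1 by (intro bal2_bilinear lin_lincomb_arg lin_lincomb2 Vf lin_\<rho> l)
  have o2: "bal2 sD (scC C) sD (scC C) free_scale (\<lambda>d c. nf T (lift T (coprodC C c) (\<lambda>(c', c''). \<tau> d c' c'')))"
    unfolding n2 by (intro bal2_bilinear lin_lincomb_arg lin_lincomb2 Vf lin_coprodC l)
  note N1 = nf_lift2[OF \<rho> T n1(1) o1] and N2 = nf_lift2[OF \<rho> T n2(1) o2]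
  show "lift T (\<rho> y) (\<lambda>(d, c). lift T (\<rho> d) (\<lambda>(d', c'). \<tau> d' c' c)) \<in> carrier T"
    "lift T (\<rho> y) (\<lambda>(d, c). lift T (coprodC C c) (\<lambda>(c', c''). \<tau> d c' c'')) \<in> carrier T"
    by (rule N1(1), rule N2(1))
  show "nf T (lift T (\<rho> y) (\<lambda>(d, c). lift T (\<rho> d) (\<lambda>(d', c'). \<tau> d' c' c)))
      = lincomb free_scale (\<lambda>(d, c). lincomb free_scale (\<lambda>(d', c'). nf T (\<tau> d' c' c))
          (nf (tensor2 sD (scC C) sD (scC C)) (\<rho> d))) (nf (tensor2 sD (scC C) sD (scC C)) (\<rho> y))"
    unfolding N1(2) n1(2) ..
  show "nf T (lift T (\<rho> y) (\<lambda>(d, c). lift T (coprodC C c) (\<lambda>(c', c''). \<tau> d c' c'')))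
      = lincomb free_scale (\<lambda>(d, c). lincomb free_scale (\<lambda>(c', c''). nf T (\<tau> d c' c''))
          (nf (CC C) (coprodC C c))) (nf (tensor2 sD (scC C) sD (scC C)) (\<rho> y))"
    unfolding N2(2) n2(2) ..
qed

lemma lincomb_tn_CnD2:
  assumes V: "vector_space sc"
    and F: "\<And>b m. lin (scC C) sc (\<lambda>a. F a b m)" "\<And>a m. lin (scC C) sc (\<lambda>b. F a b m)" "\<And>a b. lin sD sc (F a b)"
  shows "lincomb sc (\<lambda>(xs, m). F (xs ! 0) (xs ! 1) m) (tn (CnD C sD 2) ([a, b], m)) = F a b m"
  unfolding CnD_def by (subst lincomb_tnn[OF V baln_multilinear[OF multilin_2]]) (simp_all add: F)

lemma CnD2_fquot: "fquot {(xs, m). length xs = 2} (CnD C sD 2)"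
  and tens_CnD2: "tens (CnD C sD 2) ([a, b], m) \<in> carrier (CnD C sD 2)"
  unfolding CnD_def by (rule fquot_tensor_pow, rule tens_carrier[OF fquot_tensor_pow]) simp

text \<open>A trilinear \<open>F\<close> factors through the triple tensor product in which
  coassociativity is stated, so it can be applied to both sides of the law.\<close>

lemma coassoc:
  assumes V: "vector_space sc"
    and F: "\<And>b c. lin (scC C) sc (\<lambda>a. F a b c)" "\<And>a c. lin (scC C) sc (\<lambda>b. F a b c)"
      "\<And>a b. lin (scC C) sc (\<lambda>c. F a b c)"
  shows "lincomb sc (\<lambda>(a, b). lincomb sc (\<lambda>(a', a''). F a' a'' b) (nf (CC C) (coprodC C a))) (nf (CC C) (coprodC C x))
    = lincomb sc (\<lambda>(a, b). lincomb sc (\<lambda>(b', b''). F a b' b'') (nf (CC C) (coprodC C b))) (nf (CC C) (coprodC C x))"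
proof -
  let ?T = "CnD C (scC C) 2"
  have "lift ?T (coprodC C x) (\<lambda>(a, b). lift ?T (coprodC C a) (\<lambda>(a', a''). tens ?T ([a', a''], b)))
      = lift ?T (coprodC C x) (\<lambda>(a, b). lift ?T (coprodC C b) (\<lambda>(b', b''). tens ?T ([a, b'], b'')))"
    using C unfolding coalgebra_def Let_def by blast
  from arg_cong[OF this, of "\<lambda>A. lincomb sc (\<lambda>(xs, m). F (xs ! 0) (xs ! 1) m) (nf ?T A)"]
  show ?thesis
    unfolding nf_coassociativity(3,4)[OF CnD2_fquot coprodC_carrier[unfolded CC_def] lin_coprodC[unfolded CC_def]
        tens_CnD2 lin_tn_CnD2, folded CC_def]
      lincomb_lincomb2[OF V] lincomb_tn_CnD2[OF V F] .
qed

end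


text \<open>
  \<open>draws sc dr \<Psi> us y G\<close> is \<open>G [y\<^sub>(\<^sub>1\<^sub>)(u\<^sup>1), \<dots>, y\<^sub>(\<^sub>n\<^sub>)(u\<^sup>n)] y\<^sub>(\<^sub>0\<^sub>)\<close>. One factor at a time is split off from
  \<open>y\<close> by the coaction \<open>dr\<close>; since \<open>C\<close> is cocommutative the factors are interchangeable, and applying
  the coproduct to a factor amounts to splitting off another one (\<open>draw_swap\<close> and \<open>draw_split\<close>).
\<close>

primrec draws :: "('k::field \<Rightarrow> 'w \<Rightarrow> 'w) \<Rightarrow> ('d \<Rightarrow> ('d \<times> 'c \<Rightarrow>\<^sub>0 'k)) \<Rightarrow> ('c \<Rightarrow> 'u \<Rightarrow> 'v) \<Rightarrow> 'u list \<Rightarrow> 'd \<Rightarrow>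
    ('v list \<Rightarrow> 'd \<Rightarrow> 'w::ab_group_add) \<Rightarrow> 'w" where
  "draws sc dr \<Psi> [] y G = G [] y"
| "draws sc dr \<Psi> (u # us) y G = lincomb sc (\<lambda>(d, c). draws sc dr \<Psi> us d (\<lambda>vs. G (\<Psi> c u # vs))) (dr y)"

lemma draws_append:
  "draws sc dr \<Psi> (us @ us') y G = draws sc dr \<Psi> us y (\<lambda>vs d. draws sc dr \<Psi> us' d (\<lambda>vs'. G (vs @ vs')))"
  by (induction us arbitrary: y G) (auto intro: lincomb_cong2)

lemma draws_cong:
  "us = us' \<Longrightarrow> y = y' \<Longrightarrow> (\<And>vs d. length vs = length us' \<Longrightarrow> G vs d = G' vs d) \<Longrightarrow>
    draws sc dr \<Psi> us y G = draws sc dr \<Psi> us' y' G'"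
proof (induction us' arbitrary: us y y' G G')
  case (Cons u us')
  show ?case unfolding Cons.prems(1,2) draws.simps
    by (intro lincomb_cong2 refl Cons.IH) (simp add: Cons.prems)
qed simp

lemma draws_lincomb:
  assumes V: "vector_space sc"
  shows "draws sc dr \<Psi> us y (\<lambda>vs d. lincomb sc (\<lambda>(a, b). G a b vs d) z)
    = lincomb sc (\<lambda>(a, b). draws sc dr \<Psi> us y (G a b)) z"
proof (induction us arbitrary: y G)
  case (Cons u us)
  show ?case by (simp add: Cons.IH lincomb_swap2[OF V, of _ "dr y"])
qed simp

lemma lin_draws_fun:
  assumes V: "vector_space sc" and G: "\<And>vs d. length vs = length us \<Longrightarrow> lin s sc (\<lambda>x. G x vs d)"
  shows "lin s sc (\<lambda>x. draws sc dr \<Psi> us y (G x))"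
  using G
proof (induction us arbitrary: y G)
  case (Cons u us)
  show ?case unfolding draws.simps
    by (intro lin_lincomb2 V Cons.IH Cons.prems) simp
qed simp

lemma draws_comp:
  assumes h: "lin sc sc' h"
  shows "h (draws sc dr \<Psi> us y G) = draws sc' dr \<Psi> us y (\<lambda>vs d. h (G vs d))"
  by (induction us arbitrary: y G) (simp_all add: lincomb_comp2[OF h] cong: lincomb_cong2)

section \<open>Interchanging and splitting the legs of a coaction\<close>

locale comodule =
  fixes C :: "('k::field, 'c::ab_group_add) coalg" and D :: "('k, 'c, 'd::ab_group_add) comod"
  assumes coalg: "coalgebra C" and cocomm: "cocommutative C" and comod: "right_comodule C D"
begin

abbreviation "cop x \<equiv> nf (CC C) (coprodC C x)"
abbreviation "dr y \<equiv> nf (DC C D) (coactD D y)"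

lemma comod_vs: "vector_space (scD D)"
  using comod by (simp add: right_comodule_def)

lemma coactD_carrier: "coactD D y \<in> carrier (DC C D)"
  using comod k_linear_carrier[OF fquot_tensor2] unfolding right_comodule_def DC_def by blast

lemma lin_dr: "lin (scD D) free_scale dr"
  using comod k_linear_nf[OF fquot_tensor2] unfolding right_comodule_def DC_def by blast

lemma cop_commute:
  assumes V: "vector_space sc"
    and F: "\<And>b. lin (scC C) sc (\<lambda>a. F a b)" "\<And>a. lin (scC C) sc (\<lambda>b. F a b)"
  shows "lincomb sc (\<lambda>(a, b). F a b) (cop x) = lincomb sc (\<lambda>(a, b). F b a) (cop x)"
proof -
  note mem = coprodC_carrier[OF coalg, unfolded CC_def] and T = fquot_tensor2
  have bal: "bal2 (scC C) (scC C) (scC C) (scC C) free_scale (\<lambda>a b. tn (CC C) (a, b))"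
    unfolding CC_def by (rule bal2_tn)
  have bal': "bal2 (scC C) (scC C) (scC C) (scC C) free_scale (\<lambda>a b. tn (CC C) (b, a))"
    by (intro bal2_bilinear bal2_lin1[OF bal lin_id] bal2_lin2[OF bal lin_id])
  have balF: "bal2 (scC C) (scC C) (scC C) (scC C) sc F"
    by (intro bal2_bilinear F)
  have "lift (CC C) (coprodC C x) (\<lambda>(a, b). tens (CC C) (b, a)) = coprodC C x"
    using cocomm by (simp add: cocommutative_def)
  from arg_cong[OF this, of "nf (CC C)"]
  have "lincomb free_scale (\<lambda>(a, b). tn (CC C) (b, a)) (cop x) = cop x"
    unfolding CC_def
    by (subst (asm) nf_lift2[OF mem T _ bal'[unfolded CC_def]]) (auto intro: tens_carrier[OF T])
  from arg_cong[OF this, of "lincomb sc (\<lambda>(a, b). F a b)"] show ?thesis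
    unfolding lincomb_lincomb2[OF V] unfolding CC_def lincomb_tn2[OF V balF] by simp
qed

lemma draw_assoc:
  assumes V: "vector_space sc"
    and G: "\<And>c c'. lin (scD D) sc (\<lambda>d. G d c c')" "\<And>d c'. lin (scC C) sc (\<lambda>c. G d c c')"
      "\<And>d c. lin (scC C) sc (\<lambda>c'. G d c c')"
  shows "lincomb sc (\<lambda>(d, c). lincomb sc (\<lambda>(d', c'). G d' c' c) (dr d)) (dr y)
    = lincomb sc (\<lambda>(d, c). lincomb sc (\<lambda>(c', c''). G d c' c'') (cop c)) (dr y)"
proof -
  let ?T = "CnD C (scD D) 2"
  have "lift ?T (coactD D y) (\<lambda>(d, c). lift ?T (coactD D d) (\<lambda>(d', c'). tens ?T ([c', c], d')))
      = lift ?T (coactD D y) (\<lambda>(d, c). lift ?T (coprodC C c) (\<lambda>(c', c''). tens ?T ([c', c''], d)))"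
    using comod unfolding right_comodule_def Let_def by blast
  from arg_cong[OF this, of "\<lambda>A. lincomb sc (\<lambda>(xs, m). G m (xs ! 0) (xs ! 1)) (nf ?T A)"]
  show ?thesis
    unfolding nf_coassociativity(3,4)[OF coalg CnD2_fquot[OF coalg] coactD_carrier[unfolded DC_def] lin_dr[unfolded DC_def]
        tens_CnD2[OF coalg] lin_tn_CnD2(3,1,2)[OF coalg], folded DC_def]
      lincomb_lincomb2[OF V] lincomb_tn_CnD2[OF coalg V, of "\<lambda>c c' d. G d c c'", OF G(2,3,1)] .
qed

text \<open>By coassociativity two successive legs are the two halves of a coproduct in
  \<open>C\<close>, and there cocommutativity exchanges them.\<close>

lemma draw_swap:
  assumes V: "vector_space sc"
    and G: "\<And>c c'. lin (scD D) sc (\<lambda>d. G d c c')" "\<And>d c'. lin (scC C) sc (\<lambda>c. G d c c')"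
      "\<And>d c. lin (scC C) sc (\<lambda>c'. G d c c')"
  shows "lincomb sc (\<lambda>(d, c). lincomb sc (\<lambda>(d', c'). G d' c c') (dr d)) (dr y)
    = lincomb sc (\<lambda>(d, c). lincomb sc (\<lambda>(d', c'). G d' c' c) (dr d)) (dr y)"
  unfolding draw_assoc[OF V, of "\<lambda>d c c'. G d c' c", OF G(1,3,2)] draw_assoc[OF V G]
  by (intro lincomb_cong2 refl cop_commute[OF V] G)

text \<open>Coassociativity alone delivers the two legs in the opposite order;
  \<open>draw_swap\<close> corrects this.\<close>

lemma draw_split:
  assumes V: "vector_space sc"
    and G: "\<And>c c'. lin (scD D) sc (\<lambda>d. G d c c')" "\<And>d c'. lin (scC C) sc (\<lambda>c. G d c c')"
      "\<And>d c. lin (scC C) sc (\<lambda>c'. G d c c')"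
  shows "lincomb sc (\<lambda>(d, c). lincomb sc (\<lambda>(c', c''). G d c' c'') (cop c)) (dr y)
    = lincomb sc (\<lambda>(d, c). lincomb sc (\<lambda>(d', c'). G d' c c') (dr d)) (dr y)"
  unfolding draw_swap[OF V, of G, OF G] draw_assoc[OF V, of G, OF G] ..

lemma draw_counit:
  assumes V: "vector_space sc" and g: "lin (scD D) sc g"
  shows "lincomb sc (\<lambda>(d, c). sc (counitC C c) (g d)) (dr y) = g y"
proof -
  interpret D: vector_space "scD D" by (rule comod_vs)
  have bal: "bal2 (scD D) (scC C) (scD D) (scC C) (scD D) (\<lambda>d c. scD D (counitC C c) d)"
    using coalgebra_lin_counit[OF coalg]
    by (intro bal2_bilinear) (auto simp: lin_iff D.scale_left_distrib D.scale_right_distrib mult.commute)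
  have "y = lincomb (scD D) (\<lambda>(d, c). scD D (counitC C c) d) (dr y)"
    using comod unfolding DC_def
    by (subst lift2_type_space[OF coactD_carrier[unfolded DC_def] comod_vs bal, symmetric])
      (simp add: right_comodule_def)
  then have "g y = g (lincomb (scD D) (\<lambda>(d, c). scD D (counitC C c) d) (dr y))" by simp
  then show ?thesis by (simp add: lincomb_comp2[OF g] lin_scale[OF g])
qed

text \<open>No induction is involved: for a nonempty list \<open>y\<close> occurs only in the
  outermost \<open>dr y\<close>, and for the empty list the value is \<open>G [] y\<close>.\<close>

lemma lin_draws_arg: "vector_space sc \<Longrightarrow> (\<And>vs. length vs = length us \<Longrightarrow> lin (scD D) sc (G vs)) \<Longrightarrow>
    lin (scD D) sc (\<lambda>y. draws sc dr \<Psi> us y G)"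
  by (cases us) (auto intro!: lin_lincomb_arg lin_dr)

text \<open>The leg that is split off last is moved to the front, past one leg of the list at a
  time.\<close>

lemma draws_draw_swap:
  assumes V: "vector_space sc" and \<Psi>: "\<And>u. lin (scC C) sv (\<lambda>c. \<Psi> c u)"
    and G: "\<And>c. multilin (length us) sv (scD D) sc (\<lambda>vs d. G vs d c)"
      "\<And>vs d. length vs = length us \<Longrightarrow> lin (scC C) sc (G vs d)"
  shows "draws sc dr \<Psi> us y (\<lambda>vs d. lincomb sc (\<lambda>(d', c). G vs d' c) (dr d))
    = lincomb sc (\<lambda>(d, c). draws sc dr \<Psi> us d (\<lambda>vs d'. G vs d' c)) (dr y)"
  using G
proof (induction us arbitrary: y G)
  case (Cons u us)
  note ml = Cons.prems(1)[unfolded list.size add_Suc_right add_0_right]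
  have "draws sc dr \<Psi> us d (\<lambda>vs d. lincomb sc (\<lambda>(d', c). G (\<Psi> c0 u # vs) d' c) (dr d))
      = lincomb sc (\<lambda>(d', c). draws sc dr \<Psi> us d' (\<lambda>vs d''. G (\<Psi> c0 u # vs) d'' c)) (dr d)" for d c0
    by (intro Cons.IH multilin_Cons[OF ml] Cons.prems(2)) simp
  then show ?case unfolding draws.simps
    by (simp only:) (intro draw_swap V lin_draws_arg lin_draws_fun multilin_last[OF ml _ lin_id]
        multilin_hd[OF ml _ \<Psi>] Cons.prems(2); simp)
qed simp

text \<open>\<open>draws\<close> splits off the leg of the head first, whereas the recursion of
  \<open>iter_coact\<close> splits off the leg of the last factor first. Interchanging legs
  reconciles the two orders.\<close>

lemma draws_snoc:
  fixes sv :: "'k \<Rightarrow> 'v \<Rightarrow> 'v::ab_group_add"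
  assumes V: "vector_space sc" and \<Psi>: "\<And>u. lin (scC C) sv (\<lambda>c. \<Psi> c u)"
    and G: "multilin (Suc (length us)) sv (scD D) sc G"
  shows "draws sc dr \<Psi> (us @ [u]) y G = lincomb sc (\<lambda>(d, c). draws sc dr \<Psi> us d (\<lambda>vs. G (vs @ [\<Psi> c u]))) (dr y)"
proof -
  have "multilin (length us) sv (scD D) sc (\<lambda>vs d. G (vs @ [\<Psi> c u]) d)" for c
    by (rule multilin_snoc[OF G])
  moreover have "lin (scC C) sc (\<lambda>c. G (vs @ [\<Psi> c u]) d)" if "length vs = length us" for vs d
    by (rule multilin_snoc_slot[OF G that \<Psi>])
  ultimately show ?thesis
    by (simp add: draws_append draws_draw_swap[OF V \<Psi>])
qed

text \<open>Membership, linearity in \<open>y\<close> and the recursion are proved together: the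
  \<open>lift\<close> defining the next stage is meaningful only because the present stage is a
  linear map into the right tensor product.\<close>

lemma iter_coact_tensor:
  fixes n :: nat
  defines "T \<equiv> CnD C (scD D)"
  shows iter_coact_carrier: "iter_coact C D n y \<in> carrier (T n)"
    and nf_iter_coact_Suc: "nf (T (Suc n)) (iter_coact C D (Suc n) y) = lincomb free_scale
      (\<lambda>(d, c). lincomb free_scale (\<lambda>(cs, d'). tn (T (Suc n)) (cs @ [c], d')) (nf (T n) (iter_coact C D n d))) (dr y)"
proof -
  note Vf = vector_space_free
  have T: "fquot {(xs, m). length xs = n} (T n)" for n unfolding T_def CnD_def by (rule fquot_tensor_pow)
  note ml = multilin_tn_CnD[OF coalg, where sD = "scD D", folded T_def]
  have step: "(\<forall>y. iter_coact C D (Suc n) y \<in> carrier (T (Suc n)))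
    \<and> lin (scD D) free_scale (\<lambda>y. nf (T (Suc n)) (iter_coact C D (Suc n) y))
    \<and> (\<forall>y. nf (T (Suc n)) (iter_coact C D (Suc n) y) = lincomb free_scale
      (\<lambda>(d, c). lincomb free_scale (\<lambda>(cs, d'). tn (T (Suc n)) (cs @ [c], d')) (nf (T n) (iter_coact C D n d))) (dr y))"
    if mem: "\<And>y. iter_coact C D n y \<in> carrier (T n)"
      and lin: "lin (scD D) free_scale (\<lambda>y. nf (T n) (iter_coact C D n y))" for n
  proof -
    note mem' = mem[unfolded T_def CnD_def]
    have t: "\<forall>cs d. length cs = n \<longrightarrow> tens (T (Suc n)) (cs @ [c], d) \<in> carrier (T (Suc n))" for c
      by (intro allI impI tens_carrier[OF T]) simp
    have i: "baln n (scC C) (scC C) (scC C) (scD D) (scD D) free_scale (\<lambda>cs d'. tn (T (Suc n)) (cs @ [c], d'))" for c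
      by (intro baln_multilinear multilin_snoc[OF ml])
    note n = nf_liftn[OF mem' T t i, folded CnD_def T_def]
    have o: "bal2 (scD D) (scC C) (scD D) (scC C) free_scale
      (\<lambda>d c. nf (T (Suc n)) (lift (T (Suc n)) (iter_coact C D n d) (\<lambda>(cs, d'). tens (T (Suc n)) (cs @ [c], d'))))"
      unfolding n
      by (intro bal2_bilinear lin_lincomb_arg[OF Vf] lin)
        (unfold T_def CnD_def, rule lin_lincombn[OF Vf mem'],
          rule multilin_snoc_slot[OF ml[unfolded T_def CnD_def] _ lin_id])
    note N = nf_lift2[OF coactD_carrier[unfolded DC_def] T n(1) o, folded DC_def]
    have eq: "nf (T (Suc n)) (iter_coact C D (Suc n) y) = lincomb free_scale
      (\<lambda>(d, c). lincomb free_scale (\<lambda>(cs, d'). tn (T (Suc n)) (cs @ [c], d')) (nf (T n) (iter_coact C D n d))) (dr y)" for y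
      using N(2)[unfolded n(2)] by (simp add: T_def Let_def)
    moreover have "iter_coact C D (Suc n) y \<in> carrier (T (Suc n))" for y
      using N(1) by (simp add: T_def Let_def)
    moreover have "lin (scD D) free_scale (\<lambda>y. nf (T (Suc n)) (iter_coact C D (Suc n) y))"
      unfolding eq by (intro lin_lincomb_arg[OF Vf] lin_dr)
    ultimately show ?thesis by blast
  qed
  have all: "(\<forall>y. iter_coact C D n y \<in> carrier (T n)) \<and> lin (scD D) free_scale (\<lambda>y. nf (T n) (iter_coact C D n y))" for n
  proof (induction n)
    case 0
    have "lin (scD D) free_scale (\<lambda>y. tn (T 0) ([], y))" by (rule multilin_last[OF ml _ lin_id]) simp
    then show ?case using tens_carrier[OF T, of "([], _)" 0] by (simp add: T_def)
  next
    case (Suc n)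
    then show ?case using step[of n] by blast
  qed
  show "iter_coact C D n y \<in> carrier (T n)"
    "nf (T (Suc n)) (iter_coact C D (Suc n) y) = lincomb free_scale
      (\<lambda>(d, c). lincomb free_scale (\<lambda>(cs, d'). tn (T (Suc n)) (cs @ [c], d')) (nf (T n) (iter_coact C D n d))) (dr y)"
    using all[of n] step[of n] by blast+
qed

text \<open>The induction runs from the end of the list, because \<open>iter_coact\<close> appends
  the new leg there.\<close>

lemma lincomb_iter_coact:
  assumes V: "vector_space sc" and \<Psi>: "\<And>u. lin (scC C) sv (\<lambda>c. \<Psi> c u)"
    and G: "multilin (length us) sv (scD D) sc G"
  shows "lincomb sc (\<lambda>(cs, d). G (map2 \<Psi> cs us) d) (nf (CnD C (scD D) (length us)) (iter_coact C D (length us) y))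
    = draws sc dr \<Psi> us y G"
  using G
proof (induction us arbitrary: y G rule: rev_induct)
  case Nil
  have "baln 0 (scC C) (scC C) (scC C) (scD D) (scD D) sc (\<lambda>cs d. G [] d)"
    using Nil by (intro baln_multilinear) (simp add: multilin_def)
  from lincomb_tnn[OF V this] show ?case by (simp add: CnD_def)
next
  case (snoc u us)
  let ?T = "CnD C (scD D)" and ?F = "\<lambda>cs d. G (map2 \<Psi> cs (us @ [u])) d"
  have "multilin (Suc (length us)) (scC C) (scD D) sc ?F"
    using multilin_map2[where us = "us @ [u]", OF _ \<Psi>, where G = G] snoc.prems by simp
  from baln_multilinear[OF this]
  have b: "baln (Suc (length us)) (scC C) (scC C) (scC C) (scD D) (scD D) sc ?F" .
  have "lincomb sc (\<lambda>(cs, d). ?F cs d) (nf (?T (Suc (length us))) (iter_coact C D (Suc (length us)) y))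
      = lincomb sc (\<lambda>(d, c). lincomb sc (\<lambda>(cs, d'). ?F (cs @ [c]) d')
          (nf (?T (length us)) (iter_coact C D (length us) d))) (dr y)"
    unfolding nf_iter_coact_Suc lincomb_lincomb2[OF V] lincomb_tnn[OF V b, folded CnD_def] ..
  also have "\<dots> = lincomb sc (\<lambda>(d, c). lincomb sc (\<lambda>(cs, d'). G (map2 \<Psi> cs us @ [\<Psi> c u]) d')
          (nf (?T (length us)) (iter_coact C D (length us) d))) (dr y)"
  \<comment> \<open>\<open>map2\<close> cuts off at the shorter list, so the equation needs the
    length of \<open>cs\<close>, which is known for the keys of a normal form.\<close>
  proof (intro lincomb_cong2 refl)
    fix d c cs d'
    assume "(cs, d') \<in> Poly_Mapping.keys (nf (?T (length us)) (iter_coact C D (length us) d))"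
    then have "length cs = length us"
      using length_nf_keys[OF iter_coact_carrier[unfolded CnD_def]] by (simp add: CnD_def)
    then show "?F (cs @ [c]) d' = G (map2 \<Psi> cs us @ [\<Psi> c u]) d'" by simp
  qed
  also have "\<dots> = lincomb sc (\<lambda>(d, c). draws sc dr \<Psi> us d (\<lambda>vs. G (vs @ [\<Psi> c u]))) (dr y)"
    by (intro lincomb_cong2 refl snoc.IH multilin_snoc) (use snoc.prems in simp)
  also have "\<dots> = draws sc dr \<Psi> (us @ [u]) y G"
    by (rule draws_snoc[OF V \<Psi>, symmetric]) (use snoc.prems in simp)
  finally show ?case by simp
qed

end

text \<open>\<open>C\<close> coacts on itself, so everything shown for legs of \<open>D\<close> also
  applies to legs of an element of \<open>C\<close>.\<close>

lemma regular_comodule: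
  assumes "coalgebra C" "cocommutative C"
  shows "comodule C \<lparr>scD = scC C, coactD = coprodC C\<rparr>"
proof -
  let ?D = "\<lparr>scD = scC C, coactD = coprodC C\<rparr>"
  let ?T = "CnD C (scC C) 2"
  note N = nf_coassociativity[OF assms(1) CnD2_fquot[OF assms(1)] coprodC_carrier[OF assms(1), unfolded CC_def]
      lin_coprodC[OF assms(1), unfolded CC_def] tens_CnD2[OF assms(1)] lin_tn_CnD2(3,1,2)[OF assms(1)], folded CC_def]
  have "lift ?T (coprodC C y) (\<lambda>(d, c). lift ?T (coprodC C d) (\<lambda>(d', c'). tens ?T ([c', c], d')))
      = lift ?T (coprodC C y) (\<lambda>(d, c). lift ?T (coprodC C c) (\<lambda>(c', c''). tens ?T ([c', c''], d)))" for y
    by (rule nf_inj[OF CnD2_fquot[OF assms(1)] N(1,2)], unfold N(3,4))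
      (rule coassoc[OF assms(1) vector_space_free, of "\<lambda>a a' b. tn ?T ([a', b], a)", OF lin_tn_CnD2(3,1,2)[OF assms(1)]])
  moreover have "k_linear (type_space (scC C)) (CC C) (coprodC C)" "vector_space (scC C)"
    "lift (type_space (scC C)) (coprodC C x) (\<lambda>(d, c). scC C (counitC C c) d) = x" for x
    using assms(1) by (simp_all add: coalgebra_def)
  moreover have "DC C ?D = CC C" by (simp add: DC_def CC_def)
  ultimately show ?thesis
    by (intro comodule.intro assms) (simp add: right_comodule_def)
qed

section \<open>Hopf algebroids\<close>

lemma lincomb_tn_nf:
  assumes T: "fquot X T" and A: "A \<in> carrier T"
  shows "lincomb free_scale (tn T) (nf T A) = nf T A"
proof -
  have "lincomb free_scale (tn T) (nf T A) = proj \<zero>\<^bsub>T\<^esub> (nf T A)"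
    by (simp add: lincomb_comp[OF proj_lin[OF T], symmetric] tens_def nf_coset[OF T] lincomb_free_gen)
  also have "\<dots> = nf T A"
    using nf_coset[OF T, of UNIV "nf T A"] carrier_eq_coset[OF T A nf_mem[OF T A]] by simp
  finally show ?thesis .
qed

text \<open>\<open>icop sc \<Delta> n u F\<close> is \<open>F [u\<^sub>(\<^sub>1\<^sub>), \<dots>, u\<^sub>(\<^sub>n\<^sub>)] u\<^sub>(\<^sub>n\<^sub>+\<^sub>1\<^sub>)\<close>.\<close>

primrec icop :: "('k::field \<Rightarrow> 'w \<Rightarrow> 'w) \<Rightarrow> ('u \<Rightarrow> ('u \<times> 'u \<Rightarrow>\<^sub>0 'k)) \<Rightarrow> nat \<Rightarrow> 'u \<Rightarrow>
    ('u list \<Rightarrow> 'u \<Rightarrow> 'w::ab_group_add) \<Rightarrow> 'w" where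
  "icop sc \<Delta> 0 u F = F [] u"
| "icop sc \<Delta> (Suc n) u F = lincomb sc (\<lambda>(u1, u2). icop sc \<Delta> n u2 (\<lambda>vs. F (u1 # vs))) (\<Delta> u)"

lemma icop_cong:
  assumes "\<And>vs v. length vs = n \<Longrightarrow> F vs v = F' vs v"
  shows "icop sc \<Delta> n u F = icop sc \<Delta> n u F'"
  using assms
proof (induction n arbitrary: u F F')
  case (Suc n)
  show ?case unfolding icop.simps
    by (intro lincomb_cong2 refl Suc.IH Suc.prems) simp
qed simp

lemma icop_lincomb:
  assumes V: "vector_space sc"
  shows "icop sc \<Delta> n u (\<lambda>vs v. lincomb sc (\<lambda>(a, b). F a b vs v) z)
    = lincomb sc (\<lambda>(a, b). icop sc \<Delta> n u (F a b)) z"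
proof (induction n arbitrary: u F)
  case (Suc n)
  show ?case by (simp add: Suc.IH lincomb_swap2[OF V, of _ "\<Delta> u"])
qed simp

lemma lin_icop_fun:
  assumes V: "vector_space sc" and F: "\<And>vs v. length vs = n \<Longrightarrow> lin s0 sc (\<lambda>x. F x vs v)"
  shows "lin s0 sc (\<lambda>x. icop sc \<Delta> n u (F x))"
  using F
proof (induction n arbitrary: u F)
  case (Suc n)
  show ?case unfolding icop.simps by (intro lin_lincomb2 V Suc.IH Suc.prems) simp
qed simp

lemma draws_icop:
  assumes V: "vector_space sc"
  shows "draws sc dr \<Psi> us y (\<lambda>vs d. icop sc \<Delta> n u (\<lambda>ws w. G ws w vs d))
    = icop sc \<Delta> n u (\<lambda>ws w. draws sc dr \<Psi> us y (G ws w))"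
proof (induction n arbitrary: u G)
  case (Suc n)
  show ?case by (simp add: draws_lincomb[OF V] Suc.IH)
qed simp

lemma icop_comp:
  assumes h: "lin sc sc' h"
  shows "h (icop sc \<Delta> n u F) = icop sc' \<Delta> n u (\<lambda>vs v. h (F vs v))"
  by (induction n arbitrary: u F) (simp_all add: lincomb_comp2[OF h] cong: lincomb_cong2)

locale hopf_alg =
  fixes H :: "('k::field, 'u::{ring,monoid_mult}, 'a::{ring,monoid_mult}) hopf"
  assumes hopf: "hopf_algebroid H"
begin

abbreviation "s \<equiv> src H"
abbreviation "t \<equiv> tgt H"
abbreviation "\<epsilon> \<equiv> counit H"
abbreviation "S \<equiv> antipode H"
abbreviation "dl u \<equiv> nf (UU H) (coprod H u)"
abbreviation "balU sc F \<equiv> bal2 (scU H) (scU H) (\<lambda>a u. t a * u) (\<lambda>a u. s a * u) sc F"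
abbreviation "balop sc F \<equiv> bal2 (scU H) (scU H) (\<lambda>a u. u * t a) (\<lambda>a u. t a * u) sc F"
abbreviation "balUn n sc F \<equiv> baln n (scU H) (\<lambda>a u. t a * u) (\<lambda>a u. s a * u) (scU H) (\<lambda>a u. s a * u) sc F"

lemma bialg: "left_bialgebroid H"
  using hopf by (simp add: hopf_algebroid_def)

lemma U_alg: "k_algebra (scU H)"
  and lin_s: "lin (scA H) (scU H) s" and s_one: "s 1 = 1" and s_mult: "s (a * b) = s a * s b"
  and t_one: "t 1 = 1"
  and st_commute: "s a * t b = t b * s a"
  and k_linear_coprod: "k_linear (type_space (scU H)) (UU H) (coprod H)"
  and coprod_bimod: "coprod H (s a * t b * u) = lift (UU H) (coprod H u) (\<lambda>(u1, u2). tens (UU H) (s a * u1, t b * u2))"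
  and lin_counit: "lin (scU H) (scA H) \<epsilon>"
  and counit_bimod: "\<epsilon> (s a * t b * u) = a * \<epsilon> u * b"
  and coprod_takeuchi: "lift (UU H) (coprod H u) (\<lambda>(u1, u2). tens (UU H) (u1 * t a, u2))
            = lift (UU H) (coprod H u) (\<lambda>(u1, u2). tens (UU H) (u1, u2 * s a))"
  and coprod_one: "coprod H 1 = tens (UU H) (1, 1)"
  and coprod_mult: "coprod H (u * v) = lift (UU H) (coprod H v) (\<lambda>(v1, v2). lift (UU H) (coprod H u) (\<lambda>(u1, u2). tens (UU H) (u1 * v1, u2 * v2)))"
  using bialg unfolding left_bialgebroid_def Let_def by - (elim conjE, (assumption | (erule allE)+, assumption))+

lemma lin_S: "lin (scU H) (scU H) S" and S_mult: "S (u * v) = S v * S u" and S_S: "S (S u) = u"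
  and S_t: "S (t a) = s a"
  and antipode_left: "lift (UU H) (coprod H u) (\<lambda>(u1, u2). lift (UU H) (coprod H (S u1)) (\<lambda>(v, w). tens (UU H) (v * u2, w)))
          = tens (UU H) (1, S u)"
  and antipode_right: "lift (UU H) (coprod H u) (\<lambda>(u1, u2). lift (UU H) (coprod H (S u2)) (\<lambda>(v, w). tens (UU H) (v, w * u1)))
          = tens (UU H) (S u, 1)"
  using hopf unfolding hopf_algebroid_def Let_def by - (elim conjE, (assumption | (erule allE)+, assumption))+

lemma S_s: "S (s a) = t a"
  by (metis S_S S_t)

lemma st_left_commute: "s a * (t b * x) = t b * (s a * x)"
  by (metis mult.assoc st_commute)

lemma U_vs: "vector_space (scU H)"
  using U_alg by (simp add: k_algebra_def)

lemma lin_mult_left: "lin s0 (scU H) g \<Longrightarrow> lin s0 (scU H) (\<lambda>x. u * g x)"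
  and lin_mult_right: "lin s0 (scU H) g \<Longrightarrow> lin s0 (scU H) (\<lambda>x. g x * u)"
  using U_alg by (simp_all add: lin_iff k_algebra_def algebra_simps)

lemmas lin_U = lin_id lin_mult_left lin_mult_right lin_compose[OF _ lin_S]

lemma coprod_carrier: "coprod H u \<in> carrier (UU H)"
  using k_linear_coprod k_linear_carrier[OF fquot_tensor2] unfolding UU_def by blast

lemma lin_dl: "lin (scU H) free_scale dl"
  using k_linear_coprod k_linear_nf[OF fquot_tensor2] unfolding UU_def by blast

lemma UU_fquot: "fquot UNIV (UU H)" and UopU_fquot: "fquot UNIV (UopU H)"
  unfolding UU_def UopU_def by (rule fquot_tensor2)+

lemmas coprod_carrier' = coprod_carrier[unfolded UU_def]

lemma tens_UU: "tens (UU H) g \<in> carrier (UU H)" and tens_UopU: "tens (UopU H) g \<in> carrier (UopU H)"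
  by (simp_all add: tens_carrier[OF UU_fquot] tens_carrier[OF UopU_fquot])

lemma tn_UU: "balU free_scale (\<lambda>x y. tn (UU H) (x, y))"
  unfolding UU_def by (rule bal2_tn)

lemma tn_UopU: "balop free_scale (\<lambda>x y. tn (UopU H) (x, y))"
  unfolding UopU_def by (rule bal2_tn)

lemma balUI:
  "(\<And>y. lin (scU H) sc (\<lambda>x. F x y)) \<Longrightarrow> (\<And>x. lin (scU H) sc (\<lambda>y. F x y)) \<Longrightarrow>
    (\<And>a x y. F (t a * x) y = F x (s a * y)) \<Longrightarrow> balU sc F"
  by (simp add: bal2_def)

lemma balopI:
  "(\<And>y. lin (scU H) sc (\<lambda>x. F x y)) \<Longrightarrow> (\<And>x. lin (scU H) sc (\<lambda>y. F x y)) \<Longrightarrow>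
    (\<And>a x y. F (x * t a) y = F x (t a * y)) \<Longrightarrow> balop sc F"
  by (simp add: bal2_def)

section \<open>Calculation rules for the coproduct under balanced maps\<close>

context
  fixes sc :: "'k \<Rightarrow> 'w \<Rightarrow> 'w::ab_group_add" and F :: "'u \<Rightarrow> 'u \<Rightarrow> 'w"
  assumes V: "vector_space sc" and F: "balU sc F"
begin

lemma lincomb_tn_UU: "lincomb sc (\<lambda>(x, y). F x y) (tn (UU H) (x, y)) = F x y"
  unfolding UU_def by (rule lincomb_tn2[OF V F])

text \<open>The common route from an axiom, which is an equation between \<open>lift\<close>s in U
  \<otimes> U, to an equation between sums over \<open>dl u\<close> with an arbitrary balanced
  \<open>F\<close>.\<close>

lemma lincomb_lift_UU:
  assumes b: "balU free_scale (\<lambda>x y. tn (UU H) (p x y, q x y))"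
  shows "lincomb sc (\<lambda>(x, y). F x y) (nf (UU H) (lift (UU H) (coprod H u) (\<lambda>(x, y). tens (UU H) (p x y, q x y))))
    = lincomb sc (\<lambda>(x, y). F (p x y) (q x y)) (dl u)"
  unfolding nf_lift2[OF coprod_carrier' UU_fquot tens_UU b, folded UU_def] lincomb_lincomb2[OF V] lincomb_tn_UU ..

lemma sw_bimod:
  "lincomb sc (\<lambda>(x, y). F x y) (dl (s a * t b * u)) = lincomb sc (\<lambda>(x, y). F (s a * x) (t b * y)) (dl u)"
  unfolding coprod_bimod
proof (rule lincomb_lift_UU[OF balUI])
  fix c x y
  show "tn (UU H) (s a * (t c * x), t b * y) = tn (UU H) (s a * x, t b * (s c * y))"
    by (simp only: st_left_commute bal2_move[OF tn_UU])
qed (intro bal2_lin1[OF tn_UU] bal2_lin2[OF tn_UU] lin_U)+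

lemma sw_src: "lincomb sc (\<lambda>(x, y). F x y) (dl (s a * u)) = lincomb sc (\<lambda>(x, y). F (s a * x) y) (dl u)"
  using sw_bimod[of a 1 u] by (simp add: t_one)

lemma sw_tgt: "lincomb sc (\<lambda>(x, y). F x y) (dl (t a * u)) = lincomb sc (\<lambda>(x, y). F x (t a * y)) (dl u)"
  using sw_bimod[of 1 a u] by (simp add: s_one)

lemma sw_takeuchi:
  "lincomb sc (\<lambda>(x, y). F (x * t a) y) (dl u) = lincomb sc (\<lambda>(x, y). F x (y * s a)) (dl u)"
proof -
  have 1: "balU free_scale (\<lambda>x y. tn (UU H) (x * t a, y))" for a
    by (intro balUI bal2_lin1[OF tn_UU] bal2_lin2[OF tn_UU] lin_U) (simp add: bal2_move[OF tn_UU] mult.assoc)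
  have 2: "balU free_scale (\<lambda>x y. tn (UU H) (x, y * s a))" for a
    by (intro balUI bal2_lin1[OF tn_UU] bal2_lin2[OF tn_UU] lin_U) (simp add: bal2_move[OF tn_UU] mult.assoc)
  show ?thesis
    using arg_cong[OF coprod_takeuchi, of "\<lambda>X. lincomb sc (\<lambda>(x, y). F x y) (nf (UU H) X)"]
    unfolding lincomb_lift_UU[OF 1] lincomb_lift_UU[OF 2] .
qed

lemma sw_one: "lincomb sc (\<lambda>(x, y). F x y) (dl 1) = F 1 1"
  by (simp add: coprod_one lincomb_tn_UU)

end

text \<open>A single term \<open>F (u1 * x) (u2 * y)\<close> need not be balanced in
  \<open>x\<close> and \<open>y\<close>; the sum over the coproduct of \<open>u\<close> is, by the
  Takeuchi condition. This is why the left factor of a product supplies the inner sum in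
  \<open>sw_mult\<close>.\<close>

lemma sw_mult_balU:
  assumes V: "vector_space sc" and F: "balU sc F"
  shows "balU sc (\<lambda>x y. lincomb sc (\<lambda>(u1, u2). F (u1 * x) (u2 * y)) (dl u))"
proof (intro balUI lin_lincomb2 V bal2_lin1[OF F] bal2_lin2[OF F] lin_U)
  fix a x y
  have "balU sc (\<lambda>u1 u2. F (u1 * x) (u2 * y))"
    by (intro balUI bal2_lin1[OF F] bal2_lin2[OF F] lin_U) (simp add: bal2_move[OF F] mult.assoc)
  from sw_takeuchi[OF V this]
  show "lincomb sc (\<lambda>(u1, u2). F (u1 * (t a * x)) (u2 * y)) (dl u)
      = lincomb sc (\<lambda>(u1, u2). F (u1 * x) (u2 * (s a * y))) (dl u)" by (simp add: mult.assoc)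
qed

lemma sw_mult:
  assumes V: "vector_space sc" and F: "balU sc F"
  shows "lincomb sc (\<lambda>(x, y). F x y) (dl (u * v))
    = lincomb sc (\<lambda>(v1, v2). lincomb sc (\<lambda>(u1, u2). F (u1 * v1) (u2 * v2)) (dl u)) (dl v)"
proof -
  have i: "balU free_scale (\<lambda>u1 u2. tn (UU H) (u1 * v1, u2 * v2))" for v1 v2
    by (intro balUI bal2_lin1[OF tn_UU] bal2_lin2[OF tn_UU] lin_U) (simp add: bal2_move[OF tn_UU] mult.assoc)
  note n = nf_lift2[OF coprod_carrier' UU_fquot tens_UU i, folded UU_def]
  have o: "balU free_scale (\<lambda>v1 v2. nf (UU H) (lift (UU H) (coprod H u) (\<lambda>(u1, u2). tens (UU H) (u1 * v1, u2 * v2))))"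
    unfolding n by (rule sw_mult_balU[OF vector_space_free tn_UU])
  show ?thesis
    unfolding coprod_mult nf_lift2[OF coprod_carrier' UU_fquot n(1) o, folded UU_def] n
      lincomb_lincomb2[OF V] lincomb_tn_UU[OF V F] ..
qed

text \<open>The bimodule law only covers multiplication from the left. Writing \<open>s a\<close> as
  \<open>s a * 1\<close> gives \<Delta>(s(a)) = s(a) \<otimes> 1 inside the outer sum of
  \<open>sw_mult\<close>.\<close>

lemma sw_mult_src:
  assumes V: "vector_space sc" and F: "balU sc F"
  shows "lincomb sc (\<lambda>(x, y). F x y) (dl (u * s a)) = lincomb sc (\<lambda>(x, y). F (x * s a) y) (dl u)"
proof -
  let ?K = "\<lambda>x y. lincomb sc (\<lambda>(u1, u2). F (u1 * x) (u2 * y)) (dl u)"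
  have K: "balU sc ?K" by (rule sw_mult_balU[OF V F])
  have "lincomb sc (\<lambda>(x, y). ?K x y) (dl (s a * 1)) = lincomb sc (\<lambda>(x, y). ?K (s a * x) y) (dl 1)"
    by (rule sw_src[OF V K])
  also have "\<dots> = ?K (s a * 1) 1"
    by (rule sw_one[OF V]) (intro balUI bal2_lin1[OF K] bal2_lin2[OF K] lin_U,
        simp only: st_left_commute bal2_move[OF K])
  finally show ?thesis by (simp add: sw_mult[OF V F])
qed

lemma sw_mult_tgt:
  assumes V: "vector_space sc" and F: "balU sc F"
  shows "lincomb sc (\<lambda>(x, y). F x y) (dl (u * t a)) = lincomb sc (\<lambda>(x, y). F x (y * t a)) (dl u)"
proof -
  let ?K = "\<lambda>x y. lincomb sc (\<lambda>(u1, u2). F (u1 * x) (u2 * y)) (dl u)"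
  have K: "balU sc ?K" by (rule sw_mult_balU[OF V F])
  have "lincomb sc (\<lambda>(x, y). ?K x y) (dl (t a * 1)) = lincomb sc (\<lambda>(x, y). ?K x (t a * y)) (dl 1)"
    by (rule sw_tgt[OF V K])
  also have "\<dots> = ?K 1 (t a * 1)"
    by (rule sw_one[OF V]) (intro balUI bal2_lin1[OF K] bal2_lin2[OF K] lin_U,
        simp only: st_left_commute bal2_move[OF K])
  finally show ?thesis by (simp add: sw_mult[OF V F])
qed

text \<open>The outer sum is balanced since S(t(a)u) = S(u)s(a), and \<Delta> carries the factor
  s(a) to the first leg, next to \<open>u2\<close>. On the other side of the pair, in
  \<open>sw_antipode_right\<close>, S(s(a)u) = S(u)t(a) goes to the second leg.\<close>

lemma sw_antipode_left:
  assumes V: "vector_space sc" and F: "balU sc F"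
  shows "lincomb sc (\<lambda>(u1, u2). lincomb sc (\<lambda>(v, w). F (v * u2) w) (dl (S u1))) (dl u) = F 1 (S u)"
proof -
  have i: "balU sc' (\<lambda>v w. F' (v * u2) w)" if "balU sc' F'"
    for sc' :: "'k \<Rightarrow> 'w \<Rightarrow> 'w::ab_group_add" and F' u2
    by (intro balUI bal2_lin1[OF that] bal2_lin2[OF that] lin_U) (simp add: bal2_move[OF that] mult.assoc)
  note n = nf_lift2[OF coprod_carrier' UU_fquot tens_UU i[OF tn_UU], folded UU_def]
  have o: "balU free_scale (\<lambda>u1 u2. nf (UU H) (lift (UU H) (coprod H (S u1)) (\<lambda>(v, w). tens (UU H) (v * u2, w))))"
    unfolding n
    by (intro balUI lin_lincomb2 vector_space_free bal2_lin1[OF tn_UU] lin_U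
        lin_lincomb_arg[OF vector_space_free lin_compose[OF lin_S lin_dl]])
      (simp add: S_mult S_t sw_mult_src[OF vector_space_free i[OF tn_UU]] mult.assoc)
  show ?thesis
    using arg_cong[OF antipode_left, of "\<lambda>X. lincomb sc (\<lambda>(x, y). F x y) (nf (UU H) X)" u]
    unfolding nf_lift2[OF coprod_carrier' UU_fquot n(1) o, folded UU_def] n
      lincomb_lincomb2[OF V] lincomb_tn_UU[OF V F] .
qed

lemma sw_antipode_right:
  assumes V: "vector_space sc" and F: "balU sc F"
  shows "lincomb sc (\<lambda>(u1, u2). lincomb sc (\<lambda>(v, w). F v (w * u1)) (dl (S u2))) (dl u) = F (S u) 1"
proof -
  have i: "balU sc' (\<lambda>v w. F' v (w * u2))" if "balU sc' F'"
    for sc' :: "'k \<Rightarrow> 'w \<Rightarrow> 'w::ab_group_add" and F' u2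
    by (intro balUI bal2_lin1[OF that] bal2_lin2[OF that] lin_U) (simp add: bal2_move[OF that] mult.assoc)
  note n = nf_lift2[OF coprod_carrier' UU_fquot tens_UU i[OF tn_UU], folded UU_def]
  have o: "balU free_scale (\<lambda>u1 u2. nf (UU H) (lift (UU H) (coprod H (S u2)) (\<lambda>(v, w). tens (UU H) (v, w * u1))))"
    unfolding n
    by (intro balUI lin_lincomb2 vector_space_free bal2_lin2[OF tn_UU] lin_U
        lin_lincomb_arg[OF vector_space_free lin_compose[OF lin_S lin_dl]])
      (simp add: S_mult S_s sw_mult_tgt[OF vector_space_free i[OF tn_UU]] mult.assoc)
  show ?thesis
    using arg_cong[OF antipode_right, of "\<lambda>X. lincomb sc (\<lambda>(x, y). F x y) (nf (UU H) X)" u]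
    unfolding nf_lift2[OF coprod_carrier' UU_fquot n(1) o, folded UU_def] n
      lincomb_lincomb2[OF V] lincomb_tn_UU[OF V F] .
qed

text \<open>
  The inverse of \<open>\<beta>\<close> is \<open>u \<otimes> v \<mapsto> S(S(u)\<^sub>(\<^sub>2\<^sub>)) \<otimes> S(u)\<^sub>(\<^sub>1\<^sub>) v\<close>: the two antipode axioms say that this is
  a left inverse and a right inverse.
\<close>

lemma nf_hopf_beta:
  assumes X: "X \<in> carrier (UopU H)"
  shows hopf_beta_carrier: "hopf_beta H X \<in> carrier (UU H)"
    and "nf (UU H) (hopf_beta H X) = lincomb free_scale
      (\<lambda>(u, v). lincomb free_scale (\<lambda>(u1, u2). tn (UU H) (u1, u2 * v)) (dl u)) (nf (UopU H) X)"
proof -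
  have i: "balU free_scale (\<lambda>u1 u2. tn (UU H) (u1, u2 * v))" for v
    by (intro balUI bal2_lin1[OF tn_UU] bal2_lin2[OF tn_UU] lin_U) (simp add: bal2_move[OF tn_UU] mult.assoc)
  note n = nf_lift2[OF coprod_carrier' UU_fquot tens_UU i, folded UU_def]
  have o: "balop free_scale (\<lambda>u v. nf (UU H) (lift (UU H) (coprod H u) (\<lambda>(u1, u2). tens (UU H) (u1, u2 * v))))"
    unfolding n
    by (intro balopI lin_lincomb2 vector_space_free bal2_lin2[OF tn_UU] lin_U
        lin_lincomb_arg[OF vector_space_free lin_dl])
      (simp add: sw_mult_tgt[OF vector_space_free i] mult.assoc)
  note N = nf_lift2[OF X[unfolded UopU_def] UU_fquot n(1) o, folded UopU_def]
  show "hopf_beta H X \<in> carrier (UU H)" unfolding hopf_beta_def by (rule N(1))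
  show "nf (UU H) (hopf_beta H X) = lincomb free_scale
      (\<lambda>(u, v). lincomb free_scale (\<lambda>(u1, u2). tn (UU H) (u1, u2 * v)) (dl u)) (nf (UopU H) X)"
    unfolding hopf_beta_def N n ..
qed

lemma balU_flip':
  assumes K: "balop sc K"
  shows "balU sc (\<lambda>w1 w2. K (S w2) (w1 * v))"
  by (intro balUI bal2_lin1[OF K] bal2_lin2[OF K] lin_U lin_S) (simp add: S_mult S_s bal2_move[OF K] mult.assoc)

lemma balU_flip: "balop sc K \<Longrightarrow> balU sc (\<lambda>w1 w2. K (S w2) w1)"
  using balU_flip'[of sc K 1] by simp

lemma balop_flip:
  assumes B: "balU sc B"
  shows "balop sc (\<lambda>x y. B y (S x))"
  by (intro balopI bal2_lin1[OF B] bal2_lin2[OF B] lin_U lin_S) (simp add: S_mult S_t bal2_move[OF B])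

lemma inj_hopf_beta: "inj_on (hopf_beta H) (carrier (UopU H))"
proof -
  let ?\<Phi> = "\<lambda>u v. lincomb free_scale (\<lambda>(w1, w2). tn (UopU H) (S w2, w1 * v)) (dl (S u))"
  note Vf = vector_space_free
  have \<Phi>: "balU free_scale ?\<Phi>"
    by (intro balUI lin_lincomb2 Vf bal2_lin2[OF tn_UopU] lin_U lin_lincomb_arg[OF Vf lin_compose[OF lin_S lin_dl]])
      (simp add: S_mult S_t sw_mult_src[OF Vf balU_flip'[OF tn_UopU]] mult.assoc)
  have "lincomb free_scale (\<lambda>(u, v). ?\<Phi> u v) (nf (UU H) (hopf_beta H X)) = nf (UopU H) X"
    if X: "X \<in> carrier (UopU H)" for X
  proof -
    \<comment> \<open>The first antipode axiom for the test map \<open>S w2 \<otimes> w1 v\<close>: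
      it collapses the first leg to 1 and the second to S(u), and S(S(u)) = u.\<close>
    have "lincomb free_scale (\<lambda>(u1, u2). ?\<Phi> u1 (u2 * v)) (dl u) = tn (UopU H) (u, v)" for u v
    proof -
      have "balU free_scale (\<lambda>w1 w2. tn (UopU H) (S w2, w1 * v))" by (rule balU_flip'[OF tn_UopU])
      from sw_antipode_left[OF Vf this, of u] show ?thesis by (simp add: S_S mult.assoc)
    qed
    then have "lincomb free_scale (\<lambda>(u, v). ?\<Phi> u v) (nf (UU H) (hopf_beta H X))
        = lincomb free_scale (\<lambda>(u, v). tn (UopU H) (u, v)) (nf (UopU H) X)"
      unfolding nf_hopf_beta[OF X] lincomb_lincomb2[OF Vf] lincomb_tn_UU[OF Vf \<Phi>] by simp
    also have "\<dots> = nf (UopU H) X" using lincomb_tn_nf[OF UopU_fquot X] by (simp add: split_def)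
    finally show ?thesis .
  qed
  then show ?thesis by (metis (no_types, lifting) inj_onI nf_inj[OF UopU_fquot])
qed

text \<open>Since \<open>translation\<close> is an \<open>inv_into\<close>, injectivity of \<beta>
  and one preimage of u \<otimes> 1 determine it. The preimage \<open>?G\<close> is the value of the
  explicit inverse there.\<close>

lemma translation_carrier: "translation H u \<in> carrier (UopU H)"
  and nf_translation: "nf (UopU H) (translation H u)
    = lincomb free_scale (\<lambda>(w1, w2). tn (UopU H) (S w2, w1)) (dl (S u))"
proof -
  let ?G = "lift (UopU H) (coprod H (S u)) (\<lambda>(w1, w2). tens (UopU H) (S w2, w1))"
  note Vf = vector_space_free
  note N = nf_lift2[OF coprod_carrier' UopU_fquot tens_UopU balU_flip[OF tn_UopU], folded UU_def]
  have b: "balop free_scale (\<lambda>u v. lincomb free_scale (\<lambda>(u1, u2). tn (UU H) (u1, u2 * v)) (dl u))"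
  proof (intro balopI lin_lincomb2 Vf bal2_lin2[OF tn_UU] lin_U lin_lincomb_arg[OF Vf lin_dl])
    fix a x y
    have i: "balU free_scale (\<lambda>u1 u2. tn (UU H) (u1, u2 * y))"
      by (intro balUI bal2_lin1[OF tn_UU] bal2_lin2[OF tn_UU] lin_U) (simp add: bal2_move[OF tn_UU] mult.assoc)
    show "lincomb free_scale (\<lambda>(u1, u2). tn (UU H) (u1, u2 * y)) (dl (x * t a))
        = lincomb free_scale (\<lambda>(u1, u2). tn (UU H) (u1, u2 * (t a * y))) (dl x)"
      by (simp add: sw_mult_tgt[OF Vf i] mult.assoc)
  qed
  have ev: "lincomb free_scale (\<lambda>(u, v). lincomb free_scale (\<lambda>(u1, u2). tn (UU H) (u1, u2 * v)) (dl u))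
      (tn (UopU H) (x, y)) = lincomb free_scale (\<lambda>(u1, u2). tn (UU H) (u1, u2 * y)) (dl x)" for x y
    unfolding UopU_def by (rule lincomb_tn2[OF Vf b])
  have "hopf_beta H ?G = tens (UU H) (u, 1)"
  proof (rule nf_inj[OF UU_fquot hopf_beta_carrier[OF N(1)] tens_UU])
    \<comment> \<open>This is the second antipode axiom at S(u), with S(S(u)) = u.\<close>
    show "nf (UU H) (hopf_beta H ?G) = tn (UU H) (u, 1)"
      unfolding nf_hopf_beta(2)[OF N(1)] N(2) lincomb_lincomb2[OF Vf] ev
      using sw_antipode_right[OF Vf tn_UU, of "S u"] by (simp add: S_S)
  qed
  then have eq: "translation H u = ?G"
    unfolding translation_def by (intro inv_into_f_eq inj_hopf_beta N(1))
  show "translation H u \<in> carrier (UopU H)" unfolding eq by (rule N(1))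
  show "nf (UopU H) (translation H u) = lincomb free_scale (\<lambda>(w1, w2). tn (UopU H) (S w2, w1)) (dl (S u))"
    unfolding eq by (rule N(2))
qed

section \<open>Calculation rules for \<open>u\<^sub>+ \<otimes> u\<^sub>-\<close>\<close>

abbreviation "tr u \<equiv> nf (UopU H) (translation H u)"

lemma lin_tr: "lin (scU H) free_scale tr"
  unfolding nf_translation by (intro lin_lincomb_arg vector_space_free lin_compose[OF lin_S lin_dl])

lemma sw_tr:
  assumes V: "vector_space sc" and K: "balop sc K"
  shows "lincomb sc (\<lambda>(x, y). K x y) (tr u) = lincomb sc (\<lambda>(w1, w2). K (S w2) w1) (dl (S u))"
proof -
  have "lincomb sc (\<lambda>(x, y). K x y) (tn (UopU H) (a, b)) = K a b" for a b
    unfolding UopU_def by (rule lincomb_tn2[OF V K])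
  then show ?thesis unfolding nf_translation lincomb_lincomb2[OF V] by simp
qed

text \<open>Expressed through S(u) this is the Takeuchi condition, because t(a)S(w) = S(w
  s(a)).\<close>

lemma sw_tr_move:
  assumes V: "vector_space sc" and K: "balop sc K"
  shows "lincomb sc (\<lambda>(x, y). K (t a * x) y) (tr u) = lincomb sc (\<lambda>(x, y). K x (y * t a)) (tr u)"
proof -
  have 1: "balop sc (\<lambda>x y. K (t a * x) y)"
    by (intro balopI bal2_lin1[OF K] bal2_lin2[OF K] lin_U) (simp add: bal2_move[OF K] mult.assoc[symmetric])
  have 2: "balop sc (\<lambda>x y. K x (y * t a))"
    by (intro balopI bal2_lin1[OF K] bal2_lin2[OF K] lin_U) (simp add: bal2_move[OF K] mult.assoc)
  show ?thesis
    unfolding sw_tr[OF V 1] sw_tr[OF V 2] sw_takeuchi[OF V balU_flip[OF K]] S_mult S_s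
    using sw_takeuchi[OF V balU_flip[OF K], of a "S u"] by (simp add: S_mult S_s)
qed

lemma sw_tr_tgt:
  assumes V: "vector_space sc" and K: "balop sc K"
  shows "lincomb sc (\<lambda>(x, y). K x y) (tr (t a * u)) = lincomb sc (\<lambda>(x, y). K x (y * s a)) (tr u)"
proof -
  have 2: "balop sc (\<lambda>x y. K x (y * s a))"
    by (intro balopI bal2_lin1[OF K] bal2_lin2[OF K] lin_U) (simp add: bal2_move[OF K] mult.assoc)
  show ?thesis
    unfolding sw_tr[OF V K] sw_tr[OF V 2] S_mult S_t sw_mult_src[OF V balU_flip[OF K]] ..
qed


section \<open>The iterated coproduct of a left bialgebroid\<close>

abbreviation "ic sc \<equiv> icop sc dl"

text \<open>A factor s(a) in front of the remaining argument reappears on the first of its legs, and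
  from there the balancedness of \<open>F\<close> moves it as t(a) to the preceding factor.\<close>

lemma icop_balU:
  assumes V: "vector_space sc" and F: "balUn (Suc n) sc F"
  shows "balU sc (\<lambda>x y. ic sc n y (\<lambda>vs. F (x # vs)))"
  using F
proof (induction n arbitrary: F)
  case 0
  show ?case
    using multilin_hd[OF baln_multilin[OF 0] _ lin_id, of "[]"]
      multilin_last[OF baln_multilin[OF 0] _ lin_id, of "[_]"] baln_move_last[OF 0, of "[]"]
    by (intro balUI) simp_all
next
  case (Suc n)
  note ml = baln_multilin[OF Suc.prems]
  have IH: "balU sc (\<lambda>x y. ic sc n y (\<lambda>vs. F (u # x # vs)))" for u
    by (rule Suc.IH[OF baln_Cons[OF Suc.prems]])
  show ?case
  proof (rule balUI)
    fix y
    show "lin (scU H) sc (\<lambda>x. ic sc (Suc n) y (\<lambda>vs. F (x # vs)))"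
      by (intro lin_icop_fun V multilin_hd[OF ml _ lin_id]) simp
  next
    fix x
    show "lin (scU H) sc (\<lambda>y. ic sc (Suc n) y (\<lambda>vs. F (x # vs)))"
      by (simp add: lin_lincomb_arg[OF V lin_dl])
  next
    fix a x y
    have "ic sc (Suc n) (s a * y) (\<lambda>vs. F (x # vs))
        = lincomb sc (\<lambda>(u1, u2). ic sc n u2 (\<lambda>vs. F (x # (s a * u1) # vs))) (dl y)"
      by (simp add: sw_src[OF V IH])
    also have "\<dots> = lincomb sc (\<lambda>(u1, u2). ic sc n u2 (\<lambda>vs. F ((t a * x) # u1 # vs))) (dl y)"
      using baln_move[OF Suc.prems, of "[]"] by (intro lincomb_cong2 refl icop_cong) simp
    finally show "ic sc (Suc n) y (\<lambda>vs. F (t a * x # vs)) = ic sc (Suc n) (s a * y) (\<lambda>vs. F (x # vs))"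
      by simp
  qed
qed

lemma lin_icop:
  assumes V: "vector_space sc" and F: "balUn n sc F"
  shows "lin (scU H) sc (\<lambda>u. ic sc n u F)"
  using multilin_last[OF baln_multilin[OF F] _ lin_id]
  by (cases n) (simp_all add: lin_lincomb_arg[OF V lin_dl])

lemma icop_tgt_left:
  assumes V: "vector_space sc" and F: "balUn n sc F"
  shows "ic sc n (t a * u) F = ic sc n u (\<lambda>vs v. F vs (t a * v))"
  using F
proof (induction n arbitrary: u F)
  case (Suc n)
  show ?case
    by (simp add: sw_tgt[OF V icop_balU[OF V Suc.prems]] Suc.IH[OF baln_Cons[OF Suc.prems]])
qed simp

lemma icop_mult_tgt:
  assumes V: "vector_space sc" and F: "balUn n sc F"
  shows "ic sc n (u * t a) F = ic sc n u (\<lambda>vs v. F vs (v * t a))"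
  using F
proof (induction n arbitrary: u F)
  case (Suc n)
  show ?case
    by (simp add: sw_mult_tgt[OF V icop_balU[OF V Suc.prems]] Suc.IH[OF baln_Cons[OF Suc.prems]])
qed simp

lemma icop_mult_src:
  assumes V: "vector_space sc" and F: "balUn (Suc n) sc F"
  shows "ic sc (Suc n) (u * s a) F = ic sc (Suc n) u (\<lambda>vs. F (vs[0 := vs ! 0 * s a]))"
  by (simp add: sw_mult_src[OF V icop_balU[OF V F]])

text \<open>At the first two legs the Takeuchi condition for \<open>u\<close> turns t(a) into a
  factor s(a) to the right of \<open>u2\<close>, and \<open>icop_mult_src\<close> puts it on the
  first leg of \<open>u2\<close>. Later positions follow by peeling off the first leg.\<close>

lemma icop_takeuchi:
  assumes V: "vector_space sc" and F: "balUn n sc F" and i: "Suc i < n"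
  shows "ic sc n u (\<lambda>vs. F (vs[i := vs ! i * t a])) = ic sc n u (\<lambda>vs. F (vs[Suc i := vs ! Suc i * s a]))"
  using F i
proof (induction n arbitrary: u F i)
  case (Suc n)
  note F' = baln_Cons[OF Suc.prems(1)]
  show ?case
  proof (cases i)
    case 0
    then obtain m where m: "n = Suc m" using Suc.prems(2) by (cases n) auto
    have "ic sc (Suc n) u (\<lambda>vs. F (vs[i := vs ! i * t a]))
        = lincomb sc (\<lambda>(u1, u2). ic sc n (u2 * s a) (\<lambda>vs. F (u1 # vs))) (dl u)"
      using sw_takeuchi[OF V icop_balU[OF V Suc.prems(1)]] 0 by simp
    also have "\<dots> = lincomb sc (\<lambda>(u1, u2). ic sc n u2 (\<lambda>vs. F (u1 # vs[0 := vs ! 0 * s a]))) (dl u)"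
      unfolding m by (intro lincomb_cong2 refl icop_mult_src[OF V F'[unfolded m]])
    finally show ?thesis using 0 by simp
  next
    case (Suc j)
    then show ?thesis using Suc.IH[OF F', of j] Suc.prems(2) by simp
  qed
qed simp

lemma icop_takeuchi_last:
  assumes V: "vector_space sc" and F: "balUn (Suc n) sc F"
  shows "ic sc (Suc n) u (\<lambda>vs. F (vs[n := vs ! n * t a])) = ic sc (Suc n) u (\<lambda>vs v. F vs (v * s a))"
  using F
proof (induction n arbitrary: u F)
  case 0
  then show ?case using sw_takeuchi[OF V icop_balU[OF V 0]] by simp
next
  case (Suc n)
  then show ?case using Suc.IH[OF baln_Cons[OF Suc.prems]] by simp
qed

lemma lincomb_icop_tn:
  assumes V: "vector_space sc" and F: "balUn n sc F"
  shows "lincomb sc (\<lambda>(vs, v). F vs v) (ic free_scale n u (\<lambda>vs v. tn (UnU H n) (vs, v))) = ic sc n u F"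
proof -
  have "lincomb sc (\<lambda>(vs, v). F vs v) (tn (UnU H n) (vs, v)) = F vs v" for vs v
    unfolding UnU_def by (rule lincomb_tnn[OF V F])
  then show ?thesis by (simp add: icop_comp[OF lincomb_lin[OF V]])
qed

lemma iter_coprod_tensor:
  "iter_coprod H n u \<in> carrier (UnU H n)
   \<and> nf (UnU H n) (iter_coprod H n u) = ic free_scale n u (\<lambda>vs v. tn (UnU H n) (vs, v))"
proof (induction n arbitrary: u)
  case 0
  have T: "fquot {(xs, m). length xs = 0} (UnU H 0)" unfolding UnU_def by (rule fquot_tensor_pow)
  show ?case using tens_carrier[OF T] by simp
next
  case (Suc n)
  note Vf = vector_space_free
  let ?T = "UnU H (Suc n)"
  have T: "fquot {(xs, m). length xs = Suc n} ?T" unfolding UnU_def by (rule fquot_tensor_pow)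
  have b: "balUn (Suc n) free_scale (\<lambda>vs v. tn ?T (vs, v))" unfolding UnU_def by (rule baln_tn)
  have mem: "iter_coprod H n u \<in> carrier (UnU H n)" for u using Suc.IH by blast
  have t: "\<forall>vs v. length vs = n \<longrightarrow> tens ?T (u1 # vs, v) \<in> carrier ?T" for u1
    by (intro allI impI tens_carrier[OF T]) simp
  note n = nf_liftn[OF mem[unfolded UnU_def] T t baln_Cons[OF b], folded UnU_def]
  have ev: "lincomb free_scale (\<lambda>(vs, v). tn ?T (u1 # vs, v)) (nf (UnU H n) (iter_coprod H n u2))
      = ic free_scale n u2 (\<lambda>vs v. tn ?T (u1 # vs, v))" for u1 u2
    using Suc.IH[of u2] lincomb_icop_tn[OF Vf baln_Cons[OF b]] by simp
  have o: "balU free_scale (\<lambda>u1 u2. nf ?T (lift ?T (iter_coprod H n u2) (\<lambda>(vs, v). tens ?T (u1 # vs, v))))"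
    unfolding n ev by (rule icop_balU[OF Vf b])
  note N = nf_lift2[OF coprod_carrier' T n(1) o, folded UU_def]
  show ?case using N unfolding n ev by (simp add: Let_def)
qed

lemma iter_coprod_carrier: "iter_coprod H n u \<in> carrier (UnU H n)"
  using iter_coprod_tensor by blast

lemma lincomb_iter_coprod:
  "vector_space sc \<Longrightarrow> balUn n sc F \<Longrightarrow>
    lincomb sc (\<lambda>(vs, v). F vs v) (nf (UnU H n) (iter_coprod H n u)) = ic sc n u F"
  using iter_coprod_tensor lincomb_icop_tn by simp

end

section \<open>The structure maps of the cocyclic module\<close>

lemma map2_split_right:
  "length vs = Suc (length as + length bs) \<Longrightarrow>
    map2 f vs (as @ x # bs) = map2 f (take (length as) vs) as @ f (vs ! length as) x # map2 f (drop (Suc (length as)) vs) bs"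
proof -
  assume l: "length vs = Suc (length as + length bs)"
  have vs: "vs = take (length as) vs @ vs ! length as # drop (Suc (length as)) vs"
    using l by (intro id_take_nth_drop) simp
  show ?thesis by (subst vs, subst zip_append) (use l in simp_all)
qed

lemma multilin_ConsI:
  fixes f :: "'x::ab_group_add list \<Rightarrow> 'm::ab_group_add \<Rightarrow> 'w::ab_group_add"
  assumes "\<And>x. multilin n scX scM sc (\<lambda>xs. f (x # xs))"
    and "\<And>xs m. length xs = n \<Longrightarrow> lin scX sc (\<lambda>x. f (x # xs) m)"
  shows "multilin (Suc n) scX scM sc f"
  unfolding multilin_def
proof (intro conjI allI impI)
  fix as bs :: "'x list" and m assume n: "Suc (length as + length bs) = Suc n"
  show "lin scX sc (\<lambda>x. f (as @ x # bs) m)"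
  proof (cases as)
    case (Cons a as')
    then show ?thesis using multilin_slot[OF assms(1)[of a] _ lin_id, of as' bs m] n by simp
  qed (use assms(2)[of bs m] n in simp)
next
  fix xs :: "'x list" assume "length xs = Suc n"
  then obtain y ys where "xs = y # ys" "length ys = n" by (metis length_Suc_conv)
  then show "lin scM sc (f xs)" using multilin_last[OF assms(1)[of y] _ lin_id, of ys] by simp
qed

text \<open>The introduction rule matching \<open>baln_Cons\<close>: besides the tail, only the
  junction between the head and its right neighbour has to be checked, the neighbour being the
  module when the tail is empty.\<close>

lemma baln_ConsI:
  fixes f :: "'x::ab_group_add list \<Rightarrow> 'm::ab_group_add \<Rightarrow> 'w::ab_group_add"
  assumes "\<And>x. baln n scX ra la scM lm sc (\<lambda>xs. f (x # xs))"
    and "\<And>xs m. length xs = n \<Longrightarrow> lin scX sc (\<lambda>x. f (x # xs) m)"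
    and "\<And>a x x' xs m. Suc (length xs) = n \<Longrightarrow> f (ra a x # x' # xs) m = f (x # la a x' # xs) m"
    and "\<And>a x m. n = 0 \<Longrightarrow> f [ra a x] m = f [x] (lm a m)"
  shows "baln (Suc n) scX ra la scM lm sc f"
  unfolding baln_def
proof (intro conjI allI impI)
  show "multilin (Suc n) scX scM sc f"
    by (intro multilin_ConsI baln_multilin[OF assms(1)] assms(2))
next
  fix as bs :: "'x list" and x x' a m assume n: "length as + length bs + 2 = Suc n"
  show "f (as @ ra a x # x' # bs) m = f (as @ x # la a x' # bs) m"
  proof (cases as)
    case (Cons y as')
    then show ?thesis using baln_move[OF assms(1)[of y], of as' bs a x x' m] n by simp
  qed (use assms(3) n in simp)
next
  fix as :: "'x list" and x a m assume n: "Suc (length as) = Suc n"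
  show "f (as @ [ra a x]) m = f (as @ [x]) (lm a m)"
  proof (cases as)
    case (Cons y as')
    then show ?thesis using baln_move_last[OF assms(1)[of y], of as' a x m] n by simp
  qed (use assms(4) n in simp)
qed

lemma baln_0: "baln 0 scX ra la scM lm sc f \<longleftrightarrow> lin scM sc (f [])"
  by (simp add: baln_def multilin_def)

lemma baln_cong:
  fixes f :: "'x::ab_group_add list \<Rightarrow> 'm::ab_group_add \<Rightarrow> 'w::ab_group_add"
  assumes "\<And>xs m. length xs = n \<Longrightarrow> f xs m = f' xs m" and "baln n scX ra la scM lm sc f'"
  shows "baln n scX ra la scM lm sc f"
  unfolding baln_def multilin_def
proof (intro conjI allI impI)
  fix as bs :: "'x list" and m assume "Suc (length as + length bs) = n"
  then show "lin scX sc (\<lambda>x. f (as @ x # bs) m)"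
    using multilin_slot[OF baln_multilin[OF assms(2)] _ lin_id, of as bs m] assms(1) by simp
next
  fix xs :: "'x list" assume "length xs = n"
  then show "lin scM sc (f xs)"
    using multilin_last[OF baln_multilin[OF assms(2)] _ lin_id, of xs] assms(1)[of xs]
    by (simp add: lin_iff)
qed (use assms(1) baln_move[OF assms(2)] baln_move_last[OF assms(2)] in simp_all)

lemma baln_lincomb2:
  fixes F :: "'i \<Rightarrow> 'j \<Rightarrow> 'x::ab_group_add list \<Rightarrow> 'm::ab_group_add \<Rightarrow> 'w::ab_group_add"
  assumes V: "vector_space sc" and F: "\<And>a b. baln n scX ra la scM lm sc (F a b)"
  shows "baln n scX ra la scM lm sc (\<lambda>xs m. lincomb sc (\<lambda>(a, b). F a b xs m) z)"
  unfolding baln_def multilin_def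
proof (intro conjI allI impI)
  fix as bs :: "'x list" and m assume "Suc (length as + length bs) = n"
  then show "lin scX sc (\<lambda>x. lincomb sc (\<lambda>(a, b). F a b (as @ x # bs) m) z)"
    by (intro lin_lincomb2 V multilin_slot[OF baln_multilin[OF F] _ lin_id])
next
  fix xs :: "'x list" assume "length xs = n"
  then show "lin scM sc (\<lambda>m. lincomb sc (\<lambda>(a, b). F a b xs m) z)"
    by (intro lin_lincomb2 V multilin_last[OF baln_multilin[OF F] _ lin_id])
qed (use baln_move[OF F] baln_move_last[OF F] in simp_all)

text \<open>The common pattern of the structure maps: balancedness is checked for a closed form
  \<open>e\<close>, and \<open>E\<close> merely has to agree with it on lists of the right
  length.\<close>

lemma lift_generators:
  assumes X: "X \<in> carrier (tensor_pow n scX ra la scM lm)" and T: "fquot Y T"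
    and E: "\<And>us p. length us = n \<Longrightarrow> E us p \<in> carrier T \<and> nf T (E us p) = e us p"
    and e: "baln n scX ra la scM lm free_scale e"
  shows "lift T X (\<lambda>(us, p). E us p) \<in> carrier T
    \<and> nf T (lift T X (\<lambda>(us, p). E us p)) = lincomb free_scale (\<lambda>(us, p). e us p) (nf (tensor_pow n scX ra la scM lm) X)"
proof -
  have b: "baln n scX ra la scM lm free_scale (\<lambda>us p. nf T (E us p))"
    by (rule baln_cong[OF _ e]) (use E in blast)
  have c: "\<forall>us p. length us = n \<longrightarrow> E us p \<in> carrier T" using E by blast
  note N = nf_liftn[OF X T c b]
  have "lincomb free_scale (\<lambda>(us, p). nf T (E us p)) (nf (tensor_pow n scX ra la scM lm) X)
      = lincomb free_scale (\<lambda>(us, p). e us p) (nf (tensor_pow n scX ra la scM lm) X)"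
    by (intro lincomb_cong2 refl) (use E length_nf_keys[OF X] in blast)
  then show ?thesis using N by simp
qed

lemma k_linear_of_nf:
  assumes S: "fquot X S" and T: "fquot Y T"
    and f: "\<And>A. A \<in> carrier S \<Longrightarrow> f A \<in> carrier T \<and> nf T (f A) = h (nf S A)"
    and h: "lin free_scale free_scale h"
  shows "k_linear S T f"
proof -
  interpret S: vsp S by (rule vsp_fquot[OF S])
  interpret T: vsp T by (rule vsp_fquot[OF T])
  show ?thesis unfolding k_linear_def
  proof (intro conjI ballI allI)
    fix A B assume A: "A \<in> carrier S" and B: "B \<in> carrier S"
    show "f (A \<oplus>\<^bsub>S\<^esub> B) = f A \<oplus>\<^bsub>T\<^esub> f B"
      by (rule nf_inj[OF T]) (simp_all add: A B f nf_add[OF S] nf_add[OF T] lin_add[OF h])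
  next
    fix c A assume A: "A \<in> carrier S"
    show "f (c \<odot>\<^bsub>S\<^esub> A) = c \<odot>\<^bsub>T\<^esub> f A"
      by (rule nf_inj[OF T])
        (simp_all add: A f S.smult_closed T.smult_closed nf_smult[OF S] nf_smult[OF T] lin_scale[OF h])
  qed (use f in blast)
qed

locale sayd = hopf_alg H
  for H :: "('k::field, 'u::{ring,monoid_mult}, 'a::{ring,monoid_mult}) hopf" +
  fixes P :: "('k, 'u, 'a, 'p::ab_group_add) saydm"
  assumes sayd: "sayd_module H P"
begin

abbreviation "ca p \<equiv> nf (UP H P) (coact P p)"
abbreviation "balP sc F \<equiv> bal2 (scU H) (scP P) (\<lambda>a u. t a * u) (lact P) sc F"
abbreviation "balC n sc F \<equiv> baln n (scU H) (\<lambda>a u. t a * u) (\<lambda>a u. s a * u) (scP P) (lact P) sc F"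
abbreviation "tC n us p \<equiv> tn (Cn H P n) (us, p)"

lemma P_vs: "vector_space (scP P)"
  and lin_act: "lin (scP P) (scP P) (\<lambda>p. act P p u)" and lin_act_right: "lin (scU H) (scP P) (act P p)"
  and act_act: "act P (act P p u) v = act P p (u * v)"
  and lin_lact: "lin (scP P) (scP P) (lact P a)" and lin_lact_left: "lin (scA H) (scP P) (\<lambda>a. lact P a p)"
  and lact_lact: "lact P a (lact P b p) = lact P (a * b) p"
  and k_linear_coact: "k_linear (type_space (scP P)) (UP H P) (coact P)"
  and coact_lact: "coact P (lact P a p) = lift (UP H P) (coact P p) (\<lambda>(q, p0). tens (UP H P) (s a * q, p0))"
  and coact_counit: "lift (type_space (scP P)) (coact P p) (\<lambda>(q, p0). lact P (\<epsilon> q) p0) = p"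
  and act_src_tgt: "act P p (s a * t b) = lact P b (lift (type_space (scP P)) (coact P p) (\<lambda>(q, p0). lact P (\<epsilon> (q * s a)) p0))"
  using sayd unfolding sayd_module_def Let_def
  by - (elim conjE, (assumption | (erule allE)+, assumption))+

text \<open>The third SAYD condition at a = 1, where the remaining sum is the counit law. The
  relations next to \<open>p\<close> thereby become statements about the right action.\<close>

lemma lact_eq_act: "lact P a p = act P p (t a)"
  using act_src_tgt[of p 1 a] by (simp add: s_one coact_counit)

lemmas lin_P = lin_id lin_compose[OF _ lin_act] lin_compose[OF _ lin_act_right] lin_compose[OF _ lin_lact]

lemma UP_fquot: "fquot UNIV (UP H P)" unfolding UP_def by (rule fquot_tensor2)

lemma Cn_fquot: "fquot {(xs, m). length xs = n} (Cn H P n)" unfolding Cn_def by (rule fquot_tensor_pow)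

lemma coact_carrier: "coact P p \<in> carrier (UP H P)"
  using k_linear_coact k_linear_carrier[OF fquot_tensor2] unfolding UP_def by blast

lemmas coact_carrier' = coact_carrier[unfolded UP_def]

lemma lin_ca: "lin (scP P) free_scale ca"
  using k_linear_coact k_linear_nf[OF fquot_tensor2] unfolding UP_def by blast

lemma tn_UP: "balP free_scale (\<lambda>x y. tn (UP H P) (x, y))"
  unfolding UP_def by (rule bal2_tn)

lemma tn_Cn: "balC n free_scale (tC n)"
  unfolding Cn_def by (rule baln_tn)

lemma tens_Cn: "length us = n \<Longrightarrow> tens (Cn H P n) (us, p) \<in> carrier (Cn H P n)"
  by (rule tens_carrier[OF Cn_fquot]) simp

lemma lincomb_tC: "vector_space sc \<Longrightarrow> balC n sc F \<Longrightarrow> lincomb sc (\<lambda>(us, p). F us p) (tC n us p) = F us p"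
  unfolding Cn_def by (rule lincomb_tnn)

lemma balPI:
  "(\<And>y. lin (scU H) sc (\<lambda>x. F x y)) \<Longrightarrow> (\<And>x. lin (scP P) sc (\<lambda>y. F x y)) \<Longrightarrow>
    (\<And>a x y. F (t a * x) y = F x (lact P a y)) \<Longrightarrow> balP sc F"
  by (simp add: bal2_def)

lemma sw_lact:
  assumes V: "vector_space sc" and F: "balP sc F"
  shows "lincomb sc (\<lambda>(q, p0). F q p0) (ca (lact P a p)) = lincomb sc (\<lambda>(q, p0). F (s a * q) p0) (ca p)"
proof -
  have b: "balP free_scale (\<lambda>x y. tn (UP H P) (s a * x, y))"
    by (intro balPI bal2_lin1[OF tn_UP] bal2_lin2[OF tn_UP] lin_U) (simp only: st_left_commute bal2_move[OF tn_UP])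
  have c: "tens (UP H P) g \<in> carrier (UP H P)" for g by (simp add: tens_carrier[OF UP_fquot])
  have e: "lincomb sc (\<lambda>(q, p0). F q p0) (tn (UP H P) (x, y)) = F x y" for x y
    unfolding UP_def by (rule lincomb_tn2[OF V F])
  show ?thesis
    unfolding coact_lact nf_lift2[OF coact_carrier' UP_fquot c b, folded UP_def] lincomb_lincomb2[OF V] e ..
qed

text \<open>
  For a balanced \<open>G\<close>, \<open>cof sc n i G us p\<close> is the value of the induced linear map on
  \<open>\<delta>\<^sub>i(u\<^sup>1 \<otimes> \<dots> \<otimes> u\<^sup>n \<otimes> p)\<close>. In the same way \<open>cdg\<close> stands for \<open>\<sigma>\<^sub>i\<close> and \<open>cyg\<close> for \<open>\<tau>\<close>.
\<close>

subsection \<open>Cofaces\<close>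

definition cof :: "('k \<Rightarrow> 'w \<Rightarrow> 'w) \<Rightarrow> nat \<Rightarrow> nat \<Rightarrow> ('u list \<Rightarrow> 'p \<Rightarrow> 'w::ab_group_add) \<Rightarrow> 'u list \<Rightarrow> 'p \<Rightarrow> 'w" where
  "cof sc n i G us p = (if i = 0 then G (1 # us) p
     else if i \<le> n then lincomb sc (\<lambda>(v, w). G (take (i - 1) us @ [v, w] @ drop i us) p) (dl (us ! (i - 1)))
     else lincomb sc (\<lambda>(q, p0). G (us @ [q]) p0) (ca p))"

text \<open>From position 2 on a coface leaves the first factor alone, so it is a coface one degree
  lower behind that factor. The inductions on the position use this.\<close>

lemma cof_Cons: "cof sc (Suc n) (Suc (Suc j)) G (u # us) p = cof sc n (Suc j) (\<lambda>vs. G (u # vs)) us p"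
  by (simp add: cof_def)

lemma cof_1: "cof sc (Suc n) (Suc 0) G (u # us) p = lincomb sc (\<lambda>(v, w). G (v # w # us) p) (dl u)"
  and cof_1_0: "cof sc 0 (Suc 0) G [] p = lincomb sc (\<lambda>(q, p0). G [q] p0) (ca p)"
  by (simp_all add: cof_def)

lemma lin_cof:
  assumes V: "vector_space sc" and G: "\<And>vs p. length vs = Suc n \<Longrightarrow> lin s0 sc (\<lambda>x. G x vs p)"
    and us: "length us = n"
  shows "lin s0 sc (\<lambda>x. cof sc n i (G x) us p)"
  by (cases "i = 0"; cases "i \<le> n") (auto simp: cof_def us intro!: lin_lincomb2[OF V] G)

lemma cof_cong: "(\<And>vs p. length vs = Suc n \<Longrightarrow> G vs p = G' vs p) \<Longrightarrow> length us = n \<Longrightarrow> cof sc n i G us p = cof sc n i G' us p"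
  unfolding cof_def by (auto intro!: lincomb_cong2)

lemma balU_coproduct_slot:
  assumes "balC (Suc (Suc n)) sc G" "length xs = n"
  shows "balU sc (\<lambda>v w. G (v # w # xs) p)"
proof (intro balUI)
  note ml = baln_multilin[OF assms(1)]
  show "lin (scU H) sc (\<lambda>v. G (v # w # xs) p)" for w
    using multilin_hd[OF ml _ lin_id] assms(2) by simp
  show "lin (scU H) sc (\<lambda>w. G (v # w # xs) p)" for v
    using multilin_slot[OF ml _ lin_id, of "[v]"] assms(2) by simp
  show "G (t a * v # w # xs) p = G (v # s a * w # xs) p" for a v w
    using baln_move[OF assms(1), of "[]"] assms(2) by simp
qed

lemma balP_last:
  assumes "balC (Suc n) sc G" "length us = n"
  shows "balP sc (\<lambda>q. G (us @ [q]))"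
  using baln_move_last[OF assms(1)] assms(2)
  by (intro balPI multilin_snoc_slot[OF baln_multilin[OF assms(1)] _ lin_id]
      multilin_last[OF baln_multilin[OF assms(1)] _ lin_id]) simp_all

text \<open>Only relations touching the expanded place need an argument. There \<Delta> carries t(a)
  to the second new leg, next to the right neighbour, and s(a) to the first, next to the left one;
  the coaction is left linear in the same sense.\<close>

lemma balC_cof_Suc:
  assumes V: "vector_space sc" and "balC (Suc n) sc G" "j \<le> n"
  shows "balC n sc (cof sc n (Suc j) G)"
  using assms(2-)
proof (induction j arbitrary: n G)
  case 0
  show ?case
  proof (cases n)
    case 0
    have "cof sc 0 (Suc 0) G [] = (\<lambda>p. lincomb sc (\<lambda>(q, p0). G [q] p0) (ca p))"
      by (rule ext) (rule cof_1_0)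
    then show ?thesis using 0 by (simp add: baln_0 lin_lincomb_arg[OF V lin_ca])
  next
    case (Suc m)
    note G = "0.prems"(1)[unfolded Suc]
    show ?thesis unfolding Suc
    proof (rule baln_ConsI, unfold cof_1)
      fix x show "balC m sc (\<lambda>xs p. lincomb sc (\<lambda>(v, w). G (v # w # xs) p) (dl x))"
        by (intro baln_lincomb2 V baln_Cons[where f = "\<lambda>xs. G (_ # xs)"] baln_Cons[where f = G] G)
    next
      fix xs :: "'u list" and p show "lin (scU H) sc (\<lambda>x. lincomb sc (\<lambda>(v, w). G (v # w # xs) p) (dl x))"
        by (rule lin_lincomb_arg[OF V lin_dl])
    next
      fix a x x' and xs :: "'u list" and p assume l: "Suc (length xs) = m"
      show "lincomb sc (\<lambda>(v, w). G (v # w # x' # xs) p) (dl (t a * x))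
          = lincomb sc (\<lambda>(v, w). G (v # w # s a * x' # xs) p) (dl x)"
        using baln_move[OF G, of "[_]" xs] l
        by (simp add: sw_tgt[OF V balU_coproduct_slot[OF G]])
    next
      fix a x p assume l: "m = 0"
      show "lincomb sc (\<lambda>(v, w). G [v, w] p) (dl (t a * x)) = lincomb sc (\<lambda>(v, w). G [v, w] (lact P a p)) (dl x)"
        using baln_move_last[OF G, of "[_]"] l
        by (simp add: sw_tgt[OF V balU_coproduct_slot[OF G]])
    qed
  qed
next
  case (Suc j)
  then obtain m where m: "n = Suc m" by (cases n) auto
  note G = Suc.prems(1)[unfolded m] and ml = baln_multilin[OF Suc.prems(1)[unfolded m]]
  have jm: "j \<le> m" using Suc.prems m by simp
  show ?case unfolding m
  proof (rule baln_ConsI, unfold cof_Cons)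
    fix x show "balC m sc (cof sc m (Suc j) (\<lambda>vs. G (x # vs)))"
      by (rule Suc.IH[OF baln_Cons[OF G] jm])
  next
    fix xs :: "'u list" and p assume "length xs = m"
    then show "lin (scU H) sc (\<lambda>x. cof sc m (Suc j) (\<lambda>vs. G (x # vs)) xs p)"
      by (intro lin_cof V multilin_hd[OF ml _ lin_id]) simp_all
  next
    fix a x x' and xs :: "'u list" and p assume l: "Suc (length xs) = m"
    show "cof sc m (Suc j) (\<lambda>vs. G (t a * x # vs)) (x' # xs) p = cof sc m (Suc j) (\<lambda>vs. G (x # vs)) (s a * x' # xs) p"
    proof (cases j)
      case 0
      then show ?thesis using l baln_move[OF G, of "[]"]
        by (auto simp: cof_1 sw_src[OF V balU_coproduct_slot[OF baln_Cons[OF G[folded l]]]])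
    next
      case (Suc j')
      then show ?thesis using l baln_move[OF G, of "[]"] by (auto simp: cof_Cons intro!: cof_cong)
    qed
  next
    fix a x p assume "m = 0"
    then show "cof sc m (Suc j) (\<lambda>vs. G (t a * x # vs)) [] p = cof sc m (Suc j) (\<lambda>vs. G (x # vs)) [] (lact P a p)"
      using jm baln_move[OF G, of "[]" "[]"] balP_last[OF G, of "[x]"]
      by (simp add: cof_1_0 sw_lact[OF V])
  qed
qed

lemma balC_cof:
  assumes V: "vector_space sc" and G: "balC (Suc n) sc G" and i: "i \<le> Suc n"
  shows "balC n sc (cof sc n i G)"
proof (cases i)
  case 0
  then show ?thesis using baln_Cons[OF G, of 1] by (simp add: cof_def[abs_def])
next
  case (Suc j)
  then show ?thesis using balC_cof_Suc[OF V G] i by simp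
qed

lemma lincomb_cof:
  assumes V: "vector_space sc" and G: "balC (Suc n) sc G"
  shows "lincomb sc (\<lambda>(us, p). G us p) (cof free_scale n i (tC (Suc n)) us p) = cof sc n i G us p"
  unfolding cof_def by (simp add: lincomb_tC[OF V G] lincomb_lincomb2[OF V])

lemma hopf_coface_nf:
  assumes X: "X \<in> carrier (Cn H P n)" and i: "i \<le> Suc n"
  shows "hopf_coface H P n i X \<in> carrier (Cn H P (Suc n))
    \<and> nf (Cn H P (Suc n)) (hopf_coface H P n i X)
      = lincomb free_scale (\<lambda>(us, p). cof free_scale n i (tC (Suc n)) us p) (nf (Cn H P n) X)"
  unfolding hopf_coface_def Let_def Cn_def[of H P n]
proof (rule lift_generators[OF X[unfolded Cn_def] Cn_fquot])
  show "balC n free_scale (cof free_scale n i (tC (Suc n)))"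
    by (rule balC_cof[OF vector_space_free tn_Cn i])
  fix us :: "'u list" and p assume us: "length us = n"
  let ?T = "Cn H P (Suc n)"
  show "(if i = 0 then tens ?T (1 # us, p)
        else if i \<le> n then lift ?T (coprod H (us ! (i - 1))) (\<lambda>(v, w). tens ?T (take (i - 1) us @ [v, w] @ drop i us, p))
        else lift ?T (coact P p) (\<lambda>(q, p0). tens ?T (us @ [q], p0))) \<in> carrier ?T
     \<and> nf ?T (if i = 0 then tens ?T (1 # us, p)
        else if i \<le> n then lift ?T (coprod H (us ! (i - 1))) (\<lambda>(v, w). tens ?T (take (i - 1) us @ [v, w] @ drop i us, p))
        else lift ?T (coact P p) (\<lambda>(q, p0). tens ?T (us @ [q], p0))) = cof free_scale n i (tC (Suc n)) us p"
  proof (cases "i = 0")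
    case True
    then show ?thesis using us by (simp add: tens_Cn cof_def)
  next
    case i0: False
    show ?thesis
    proof (cases "i \<le> n")
      case True
      have c: "tens ?T (take (i - 1) us @ [v, w] @ drop i us, p) \<in> carrier ?T" for v w
        by (rule tens_Cn) (use True i0 us in simp)
      have b: "balU free_scale (\<lambda>v w. tn ?T (take (i - 1) us @ [v, w] @ drop i us, p))"
        using baln_move[OF tn_Cn[of "Suc n"], of "take (i - 1) us" "drop i us"] True i0 us
          multilin_slot[OF baln_multilin[OF tn_Cn[of "Suc n"]] _ lin_id, of "take (i - 1) us" "_ # drop i us"]
          multilin_slot[OF baln_multilin[OF tn_Cn[of "Suc n"]] _ lin_id, of "take (i - 1) us @ [_]" "drop i us"]
        by (intro balUI) simp_all
      note N = nf_lift2[OF coprod_carrier' Cn_fquot c b, folded UU_def]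
      show ?thesis using N[of "us ! (i - 1)"] True i0 by (simp add: cof_def)
    next
      case False
      have c: "tens ?T (us @ [q], p0) \<in> carrier ?T" for q p0 by (rule tens_Cn) (use us in simp)
      note N = nf_lift2[OF coact_carrier' Cn_fquot c balP_last[OF tn_Cn us], folded UP_def]
      show ?thesis using N False i0 by (simp add: cof_def)
    qed
  qed
qed


subsection \<open>Codegeneracies\<close>

definition cdg :: "nat \<Rightarrow> nat \<Rightarrow> ('u list \<Rightarrow> 'p \<Rightarrow> 'w) \<Rightarrow> 'u list \<Rightarrow> 'p \<Rightarrow> 'w" where
  "cdg n i G us p = (if i < n then G (take i us @ [s (\<epsilon> (us ! i)) * us ! Suc i] @ drop (Suc (Suc i)) us) p
     else G (take n us) (lact P (\<epsilon> (us ! n)) p))"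

lemma cdg_Cons: "cdg (Suc n) (Suc i) G (u # us) p = cdg n i (\<lambda>vs. G (u # vs)) us p"
  and cdg_0: "cdg (Suc n) 0 G (u # w # us) p = G (s (\<epsilon> u) * w # us) p"
  and cdg_0_0: "cdg 0 0 G [u] p = G [] (lact P (\<epsilon> u) p)"
  by (simp_all add: cdg_def)

lemma lin_cdg:
  assumes "\<And>vs p. length vs = n \<Longrightarrow> lin s0 sc (\<lambda>x. G x vs p)" and "length us = Suc n" and "i \<le> n"
  shows "lin s0 sc (\<lambda>x. cdg n i (G x) us p)"
  using assms(2,3) by (cases "i < n") (auto simp: cdg_def intro!: assms(1))

lemma cdg_cong: "(\<And>vs p. length vs = n \<Longrightarrow> G vs p = G' vs p) \<Longrightarrow> length us = Suc n \<Longrightarrow> i \<le> n \<Longrightarrow>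
    cdg n i G us p = cdg n i G' us p"
  by (auto simp: cdg_def)

lemma counit_s: "\<epsilon> (s a * u) = a * \<epsilon> u" and counit_t: "\<epsilon> (t a * u) = \<epsilon> u * a"
  using counit_bimod[of a 1 u] counit_bimod[of 1 a u] by (simp_all add: s_one t_one)

lemma lin_s_counit: "lin s0 (scU H) g \<Longrightarrow> lin s0 (scU H) (\<lambda>x. s (\<epsilon> (g x)))"
  by (intro lin_compose[OF _ lin_s] lin_compose[OF _ lin_counit])

text \<open>Around the contracted factor, \<epsilon>(t(a)u) = \<epsilon>(u)a settles the relation
  inside the new product, \<epsilon>(s(a)u) = a\<epsilon>(u) the one on its left, and s(a)t(b) =
  t(b)s(a) the one on its right.\<close>

lemma balC_cdg:
  assumes "balC n sc G" "i \<le> n"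
  shows "balC (Suc n) sc (cdg n i G)"
  using assms
proof (induction i arbitrary: n G)
  case 0
  note ml = baln_multilin[OF "0.prems"(1)]
  show ?case
  proof (cases n)
    case 0
    have l: "lin s0 sc (\<lambda>x. G [] (h x))" if "lin s0 (scP P) h" for s0 :: "'k \<Rightarrow> 'z::ab_group_add \<Rightarrow> 'z" and h
      by (rule multilin_last[OF ml _ that]) (simp add: 0)
    have "cdg 0 0 G [x] = (\<lambda>p. G [] (lact P (\<epsilon> x) p))" for x by (rule ext) (rule cdg_0_0)
    then show ?thesis unfolding 0
      by (intro baln_ConsI)
        (auto simp: baln_0 counit_t lact_lact intro!: l lin_P lin_compose[OF lin_counit lin_lact_left])
  next
    case (Suc m)
    note G = "0.prems"(1)[unfolded Suc] and ml = baln_multilin[OF "0.prems"(1)[unfolded Suc]]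
    show ?thesis unfolding Suc
    proof (intro baln_ConsI, unfold cdg_0)
      fix x y show "balC m sc (\<lambda>xs. G (s (\<epsilon> x) * y # xs))" by (rule baln_Cons[OF G])
    next
      fix x and xs :: "'u list" and p assume "length xs = m"
      then show "lin (scU H) sc (\<lambda>y. G (s (\<epsilon> x) * y # xs) p)"
        by (intro multilin_hd[OF ml] lin_U) simp_all
    next
      fix x a y y' and xs :: "'u list" and p assume l: "Suc (length xs) = m"
      show "G (s (\<epsilon> x) * (t a * y) # y' # xs) p = G (s (\<epsilon> x) * y # s a * y' # xs) p"
        using baln_move[OF G, of "[]" xs a "s (\<epsilon> x) * y" y' p] l by (simp add: st_left_commute)
    next
      fix x a y p assume l: "m = 0"
      show "G [s (\<epsilon> x) * (t a * y)] p = G [s (\<epsilon> x) * y] (lact P a p)"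
        using baln_move_last[OF G, of "[]" a "s (\<epsilon> x) * y" p] l by (simp add: st_left_commute)
    next
      fix xs :: "'u list" and p assume "length xs = Suc m"
      then obtain y ys where xs: "xs = y # ys" "length ys = m" by (metis length_Suc_conv)
      show "lin (scU H) sc (\<lambda>x. cdg (Suc m) 0 G (x # xs) p)"
        unfolding xs(1) cdg_0 using xs(2)
        by (intro multilin_hd[OF ml] lin_mult_right lin_s_counit lin_id) simp_all
    next
      fix a x x' and xs :: "'u list" and p
      show "G (s (\<epsilon> (t a * x)) * x' # xs) p = G (s (\<epsilon> x) * (s a * x') # xs) p"
        by (simp add: counit_t s_mult mult.assoc)
    qed simp
  qed
next
  case (Suc i)
  then obtain m where m: "n = Suc m" by (cases n) auto
  note G = Suc.prems(1)[unfolded m] and ml = baln_multilin[OF Suc.prems(1)[unfolded m]]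
  have im: "i \<le> m" using Suc.prems m by simp
  show ?case unfolding m
  proof (rule baln_ConsI, unfold cdg_Cons)
    fix x show "balC (Suc m) sc (cdg m i (\<lambda>vs. G (x # vs)))"
      by (rule Suc.IH[OF baln_Cons[OF G] im])
  next
    fix xs :: "'u list" and p assume "length xs = Suc m"
    then show "lin (scU H) sc (\<lambda>x. cdg m i (\<lambda>vs. G (x # vs)) xs p)"
      by (intro lin_cdg multilin_hd[OF ml _ lin_id] im) simp_all
  next
    fix a x x' and xs :: "'u list" and p assume l: "Suc (length xs) = Suc m"
    show "cdg m i (\<lambda>vs. G (t a * x # vs)) (x' # xs) p = cdg m i (\<lambda>vs. G (x # vs)) (s a * x' # xs) p"
    proof (cases i)
      case 0
      show ?thesis
      proof (cases m)
        case m0: 0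
        then show ?thesis using l 0 baln_move_last[OF G, of "[]"]
          by (simp add: cdg_0_0 counit_s lact_lact)
      next
        case (Suc m')
        then obtain w ws where "xs = w # ws" using l by (cases xs) auto
        then show ?thesis using l Suc 0 baln_move[OF G, of "[]" ws]
          by (simp add: cdg_0 counit_s s_mult mult.assoc)
      qed
    next
      case (Suc i')
      then obtain m' where "m = Suc m'" using im by (cases m) auto
      then show ?thesis using l Suc im baln_move[OF G, of "[]"] by (auto simp: cdg_Cons intro!: cdg_cong)
    qed
  qed simp
qed

lemma lincomb_cdg:
  assumes V: "vector_space sc" and G: "balC n sc G"
  shows "lincomb sc (\<lambda>(us, p). G us p) (cdg n i (tC n) us p) = cdg n i G us p"
  unfolding cdg_def by (simp add: lincomb_tC[OF V G])

lemma hopf_codegen_nf: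
  assumes X: "X \<in> carrier (Cn H P (Suc n))" and i: "i \<le> n"
  shows "hopf_codegen H P n i X \<in> carrier (Cn H P n)
    \<and> nf (Cn H P n) (hopf_codegen H P n i X)
      = lincomb free_scale (\<lambda>(us, p). cdg n i (tC n) us p) (nf (Cn H P (Suc n)) X)"
  unfolding hopf_codegen_def Let_def Cn_def[of H P "Suc n"]
proof (rule lift_generators[OF X[unfolded Cn_def] Cn_fquot])
  show "balC (Suc n) free_scale (cdg n i (tC n))" by (rule balC_cdg[OF tn_Cn i])
  fix us :: "'u list" and p assume us: "length us = Suc n"
  show "(if i < n then tens (Cn H P n) (take i us @ [s (\<epsilon> (us ! i)) * us ! Suc i] @ drop (Suc (Suc i)) us, p)
        else tens (Cn H P n) (take n us, lact P (\<epsilon> (us ! n)) p)) \<in> carrier (Cn H P n) \<and>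
      nf (Cn H P n) (if i < n then tens (Cn H P n) (take i us @ [s (\<epsilon> (us ! i)) * us ! Suc i] @ drop (Suc (Suc i)) us, p)
        else tens (Cn H P n) (take n us, lact P (\<epsilon> (us ! n)) p)) = cdg n i (tC n) us p"
    using us by (auto simp: cdg_def intro!: tens_Cn)
qed

subsection \<open>The cyclic operator\<close>

text \<open>By associativity a left factor s(a) or t(a) of a leg is a left factor of its product
  with the entry of \<open>us\<close>. So the relations between legs are relations between the
  arguments of \<open>G\<close>.\<close>

lemma balUn_map2_mult:
  assumes "balC (Suc (length us)) sc G"
  shows "balUn (length us) sc (\<lambda>vs v. G (map2 (*) vs us @ [v * q]) p)"
  using assms
proof (induction us arbitrary: G)
  case Nil
  then show ?case
    using multilin_hd[OF baln_multilin[OF Nil] _ lin_mult_right[OF lin_id], of "[]" q]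
    by (simp add: baln_0)
next
  case (Cons u us)
  note G = Cons.prems[unfolded list.size add_Suc_right add_0_right] and ml = baln_multilin[OF G]
  have "balUn (Suc (length us)) sc (\<lambda>vs v. G (map2 (*) vs (u # us) @ [v * q]) p)"
  proof (rule baln_ConsI, unfold list.map zip_Cons_Cons prod.case append_Cons)
    fix x show "balUn (length us) sc (\<lambda>xs v. G (x * u # map2 (*) xs us @ [v * q]) p)"
      by (rule Cons.IH[OF baln_Cons[OF G]])
  next
    fix xs :: "'u list" and v assume "length xs = length us"
    then show "lin (scU H) sc (\<lambda>x. G (x * u # map2 (*) xs us @ [v * q]) p)"
      by (intro multilin_hd[OF ml] lin_U) simp_all
  next
    fix a x x' and xs :: "'u list" and v assume l: "Suc (length xs) = length us"
    then obtain w ws where us: "us = w # ws" by (cases us) auto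
    show "G (t a * x * u # map2 (*) (x' # xs) us @ [v * q]) p = G (x * u # map2 (*) (s a * x' # xs) us @ [v * q]) p"
      using baln_move[OF G, of "[]" "map2 (*) xs ws @ [v * q]" a "x * u" "x' * w" p] l
      by (simp add: us mult.assoc)
  next
    fix a x v assume l: "length us = 0"
    show "G (t a * x * u # map2 (*) [] us @ [v * q]) p = G (x * u # map2 (*) [] us @ [s a * v * q]) p"
      using baln_move[OF G, of "[]" "[]" a "x * u" "v * q" p] l by (simp add: mult.assoc)
  qed
  then show ?case by simp
qed

text \<open>The stage of \<open>cyg\<close> in which
  \<open>p\<^sub>(\<^sub>-\<^sub>1\<^sub>)\<close>, \<open>p\<^sub>(\<^sub>0\<^sub>)\<close>,
  \<open>u\<^sub>+\<close> and \<open>u\<^sub>-\<close> are held fixed. It is singled out because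
  the two pairs become balanced at different stages.\<close>

definition cyi :: "('k \<Rightarrow> 'w \<Rightarrow> 'w) \<Rightarrow> ('u list \<Rightarrow> 'p \<Rightarrow> 'w::ab_group_add) \<Rightarrow> 'u list \<Rightarrow> 'u \<Rightarrow> 'p \<Rightarrow> 'u \<Rightarrow> 'u \<Rightarrow> 'w" where
  "cyi sc G us q p0 up um = ic sc (length us) um (\<lambda>vs v. G (map2 (*) vs us @ [v * q]) (act P p0 up))"

definition cyg :: "('k \<Rightarrow> 'w \<Rightarrow> 'w) \<Rightarrow> ('u list \<Rightarrow> 'p \<Rightarrow> 'w::ab_group_add) \<Rightarrow> 'u list \<Rightarrow> 'p \<Rightarrow> 'w" where
  "cyg sc G us p = lincomb sc (\<lambda>(q, p0). lincomb sc (\<lambda>(up, um). cyi sc G (tl us) q p0 up um) (tr (hd us))) (ca p)"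

context
  fixes sc :: "'k \<Rightarrow> 'w \<Rightarrow> 'w::ab_group_add" and G :: "'u list \<Rightarrow> 'p \<Rightarrow> 'w"
  assumes V: "vector_space sc"
begin

text \<open>A factor t(a) to the right of \<open>up\<close> is the left action on the last tensor
  factor and passes to the factor \<open>v * q\<close> before it. A factor t(a) to the left of
  \<open>um\<close> also arrives there, since iterated coproducts carry it to the last leg.\<close>

lemma balop_cyi:
  assumes G: "balC (Suc (length us)) sc G"
  shows "balop sc (cyi sc G us q p0)"
  unfolding cyi_def
proof (intro balopI lin_icop V balUn_map2_mult G lin_icop_fun)
  show "lin (scU H) sc (\<lambda>x. G (map2 (*) vs us @ [v * q]) (act P p0 x))" if "length vs = length us" for vs v
    using that by (intro multilin_last[OF baln_multilin[OF G]] lin_P) simp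
  show "ic sc (length us) y (\<lambda>vs v. G (map2 (*) vs us @ [v * q]) (act P p0 (x * t a))) =
     ic sc (length us) (t a * y) (\<lambda>vs v. G (map2 (*) vs us @ [v * q]) (act P p0 x))" for a x y
    unfolding icop_tgt_left[OF V balUn_map2_mult[OF G]]
    using baln_move_last[OF G]
    by (intro icop_cong) (simp add: act_act[symmetric] lact_eq_act[symmetric] mult.assoc)
qed

lemma cyi_mult_tgt:
  assumes G: "balC (Suc (length us)) sc G"
  shows "cyi sc G us q p0 up (um * t a) = cyi sc G us (t a * q) p0 up um"
  unfolding cyi_def icop_mult_tgt[OF V balUn_map2_mult[OF G]] by (simp add: mult.assoc)

text \<open>In \<open>q\<close> and \<open>p0\<close> the expression is balanced only after summing
  over \<open>tr u\<close>: t(a) meets \<open>up\<close> from the left, \<open>sw_tr_move\<close>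
  turns this into a factor to the right of \<open>um\<close>, and the last leg brings it to
  \<open>q\<close>.\<close>

lemma balP_cyi:
  assumes G: "balC (Suc (length us)) sc G"
  shows "balP sc (\<lambda>q p0. lincomb sc (\<lambda>(up, um). cyi sc G us q p0 up um) (tr u))"
proof (intro balPI lin_lincomb2 V)
  note ml = baln_multilin[OF G]
  show "lin (scU H) sc (\<lambda>q. cyi sc G us q p0 up um)" for p0 up um
    unfolding cyi_def by (intro lin_icop_fun V multilin_snoc_slot[OF ml] lin_U) simp
  show "lin (scP P) sc (\<lambda>p0. cyi sc G us q p0 up um)" for q up um
    unfolding cyi_def by (intro lin_icop_fun V multilin_last[OF ml] lin_P) simp
  fix a q p0
  have "lincomb sc (\<lambda>(up, um). cyi sc G us q (lact P a p0) up um) (tr u)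
      = lincomb sc (\<lambda>(up, um). cyi sc G us q p0 (t a * up) um) (tr u)"
    by (simp add: cyi_def lact_eq_act act_act)
  also have "\<dots> = lincomb sc (\<lambda>(up, um). cyi sc G us q p0 up (um * t a)) (tr u)"
    by (rule sw_tr_move[OF V balop_cyi[OF G]])
  finally show "lincomb sc (\<lambda>(up, um). cyi sc G us (t a * q) p0 up um) (tr u)
      = lincomb sc (\<lambda>(up, um). cyi sc G us q (lact P a p0) up um) (tr u)"
    by (simp add: cyi_mult_tgt[OF G])
qed

text \<open>A factor t(a) of an entry multiplies the corresponding leg of \<open>um\<close> from the
  right, and the Takeuchi condition passes it as s(a) to the next leg.\<close>

lemma cyi_move:
  assumes G: "balC (Suc (length as + length bs + 2)) sc G"
  shows "cyi sc G (as @ t a * x # x' # bs) q p0 up um = cyi sc G (as @ x # s a * x' # bs) q p0 up um"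
proof -
  let ?i = "length as"
  let ?n = "length as + length bs + 2"
  let ?F = "\<lambda>vs v. G (map2 (*) vs (as @ x # x' # bs) @ [v * q]) (act P p0 up)"
  have F: "balUn ?n sc ?F"
    using balUn_map2_mult[of "as @ x # x' # bs" sc G q "act P p0 up"] G by (simp add: add_ac)
  have 1: "map2 (*) vs (as @ t a * x # x' # bs) = map2 (*) (vs[?i := vs ! ?i * t a]) (as @ x # x' # bs)"
    and 2: "map2 (*) vs (as @ x # s a * x' # bs) = map2 (*) (vs[Suc ?i := vs ! Suc ?i * s a]) (as @ x # x' # bs)"
    if l: "length vs = ?n" for vs
  proof -
    have "vs = take ?i vs @ vs ! ?i # vs ! Suc ?i # drop (Suc (Suc ?i)) vs" "length (take ?i vs) = ?i"
      using l by (simp_all add: Cons_nth_drop_Suc)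
    then obtain cs c d ds where vs: "vs = cs @ c # d # ds" "length cs = ?i" by blast
    show "map2 (*) vs (as @ t a * x # x' # bs) = map2 (*) (vs[?i := vs ! ?i * t a]) (as @ x # x' # bs)"
      "map2 (*) vs (as @ x # s a * x' # bs) = map2 (*) (vs[Suc ?i := vs ! Suc ?i * s a]) (as @ x # x' # bs)"
      unfolding vs(1) by (simp_all add: vs(2) mult.assoc nth_append list_update_append)
  qed
  have len: "length (as @ t a * x # x' # bs) = ?n" "length (as @ x # s a * x' # bs) = ?n" by simp_all
  have "cyi sc G (as @ t a * x # x' # bs) q p0 up um = ic sc ?n um (\<lambda>vs. ?F (vs[?i := vs ! ?i * t a]))"
    unfolding cyi_def len(1) by (rule icop_cong) (simp only: 1)
  also have "\<dots> = ic sc ?n um (\<lambda>vs. ?F (vs[Suc ?i := vs ! Suc ?i * s a]))"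
    by (rule icop_takeuchi[OF V F]) simp
  also have "\<dots> = cyi sc G (as @ x # s a * x' # bs) q p0 up um"
    unfolding cyi_def len(2) by (rule icop_cong) (simp only: 2)
  finally show ?thesis .
qed

lemma cyi_move_last:
  assumes G: "balC (Suc (Suc (length as))) sc G"
  shows "cyi sc G (as @ [t a * x]) q p0 up um = cyi sc G (as @ [x]) (s a * q) p0 up um"
proof -
  let ?i = "length as"
  let ?F = "\<lambda>vs v. G (map2 (*) vs (as @ [x]) @ [v * q]) (act P p0 up)"
  have F: "balUn (Suc ?i) sc ?F" using balUn_map2_mult[of "as @ [x]" sc G q "act P p0 up"] G by simp
  have 1: "map2 (*) vs (as @ [t a * x]) = map2 (*) (vs[?i := vs ! ?i * t a]) (as @ [x])"
    if l: "length vs = Suc ?i" for vs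
  proof -
    obtain cs c where vs: "vs = cs @ [c]" "length cs = ?i" using l by (metis length_Suc_conv_rev)
    show ?thesis unfolding vs(1) by (simp add: vs(2) mult.assoc nth_append list_update_append)
  qed
  have "cyi sc G (as @ [t a * x]) q p0 up um = ic sc (Suc ?i) um (\<lambda>vs. ?F (vs[?i := vs ! ?i * t a]))"
    unfolding cyi_def length_append_singleton by (rule icop_cong) (simp only: 1)
  also have "\<dots> = ic sc (Suc ?i) um (\<lambda>vs v. ?F vs (v * s a))"
    by (rule icop_takeuchi_last[OF V F])
  also have "\<dots> = cyi sc G (as @ [x]) (s a * q) p0 up um"
    unfolding cyi_def by (simp add: mult.assoc)
  finally show ?thesis .
qed

lemma cyg_tgt_hd:
  assumes G: "balC (Suc (length us)) sc G"
  shows "cyg sc G (t a * u # us) p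
    = lincomb sc (\<lambda>(q, p0). lincomb sc (\<lambda>(up, um). cyi sc G us q p0 up (um * s a)) (tr u)) (ca p)"
  unfolding cyg_def list.sel by (intro lincomb_cong2 refl sw_tr_tgt[OF V balop_cyi[OF G]])

text \<open>Relations behind the first factor are Takeuchi conditions between legs. At the end, s(a)
  reaches \<open>q\<close>, where it is the left action on \<open>p\<close>. At the front,
  \<open>(t(a)u)\<^sub>- = u\<^sub>- s(a)\<close>, and s(a) lands on the first leg, next to the
  second factor.\<close>

lemma balC_cyg:
  assumes G: "balC (Suc m) sc G"
  shows "balC (Suc m) sc (cyg sc G)"
proof (rule baln_ConsI)
  note ml = baln_multilin[OF G]
  fix u
  show "balC m sc (\<lambda>us. cyg sc G (u # us))"
    unfolding baln_def multilin_def
  proof (intro conjI allI impI)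
    fix as bs :: "'u list" and p assume l: "Suc (length as + length bs) = m"
    show "lin (scU H) sc (\<lambda>x. cyg sc G (u # as @ x # bs) p)"
      unfolding cyg_def cyi_def list.sel
    proof (intro lin_lincomb2 V, simp add: l, intro lin_icop_fun V)
      fix q p0 up um and vs :: "'u list" and v assume lv: "length vs = m"
      then show "lin (scU H) sc (\<lambda>x. G (map2 (*) vs (as @ x # bs) @ [v * q]) (act P p0 up))"
        using l by (simp add: map2_split_right[of vs as bs])
          (intro multilin_slot[OF ml] lin_U; simp)
    qed
  next
    fix xs :: "'u list" assume "length xs = m"
    show "lin (scP P) sc (cyg sc G (u # xs))"
      unfolding cyg_def by (rule lin_lincomb_arg[OF V lin_ca])
  next
    fix as bs :: "'u list" and x x' a p assume l: "length as + length bs + 2 = m"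
    show "cyg sc G (u # as @ t a * x # x' # bs) p = cyg sc G (u # as @ x # s a * x' # bs) p"
      unfolding cyg_def list.sel by (intro lincomb_cong2 refl cyi_move G[folded l])
  next
    fix as :: "'u list" and x a p assume l: "Suc (length as) = m"
    have G': "balC (Suc (length (as @ [x]))) sc G" using G l by simp
    have "cyg sc G (u # as @ [t a * x]) p
        = lincomb sc (\<lambda>(q, p0). lincomb sc (\<lambda>(up, um). cyi sc G (as @ [x]) (s a * q) p0 up um) (tr u)) (ca p)"
      unfolding cyg_def list.sel by (intro lincomb_cong2 refl cyi_move_last G[folded l])
    also have "\<dots> = cyg sc G (u # as @ [x]) (lact P a p)"
      unfolding cyg_def list.sel by (simp only: sw_lact[OF V balP_cyi[OF G']])
    finally show "cyg sc G (u # as @ [t a * x]) p = cyg sc G (u # as @ [x]) (lact P a p)" .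
  qed
next
  fix xs :: "'u list" and p
  show "lin (scU H) sc (\<lambda>u. cyg sc G (u # xs) p)"
    unfolding cyg_def list.sel by (intro lin_lincomb2 lin_lincomb_arg[OF V lin_tr] V)
next
  fix a x x' and xs :: "'u list" and p assume l: "Suc (length xs) = m"
  have G': "balC (Suc (length (x' # xs))) sc G" using G l by simp
  have "cyi sc G (x' # xs) q p0 up (um * s a) = cyi sc G (s a * x' # xs) q p0 up um" for q p0 up um
  proof -
    let ?F = "\<lambda>vs v. G (map2 (*) vs (x' # xs) @ [v * q]) (act P p0 up)"
    have "balUn (Suc (length xs)) sc ?F" using balUn_map2_mult[OF G'] by simp
    from icop_mult_src[OF V this]
    have "cyi sc G (x' # xs) q p0 up (um * s a) = ic sc (Suc (length xs)) um (\<lambda>vs. ?F (vs[0 := vs ! 0 * s a]))"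
      by (simp add: cyi_def)
    also have "\<dots> = ic sc (Suc (length xs)) um (\<lambda>vs v. G (map2 (*) vs (s a * x' # xs) @ [v * q]) (act P p0 up))"
    proof (rule icop_cong)
      fix vs :: "'u list" and v assume "length vs = Suc (length xs)"
      then obtain c cs where "vs = c # cs" by (cases vs) auto
      then show "?F (vs[0 := vs ! 0 * s a]) v = G (map2 (*) vs (s a * x' # xs) @ [v * q]) (act P p0 up)"
        by (simp add: mult.assoc)
    qed
    finally show ?thesis by (simp add: cyi_def)
  qed
  then show "cyg sc G (t a * x # x' # xs) p = cyg sc G (x # s a * x' # xs) p"
    unfolding cyg_tgt_hd[OF G'] by (simp add: cyg_def)
next
  fix a x p assume m: "m = 0"
  have G': "balC (Suc (length ([] :: 'u list))) sc G" using G m by simp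
  have "cyi sc G [] q p0 up (um * s a) = cyi sc G [] (s a * q) p0 up um" for q p0 up um
    by (simp add: cyi_def mult.assoc)
  then show "cyg sc G [t a * x] p = cyg sc G [x] (lact P a p)"
    unfolding cyg_tgt_hd[OF G'] by (simp add: cyg_def sw_lact[OF V balP_cyi[OF G']])
qed

lemma lincomb_cyg:
  assumes G: "balC (Suc (length us)) sc G"
  shows "lincomb sc (\<lambda>(us, p). G us p) (cyg free_scale (tC (Suc (length us))) (u # us) p) = cyg sc G (u # us) p"
  unfolding cyg_def cyi_def list.sel
  by (simp add: lincomb_lincomb2[OF V] icop_comp[OF lincomb_lin[OF V]] lincomb_tC[OF V G])

end

text \<open>The nested sums \<open>?E1\<close>, \<open>?E2\<close>, \<open>?E\<close> are resolved
  from the inside, their balancedness being \<open>balUn_map2_mult\<close>, \<open>balop_cyi\<close>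
  and \<open>balP_cyi\<close>.\<close>

lemma hopf_cyc_nf:
  assumes X: "X \<in> carrier (Cn H P (Suc n))"
  shows "hopf_cyc H P (Suc n) X \<in> carrier (Cn H P (Suc n))
    \<and> nf (Cn H P (Suc n)) (hopf_cyc H P (Suc n) X)
      = lincomb free_scale (\<lambda>(us, p). cyg free_scale (tC (Suc n)) us p) (nf (Cn H P (Suc n)) X)"
proof -
  note Vf = vector_space_free
  let ?T = "Cn H P (Suc n)"
  let ?E1 = "\<lambda>us q p0 up um. lift ?T (iter_coprod H n um) (\<lambda>(vs, v). tens ?T (map2 (*) vs (tl us) @ [v * q], act P p0 up))"
  let ?E2 = "\<lambda>us q p0. lift ?T (translation H (hd us)) (\<lambda>(up, um). ?E1 us q p0 up um)"
  let ?E = "\<lambda>us p. lift ?T (coact P p) (\<lambda>(q, p0). ?E2 us q p0)"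
  have "lift ?T X (\<lambda>(us, p). ?E us p) \<in> carrier ?T
    \<and> nf ?T (lift ?T X (\<lambda>(us, p). ?E us p))
      = lincomb free_scale (\<lambda>(us, p). cyg free_scale (tC (Suc n)) us p) (nf ?T X)"
  proof (rule lift_generators[OF X[unfolded Cn_def] Cn_fquot, folded Cn_def])
    show "balC (Suc n) free_scale (cyg free_scale (tC (Suc n)))" by (rule balC_cyg[OF Vf tn_Cn])
  next
    fix us :: "'u list" and p assume us: "length us = Suc n"
    define us' where "us' = tl us"
    have n: "length us' = n" using us by (simp add: us'_def)
    have G: "balC (Suc (length us')) free_scale (tC (Suc n))" unfolding n by (rule tn_Cn)
    have c: "\<forall>vs v. length vs = n \<longrightarrow> tens ?T (map2 (*) vs us' @ [v * q], p1) \<in> carrier ?T" for q p1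
      by (intro allI impI tens_Cn) (simp add: n)
    have N1: "?E1 us q p0 up um \<in> carrier ?T \<and> nf ?T (?E1 us q p0 up um) = cyi free_scale (tC (Suc n)) us' q p0 up um"
      for q p0 up um
      using nf_liftn[OF iter_coprod_carrier[unfolded UnU_def] Cn_fquot c
          balUn_map2_mult[OF G, unfolded n], folded UnU_def, of um q "act P p0 up"]
      unfolding lincomb_iter_coprod[OF Vf balUn_map2_mult[OF G, unfolded n]]
      by (simp add: cyi_def n us'_def[symmetric])
    note tr = translation_carrier[unfolded UopU_def]
    have N2: "?E2 us q p0 \<in> carrier ?T \<and> nf ?T (?E2 us q p0)
        = lincomb free_scale (\<lambda>(up, um). cyi free_scale (tC (Suc n)) us' q p0 up um) (tr (hd us))" for q p0
    proof -
      have b: "balop free_scale (\<lambda>up um. nf ?T (?E1 us q p0 up um))"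
        using N1 balop_cyi[OF Vf G] by simp
      show ?thesis using nf_lift2[OF tr Cn_fquot _ b, folded UopU_def, of "hd us"] N1 by simp
    qed
    have b: "balP free_scale (\<lambda>q p0. nf ?T (?E2 us q p0))"
      using N2 balP_cyi[OF Vf G] by simp
    show "?E us p \<in> carrier ?T \<and> nf ?T (?E us p) = cyg free_scale (tC (Suc n)) us p"
      using nf_lift2[OF coact_carrier' Cn_fquot _ b, folded UP_def, of p] N2
      by (simp add: cyg_def us'_def)
  qed
  then show ?thesis unfolding hopf_cyc_def by (simp add: Let_def)
qed

end

section \<open>Measurings\<close>

lemma baln_draws:
  assumes V: "vector_space sc"
    and F: "\<And>vs d. length vs = length us \<Longrightarrow> baln n scX ra la scM lm sc (\<lambda>xs m. F xs m vs d)"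
  shows "baln n scX ra la scM lm sc (\<lambda>xs m. draws sc dr \<Psi> us y (F xs m))"
  using F
proof (induction us arbitrary: y F)
  case (Cons u us)
  show ?case unfolding draws.simps
    by (intro baln_lincomb2 V Cons.IH Cons.prems) simp
qed simp

locale hopf_measure = comodule C D + L: hopf_alg H + R: hopf_alg H'
  for C :: "('k::field, 'c::ab_group_add) coalg" and D :: "('k, 'c, 'd::ab_group_add) comod"
    and H :: "('k, 'u::{ring,monoid_mult}, 'a::{ring,monoid_mult}) hopf"
    and H' :: "('k, 'v::{ring,monoid_mult}, 'b::{ring,monoid_mult}) hopf" +
  fixes \<Psi> :: "'c \<Rightarrow> 'u \<Rightarrow> 'v" and \<psi> :: "'c \<Rightarrow> 'a \<Rightarrow> 'b"
  assumes hopf_meas: "hopf_measuring C H H' \<Psi> \<psi>"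
begin

abbreviation "dw sc us y G \<equiv> draws sc dr \<Psi> us y G"

lemma lin_\<Psi>: "lin (scU H) (scU H') (\<Psi> c)" and lin_\<Psi>_left: "lin (scC C) (scU H') (\<lambda>c. \<Psi> c u)"
  and \<Psi>_mult': "\<Psi> c (u * v) = lift (type_space (scU H')) (coprodC C c) (\<lambda>(c1, c2). \<Psi> c1 u * \<Psi> c2 v)"
  and \<Psi>_one: "\<Psi> c 1 = scU H' (counitC C c) 1"
  and \<Psi>_s: "\<Psi> c (L.s a) = R.s (\<psi> c a)" and \<Psi>_t: "\<Psi> c (L.t a) = R.t (\<psi> c a)"
  and \<Psi>_S: "\<Psi> c (L.S u) = R.S (\<Psi> c u)" and \<psi>_counit: "\<psi> c (L.\<epsilon> u) = R.\<epsilon> (\<Psi> c u)"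
  and coprod_\<Psi>: "coprod H' (\<Psi> c u) = lift (UU H') (coprod H u)
          (\<lambda>(u1, u2). lift (UU H') (coprodC C c) (\<lambda>(x1, x2). tens (UU H') (\<Psi> x1 u1, \<Psi> x2 u2)))"
  using hopf_meas unfolding hopf_measuring_def algebra_measuring_def
  by - (elim conjE, (assumption | (erule allE)+, assumption))+

lemmas lin_measure = lin_id lin_\<Psi> lin_\<Psi>_left R.lin_mult_left R.lin_mult_right

lemma \<Psi>_mult: "\<Psi> c (u * v) = lincomb (scU H') (\<lambda>(c1, c2). \<Psi> c1 u * \<Psi> c2 v) (cop c)"
proof -
  have "bal2 (scC C) (scC C) (scC C) (scC C) (scU H') (\<lambda>c1 c2. \<Psi> c1 u * \<Psi> c2 v)"
    by (intro bal2_bilinear lin_measure)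
  from lift2_type_space[OF coprodC_carrier[OF coalg, unfolded CC_def] R.U_vs this, folded CC_def]
  show ?thesis by (simp add: \<Psi>_mult')
qed

lemma sum_mult:
  assumes K: "lin (scU H') sc K"
  shows "K (\<Psi> c (u * v)) = lincomb sc (\<lambda>(c1, c2). K (\<Psi> c1 u * \<Psi> c2 v)) (cop c)"
  unfolding \<Psi>_mult by (rule lincomb_comp2[OF K])

text \<open>\<open>K\<close> may depend on the remaining element of \<open>D\<close>, so a leg can
  be split for a product before the later legs have been drawn.\<close>

lemma draw_mult:
  assumes V: "vector_space sc" and K: "\<And>v. lin (scD D) sc (\<lambda>d. K d v)" "\<And>d. lin (scU H') sc (K d)"
  shows "lincomb sc (\<lambda>(d, c). K d (\<Psi> c (u * v))) (dr y)
    = lincomb sc (\<lambda>(d, c). lincomb sc (\<lambda>(d', c'). K d' (\<Psi> c u * \<Psi> c' v)) (dr d)) (dr y)"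
proof -
  have l: "lin s0 sc (\<lambda>x. K d (g x))" if "lin s0 (scU H') g" for d g and s0 :: "'k \<Rightarrow> 'z::ab_group_add \<Rightarrow> 'z"
    by (rule lin_compose[OF that K(2)])
  show ?thesis
    unfolding sum_mult[OF K(2)] by (rule draw_split[OF V]) (intro K(1) l lin_measure)+
qed

text \<open>A balanced map sees the relation only after measuring: \<Psi>(t(a)u) spends one leg on
  t(a) and one on \<open>u\<close>, the first factor crosses over as s, and its leg then has to be
  recombined with that of \<open>v\<close>.\<close>

lemma draw_move:
  assumes V: "vector_space sc"
    and K: "\<And>v w. lin (scD D) sc (\<lambda>d. K d v w)" "\<And>d w. lin (scU H') sc (\<lambda>v. K d v w)" "\<And>d v. lin (scU H') sc (K d v)"
    and mv: "\<And>d b v w. K d (R.t b * v) w = K d v (R.s b * w)"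
  shows "lincomb sc (\<lambda>(d, c). lincomb sc (\<lambda>(d', c'). K d' (\<Psi> c (L.t a * u)) (\<Psi> c' v)) (dr d)) (dr y)
    = lincomb sc (\<lambda>(d, c). lincomb sc (\<lambda>(d', c'). K d' (\<Psi> c u) (\<Psi> c' (L.s a * v))) (dr d)) (dr y)"
proof -
  have l2: "lin s0 sc (\<lambda>x. K d (g x) w)" if "lin s0 (scU H') g" for d g w and s0 :: "'k \<Rightarrow> 'z::ab_group_add \<Rightarrow> 'z"
    by (rule lin_compose[OF that K(2)])
  have l3: "lin s0 sc (\<lambda>x. K d w (g x))" if "lin s0 (scU H') g" for d g w and s0 :: "'k \<Rightarrow> 'z::ab_group_add \<Rightarrow> 'z"
    by (rule lin_compose[OF that K(3)])
  let ?G = "\<lambda>d c c1. lincomb sc (\<lambda>(d', c'). K d' (\<Psi> c1 u) (\<Psi> c (L.s a) * \<Psi> c' v)) (dr d)"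
  have "lincomb sc (\<lambda>(d, c). lincomb sc (\<lambda>(d', c'). K d' (\<Psi> c (L.t a * u)) (\<Psi> c' v)) (dr d)) (dr y)
      = lincomb sc (\<lambda>(d, c). lincomb sc (\<lambda>(d1, c1). lincomb sc (\<lambda>(d', c'). K d' (\<Psi> c (L.t a) * \<Psi> c1 u) (\<Psi> c' v)) (dr d1)) (dr d)) (dr y)"
    by (rule draw_mult[OF V]) (intro lin_lincomb_arg lin_lincomb2 V lin_dr K)+
  also have "\<dots> = lincomb sc (\<lambda>(d, c). lincomb sc (\<lambda>(d1, c1). ?G d1 c c1) (dr d)) (dr y)"
    by (simp add: \<Psi>_t \<Psi>_s mv)
  \<comment> \<open>The legs of \<open>a\<close> and \<open>u\<close> are exchanged, so that the leg
    of \<open>a\<close> stands directly before that of \<open>v\<close>.\<close>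
  also have "\<dots> = lincomb sc (\<lambda>(d, c). lincomb sc (\<lambda>(d1, c1). ?G d1 c1 c) (dr d)) (dr y)"
    by (rule draw_swap[OF V]) (intro lin_lincomb_arg lin_lincomb2 V lin_dr l2 l3 lin_measure)+
  also have "\<dots> = lincomb sc (\<lambda>(d, c). lincomb sc (\<lambda>(d', c'). K d' (\<Psi> c u) (\<Psi> c' (L.s a * v))) (dr d)) (dr y)"
    by (intro lincomb_cong2 refl draw_mult[OF V, symmetric] K)
  finally show ?thesis .
qed

lemma regular: "hopf_measure C \<lparr>scD = scC C, coactD = coprodC C\<rparr> H H' \<Psi> \<psi>"
  using regular_comodule[OF coalg cocomm] hopf_meas L.hopf_alg_axioms R.hopf_alg_axioms
  by (simp add: hopf_measure_def hopf_measure_axioms_def)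

text \<open>The regular comodule yields the law that removes the second leg; cocommutativity
  converts it into removal of the first.\<close>

lemma sum_counit:
  assumes V: "vector_space sc" and g: "lin (scC C) sc g"
  shows "lincomb sc (\<lambda>(c1, c2). sc (counitC C c1) (g c2)) (cop c) = g c"
proof -
  interpret V: vector_space sc by (rule V)
  interpret reg: comodule C "\<lparr>scD = scC C, coactD = coprodC C\<rparr>" by (rule regular_comodule[OF coalg cocomm])
  have "lincomb sc (\<lambda>(c1, c2). sc (counitC C c1) (g c2)) (cop c) = lincomb sc (\<lambda>(c1, c2). sc (counitC C c2) (g c1)) (cop c)"
    by (rule cop_commute[OF V])
      (use g coalgebra_lin_counit[OF coalg] in \<open>auto simp: lin_iff V.scale_left_distrib V.scale_right_distrib mult.commute\<close>)
  also have "\<dots> = g c"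
    using reg.draw_counit[OF V, of g c] g by (simp add: DC_def CC_def)
  finally show ?thesis .
qed

text \<open>The regular comodule version of \<open>draw_move\<close>, with the third leg \<open>d\<close> removed by the counit.\<close>

lemma regular_move:
  assumes V: "vector_space sc" and F: "R.balU sc F"
  shows "lincomb sc (\<lambda>(c1, c2). F (\<Psi> c1 (L.t a * u)) (\<Psi> c2 v)) (cop c)
    = lincomb sc (\<lambda>(c1, c2). F (\<Psi> c1 u) (\<Psi> c2 (L.s a * v))) (cop c)"
proof -
  interpret V: vector_space sc by (rule V)
  note lF = bal2_lin1[OF F] bal2_lin2[OF F]
  let ?K = "\<lambda>d x y. sc (counitC C d) (F x y)"
  have l: "lin (scD \<lparr>scD = scC C, coactD = coprodC C\<rparr>) sc (\<lambda>d. ?K d x y)" for x y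
    using coalgebra_lin_counit[OF coalg] by (auto simp: lin_iff V.scale_left_distrib)
  have l': "lin s0 sc (\<lambda>x. sc b (h x))" if "lin s0 sc h" for b h and s0 :: "'k \<Rightarrow> 'z::ab_group_add \<Rightarrow> 'z"
    using that by (auto simp: lin_iff V.scale_right_distrib mult.commute)
  have p: "\<And>x y. lin (scD \<lparr>scD = scC C, coactD = coprodC C\<rparr>) sc (\<lambda>d. ?K d x y)"
    "\<And>d y. lin (scU H') sc (\<lambda>x. ?K d x y)" "\<And>d x. lin (scU H') sc (\<lambda>y. ?K d x y)"
    "\<And>d b x y. ?K d (R.t b * x) y = ?K d x (R.s b * y)"
    by (intro l, intro l' lF lin_id, intro l' lF lin_id, simp add: bal2_move[OF F])
  have "lincomb sc (\<lambda>(d, c). lincomb sc (\<lambda>(d', c'). ?K d' (\<Psi> c (L.t a * u)) (\<Psi> c' v)) (cop d)) (cop c)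
      = lincomb sc (\<lambda>(d, c). lincomb sc (\<lambda>(d', c'). ?K d' (\<Psi> c u) (\<Psi> c' (L.s a * v))) (cop d)) (cop c)"
    using hopf_measure.draw_move[OF regular V p, of a u v c] by (simp add: DC_def CC_def)
  moreover have "lincomb sc (\<lambda>(d', c'). ?K d' x (\<Psi> c' y)) (cop d) = F x (\<Psi> d y)" for x y d
    by (rule sum_counit[OF V]) (intro lF lin_measure)
  ultimately have "lincomb sc (\<lambda>(d, c). F (\<Psi> c (L.t a * u)) (\<Psi> d v)) (cop c)
      = lincomb sc (\<lambda>(d, c). F (\<Psi> c u) (\<Psi> d (L.s a * v))) (cop c)" by simp
  then show ?thesis
    by (subst cop_commute[OF V], (intro lF lin_measure)+, subst (2) cop_commute[OF V], (intro lF lin_measure)+)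
qed

lemma sw_coprod_balU:
  assumes V: "vector_space sc" and F: "R.balU sc F"
  shows "L.balU sc (\<lambda>u1 u2. lincomb sc (\<lambda>(c1, c2). F (\<Psi> c1 u1) (\<Psi> c2 u2)) (cop c))"
  by (intro L.balUI regular_move V F lin_lincomb2 bal2_lin1[OF F] bal2_lin2[OF F] lin_measure)

lemma sw_coprod:
  assumes V: "vector_space sc" and F: "R.balU sc F"
  shows "lincomb sc (\<lambda>(x, y). F x y) (R.dl (\<Psi> c u))
    = lincomb sc (\<lambda>(u1, u2). lincomb sc (\<lambda>(c1, c2). F (\<Psi> c1 u1) (\<Psi> c2 u2)) (cop c)) (L.dl u)"
proof -
  note Vf = vector_space_free
  have i: "bal2 (scC C) (scC C) (scC C) (scC C) free_scale (\<lambda>c1 c2. tn (UU H') (\<Psi> c1 u1, \<Psi> c2 u2))" for u1 u2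
    by (intro bal2_bilinear bal2_lin1[OF R.tn_UU] bal2_lin2[OF R.tn_UU] lin_measure)
  note n = nf_lift2[OF coprodC_carrier[OF coalg, unfolded CC_def] R.UU_fquot R.tens_UU i, folded CC_def]
  have o: "L.balU free_scale (\<lambda>u1 u2. nf (UU H') (lift (UU H') (coprodC C c) (\<lambda>(c1, c2). tens (UU H') (\<Psi> c1 u1, \<Psi> c2 u2))))"
    unfolding n by (rule sw_coprod_balU[OF Vf R.tn_UU])
  show ?thesis
    unfolding coprod_\<Psi> nf_lift2[OF L.coprod_carrier' R.UU_fquot n(1) o, folded UU_def] n
      lincomb_lincomb2[OF V] R.lincomb_tn_UU[OF V F] ..
qed

text \<open>The formula for \<open>translation\<close> interchanges the two legs of S(u), so the
  legs of \<open>c\<close> come out in the wrong order, which cocommutativity repairs.\<close>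

lemma sw_translation:
  assumes V: "vector_space sc" and K: "R.balop sc K"
  shows "lincomb sc (\<lambda>(x, y). K x y) (R.tr (\<Psi> c u))
    = lincomb sc (\<lambda>(up, um). lincomb sc (\<lambda>(c1, c2). K (\<Psi> c1 up) (\<Psi> c2 um)) (cop c)) (L.tr u)"
proof -
  let ?B = "\<lambda>w1 w2. lincomb sc (\<lambda>(c1, c2). K (\<Psi> c1 (L.S w2)) (\<Psi> c2 w1)) (cop c)"
  have flip: "lincomb sc (\<lambda>(c1, c2). K (\<Psi> c2 (L.S w2)) (\<Psi> c1 w1)) (cop c) = ?B w1 w2" for w1 w2
    by (rule cop_commute[OF V]) (intro bal2_lin1[OF K] bal2_lin2[OF K] lin_measure)+
  have B: "L.balU sc ?B"
    using sw_coprod_balU[OF V R.balU_flip[OF K], of c] unfolding \<Psi>_S[symmetric] flip .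
  from L.balop_flip[OF B] have K': "L.balop sc (\<lambda>x y. lincomb sc (\<lambda>(c1, c2). K (\<Psi> c1 x) (\<Psi> c2 y)) (cop c))"
    by (simp add: L.S_S)
  show ?thesis
    unfolding R.sw_tr[OF V K] L.sw_tr[OF V K'] \<Psi>_S[symmetric] sw_coprod[OF V R.balU_flip[OF K]]
      flip ..
qed

text \<open>Measuring commutes with iterated coproducts: the one leg applied to \<open>u\<close>
  turns into a separate leg for every factor. The leg of the last factor is kept outermost, as this
  factor is not part of the list.\<close>

lemma icop_measure:
  assumes V: "vector_space sc"
    and F: "\<And>d. R.balUn n sc (\<lambda>ws w. F ws w d)" "\<And>ws w. length ws = n \<Longrightarrow> lin (scD D) sc (F ws w)"
  shows "lincomb sc (\<lambda>(d, c). R.ic sc n (\<Psi> c u) (\<lambda>ws w. F ws w d)) (dr y)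
    = L.ic sc n u (\<lambda>vs v. lincomb sc (\<lambda>(d, c). dw sc vs d (\<lambda>ws. F ws (\<Psi> c v))) (dr y))"
  using F
proof (induction n arbitrary: u y F)
  case (Suc n)
  have ml: "multilin (Suc n) (scU H') (scU H') sc (\<lambda>ws w. F ws w d)" for d
    by (rule baln_multilin[OF Suc.prems(1)])
  have F1: "R.balUn n sc (\<lambda>ws w. F (v # ws) w d)" for v d by (rule baln_Cons[OF Suc.prems(1)])
  let ?G = "\<lambda>u1 u2 d c1 c2. R.ic sc n (\<Psi> c2 u2) (\<lambda>ws w. F (\<Psi> c1 u1 # ws) w d)"
  have "lincomb sc (\<lambda>(d, c). R.ic sc (Suc n) (\<Psi> c u) (\<lambda>ws w. F ws w d)) (dr y)
      = lincomb sc (\<lambda>(d, c). lincomb sc (\<lambda>(u1, u2). lincomb sc (\<lambda>(c1, c2). ?G u1 u2 d c1 c2) (cop c)) (L.dl u)) (dr y)"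
    by (simp add: sw_coprod[OF V R.icop_balU[OF V Suc.prems(1)]])
  also have "\<dots> = lincomb sc (\<lambda>(u1, u2). lincomb sc (\<lambda>(d, c). lincomb sc (\<lambda>(c1, c2). ?G u1 u2 d c1 c2) (cop c)) (dr y)) (L.dl u)"
    by (rule lincomb_swap2[OF V])
  also have "\<dots> = lincomb sc (\<lambda>(u1, u2). lincomb sc (\<lambda>(d, c1). lincomb sc (\<lambda>(d', c2). ?G u1 u2 d' c1 c2) (dr d)) (dr y)) (L.dl u)"
    by (intro lincomb_cong2 refl draw_split V lin_icop_fun Suc.prems(2) multilin_hd[OF ml] lin_measure
        lin_compose[OF lin_\<Psi>_left R.lin_icop[OF V F1]]) simp_all
  also have "\<dots> = lincomb sc (\<lambda>(u1, u2). lincomb sc (\<lambda>(d, c1). L.ic sc n u2 (\<lambda>vs v.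
      lincomb sc (\<lambda>(d', c). dw sc vs d' (\<lambda>ws. F (\<Psi> c1 u1 # ws) (\<Psi> c v))) (dr d))) (dr y)) (L.dl u)"
    by (intro lincomb_cong2 refl Suc.IH F1 Suc.prems(2)) simp
  also have "\<dots> = lincomb sc (\<lambda>(u1, u2). L.ic sc n u2 (\<lambda>vs v. lincomb sc (\<lambda>(d, c1).
      lincomb sc (\<lambda>(d', c). dw sc vs d' (\<lambda>ws. F (\<Psi> c1 u1 # ws) (\<Psi> c v))) (dr d)) (dr y))) (L.dl u)"
    by (simp only: icop_lincomb[OF V])
  \<comment> \<open>The leg of the last factor is moved outside that of \<open>u1\<close>, which
    then joins the legs of \<open>vs\<close>.\<close>
  also have "\<dots> = lincomb sc (\<lambda>(u1, u2). L.ic sc n u2 (\<lambda>vs v. lincomb sc (\<lambda>(d, c).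
      lincomb sc (\<lambda>(d', c1). dw sc vs d' (\<lambda>ws. F (\<Psi> c1 u1 # ws) (\<Psi> c v))) (dr d)) (dr y))) (L.dl u)"
    by (intro lincomb_cong2 refl icop_cong draw_swap V lin_draws_arg lin_draws_fun Suc.prems(2)
        multilin_hd[OF ml] multilin_last[OF ml] lin_measure) simp_all
  also have "\<dots> = L.ic sc (Suc n) u (\<lambda>vs v. lincomb sc (\<lambda>(d, c). dw sc vs d (\<lambda>ws. F ws (\<Psi> c v))) (dr y))"
    by simp
  finally show ?case .
qed simp

text \<open>Each product costs two legs, which at first come in alternation. The leg of
  \<open>u\<close> has to pass those of \<open>vs\<close> before all legs of \<open>vs\<close>
  precede all legs of \<open>us\<close>.\<close>

lemma draws_map2_mult:
  assumes V: "vector_space sc" and "length vs = length us"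
    and "multilin (length us) (scU H') (scD D) sc G"
  shows "dw sc (map2 (*) vs us) y G = dw sc vs y (\<lambda>vs' d. dw sc us d (\<lambda>us'. G (map2 (*) vs' us')))"
  using assms(2-)
proof (induction vs us arbitrary: y G rule: list_induct2)
  case (Cons v vs u us)
  note ml = Cons.prems[unfolded list.size add_Suc_right add_0_right]
  have "dw sc (map2 (*) (v # vs) (u # us)) y G
      = lincomb sc (\<lambda>(d, c). dw sc (map2 (*) vs us) d (\<lambda>ws. G (\<Psi> c (v * u) # ws))) (dr y)" by simp
  also have "\<dots> = lincomb sc (\<lambda>(d, c). lincomb sc (\<lambda>(d', c'). dw sc (map2 (*) vs us) d' (\<lambda>ws. G ((\<Psi> c v * \<Psi> c' u) # ws))) (dr d)) (dr y)"
    by (rule draw_mult[OF V]) (intro lin_draws_arg lin_draws_fun V multilin_last[OF ml _ lin_id]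
        multilin_hd[OF ml _ lin_id]; simp add: Cons.hyps)+
  also have "\<dots> = lincomb sc (\<lambda>(d, c). lincomb sc (\<lambda>(d', c'). dw sc vs d' (\<lambda>vs' d.
      dw sc us d (\<lambda>us'. G ((\<Psi> c v * \<Psi> c' u) # map2 (*) vs' us')))) (dr d)) (dr y)"
    by (intro lincomb_cong2 refl Cons.IH multilin_Cons ml)
  also have "\<dots> = lincomb sc (\<lambda>(d, c). dw sc vs d (\<lambda>vs' d. lincomb sc (\<lambda>(d', c').
      dw sc us d' (\<lambda>us'. G ((\<Psi> c v * \<Psi> c' u) # map2 (*) vs' us'))) (dr d))) (dr y)"
  proof (intro lincomb_cong2 refl draws_draw_swap[OF V lin_\<Psi>_left, symmetric])
    fix c c'
    show "multilin (length vs) (scU H') (scD D) sc (\<lambda>vs' d. dw sc us d (\<lambda>us'. G ((\<Psi> c v * \<Psi> c' u) # map2 (*) vs' us')))"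
      unfolding multilin_def
    proof (intro conjI allI impI lin_draws_fun V)
      fix as bs us' :: "'v list" and d assume l: "Suc (length as + length bs) = length vs" "length us' = length us"
      have "multilin (length us') (scU H') (scD D) sc (\<lambda>xs. G ((\<Psi> c v * \<Psi> c' u) # map2 (*) xs us'))"
        by (rule multilin_map2[OF _ R.lin_mult_right[OF lin_id]]) (use multilin_Cons[OF ml] l in simp)
      from multilin_slot[OF this _ lin_id]
      show "lin (scU H') sc (\<lambda>x. G ((\<Psi> c v * \<Psi> c' u) # map2 (*) (as @ x # bs) us') d)"
        using l Cons.hyps by simp
    next
      fix xs :: "'v list" assume "length xs = length vs"
      then show "lin (scD D) sc (\<lambda>d. dw sc us d (\<lambda>us'. G ((\<Psi> c v * \<Psi> c' u) # map2 (*) xs us')))"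
        by (intro lin_draws_arg V multilin_last[OF ml _ lin_id]) (simp add: Cons.hyps)
    qed
  next
    fix c and xs :: "'v list" and d assume "length xs = length vs"
    then show "lin (scC C) sc (\<lambda>c'. dw sc us d (\<lambda>us'. G ((\<Psi> c v * \<Psi> c' u) # map2 (*) xs us')))"
      by (intro lin_draws_fun V multilin_hd[OF ml] lin_measure) (simp add: Cons.hyps)
  qed
  finally show ?case by simp
qed simp

end

section \<open>Comodule measurings\<close>

locale measuring = hopf_measure C D H H' \<Psi> \<psi> + L: sayd H P + R: sayd H' P'
  for C :: "('k::field, 'c::ab_group_add) coalg" and D :: "('k, 'c, 'd::ab_group_add) comod"
    and H :: "('k, 'u::{ring,monoid_mult}, 'a::{ring,monoid_mult}) hopf"
    and P :: "('k, 'u, 'a, 'p::ab_group_add) saydm"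
    and H' :: "('k, 'v::{ring,monoid_mult}, 'b::{ring,monoid_mult}) hopf"
    and P' :: "('k, 'v, 'b, 'q::ab_group_add) saydm"
    and \<Psi> :: "'c \<Rightarrow> 'u \<Rightarrow> 'v" and \<psi> :: "'c \<Rightarrow> 'a \<Rightarrow> 'b" +
  fixes \<Omega> :: "'d \<Rightarrow> 'p \<Rightarrow> 'q"
  assumes comod_meas: "comodule_measuring C D H H' P P' \<Psi> \<Omega>"
begin

lemma lin_\<Omega>: "lin (scP P) (scP P') (\<Omega> y)" and lin_\<Omega>_left: "lin (scD D) (scP P') (\<lambda>y. \<Omega> y p)"
  and \<Omega>_act': "\<Omega> y (act P p u) = lift (type_space (scP P')) (coactD D y) (\<lambda>(y0, y1). act P' (\<Omega> y0 p) (\<Psi> y1 u))"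
  and coact_\<Omega>: "coact P' (\<Omega> y p) = lift (UP H' P') (coact P p)
          (\<lambda>(q, p0). lift (UP H' P') (coactD D y) (\<lambda>(y0, y1). tens (UP H' P') (\<Psi> y1 q, \<Omega> y0 p0)))"
  using comod_meas unfolding comodule_measuring_def
  by - (elim conjE, (assumption | (erule allE)+, assumption))+

lemmas lin_measure\<Omega> = lin_measure lin_\<Omega> lin_\<Omega>_left

lemma \<Omega>_act: "\<Omega> y (act P p u) = lincomb (scP P') (\<lambda>(d, c). act P' (\<Omega> d p) (\<Psi> c u)) (dr y)"
proof -
  have "bal2 (scD D) (scC C) (scD D) (scC C) (scP P') (\<lambda>d c. act P' (\<Omega> d p) (\<Psi> c u))"
    by (intro bal2_bilinear lin_compose[OF _ R.lin_act] lin_compose[OF _ R.lin_act_right] lin_measure\<Omega>)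
  from lift2_type_space[OF coactD_carrier[unfolded DC_def] R.P_vs this, folded DC_def]
  show ?thesis by (simp add: \<Omega>_act')
qed

text \<open>The left action is the right action through t, so this is the law for \<open>act\<close>
  together with \<Psi> t = t' \<psi>.\<close>

lemma \<Omega>_lact: "\<Omega> y (lact P a p) = lincomb (scP P') (\<lambda>(d, c). lact P' (\<psi> c a) (\<Omega> d p)) (dr y)"
  unfolding L.lact_eq_act R.lact_eq_act \<Omega>_act \<Psi>_t ..

text \<open>The counterpart of \<open>draw_move\<close> at the junction with the module: there the
  leg of \<open>a\<close> is absorbed by \<Omega> and not by a leg of \<open>C\<close>.\<close>

lemma draw_move_last:
  assumes V: "vector_space sc" and F: "R.balP sc F"
  shows "lincomb sc (\<lambda>(d, c). F (\<Psi> c (L.t a * u)) (\<Omega> d p)) (dr y)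
    = lincomb sc (\<lambda>(d, c). F (\<Psi> c u) (\<Omega> d (lact P a p))) (dr y)"
proof -
  have K: "lin (scD D) sc (\<lambda>d. F v (\<Omega> d p))" "lin (scU H') sc (\<lambda>v. F v (\<Omega> d p))" for v d
    by (intro bal2_lin2[OF F] bal2_lin1[OF F] lin_measure\<Omega>)+
  have mv: "F (R.t b * v) q = F v (act P' q (R.t b))" for b v q
    using bal2_move[OF F, of b v q] by (simp add: R.lact_eq_act)
  have "lincomb sc (\<lambda>(d, c). F (\<Psi> c (L.t a * u)) (\<Omega> d p)) (dr y)
      = lincomb sc (\<lambda>(d, c). lincomb sc (\<lambda>(d', c'). F (\<Psi> c' u) (act P' (\<Omega> d' p) (\<Psi> c (L.t a)))) (dr d)) (dr y)"
    unfolding draw_mult[OF V K] by (simp add: \<Psi>_t mv)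
  also have "\<dots> = lincomb sc (\<lambda>(d, c). lincomb sc (\<lambda>(d', c'). F (\<Psi> c u) (act P' (\<Omega> d' p) (\<Psi> c' (L.t a)))) (dr d)) (dr y)"
    by (rule draw_swap[OF V, symmetric])
      (intro bal2_lin1[OF F] bal2_lin2[OF F] lin_compose[OF _ R.lin_act] lin_compose[OF _ R.lin_act_right] lin_measure\<Omega>)+
  also have "\<dots> = lincomb sc (\<lambda>(d, c). F (\<Psi> c u) (\<Omega> d (lact P a p))) (dr y)"
    unfolding L.lact_eq_act \<Omega>_act lincomb_comp2[OF bal2_lin2[OF F lin_id]] ..
  finally show ?thesis .
qed

lemma sw_coact:
  assumes V: "vector_space sc" and F: "R.balP sc F"
  shows "lincomb sc (\<lambda>(q, p0). F q p0) (R.ca (\<Omega> y p))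
    = lincomb sc (\<lambda>(q, p0). lincomb sc (\<lambda>(d, c). F (\<Psi> c q) (\<Omega> d p0)) (dr y)) (L.ca p)"
proof -
  note Vf = vector_space_free
  have t: "tens (UP H' P') g \<in> carrier (UP H' P')" for g by (simp add: tens_carrier[OF R.UP_fquot])
  have i: "bal2 (scD D) (scC C) (scD D) (scC C) free_scale (\<lambda>d c. tn (UP H' P') (\<Psi> c q, \<Omega> d p0))" for q p0
    by (intro bal2_bilinear bal2_lin1[OF R.tn_UP] bal2_lin2[OF R.tn_UP] lin_measure\<Omega>)
  note n = nf_lift2[OF coactD_carrier[unfolded DC_def] R.UP_fquot t i, folded DC_def]
  have o: "L.balP free_scale (\<lambda>q p0. nf (UP H' P') (lift (UP H' P') (coactD D y) (\<lambda>(d, c). tens (UP H' P') (\<Psi> c q, \<Omega> d p0))))"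
    unfolding n
  proof (intro L.balPI lin_lincomb2 Vf bal2_lin1[OF R.tn_UP] bal2_lin2[OF R.tn_UP] lin_measure\<Omega>)
    fix a q p0
    show "lincomb free_scale (\<lambda>(d, c). tn (UP H' P') (\<Psi> c (L.t a * q), \<Omega> d p0)) (dr y)
        = lincomb free_scale (\<lambda>(d, c). tn (UP H' P') (\<Psi> c q, \<Omega> d (lact P a p0))) (dr y)"
      by (rule draw_move_last[OF Vf R.tn_UP])
  qed
  have e: "lincomb sc (\<lambda>(q, p0). F q p0) (tn (UP H' P') (x, y)) = F x y" for x y
    unfolding UP_def by (rule lincomb_tn2[OF V F[unfolded UP_def]])
  show ?thesis
    unfolding coact_\<Omega> nf_lift2[OF L.coact_carrier' R.UP_fquot n(1) o, folded UP_def] n lincomb_lincomb2[OF V] e ..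
qed



section \<open>Compatibility of the measuring with cofaces, codegeneracies and the cyclic
  operator\<close>

abbreviation "om sc G y us p \<equiv> dw sc us y (\<lambda>vs d. G vs (\<Omega> d p))"

lemma multilin_\<Omega>:
  assumes G: "multilin n (scU H') (scP P') sc G"
  shows "multilin n (scU H') (scD D) sc (\<lambda>vs d. G vs (\<Omega> d p))"
  unfolding multilin_def
  using multilin_slot[OF G _ lin_id] multilin_last[OF G _ lin_\<Omega>_left] by simp

lemma draw_draw_move:
  assumes V: "vector_space sc" and G: "R.balC (Suc (Suc (length us))) sc G"
  shows "lincomb sc (\<lambda>(d, c). lincomb sc (\<lambda>(d', c'). om sc (\<lambda>vs. G (\<Psi> c (L.t a * u) # \<Psi> c' v # vs)) d' us p) (dr d)) (dr y)
    = lincomb sc (\<lambda>(d, c). lincomb sc (\<lambda>(d', c'). om sc (\<lambda>vs. G (\<Psi> c u # \<Psi> c' (L.s a * v) # vs)) d' us p) (dr d)) (dr y)"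
proof (rule draw_move[OF V])
  note ml = baln_multilin[OF G]
  fix d v w
  show "lin (scD D) sc (\<lambda>d. om sc (\<lambda>vs. G (v # w # vs)) d us p)"
    by (intro lin_draws_arg V multilin_last[OF ml] lin_\<Omega>_left) simp
  show "lin (scU H') sc (\<lambda>v. om sc (\<lambda>vs. G (v # w # vs)) d us p)"
    by (intro lin_draws_fun V multilin_hd[OF ml] lin_id) simp
  show "lin (scU H') sc (\<lambda>w. om sc (\<lambda>vs. G (v # w # vs)) d us p)"
    by (intro lin_draws_fun V multilin_hd[OF multilin_Cons[OF ml]] lin_id) simp
  show "om sc (\<lambda>vs. G (R.t b * v # w # vs)) d us p = om sc (\<lambda>vs. G (v # R.s b * w # vs)) d us p" for b
    using baln_move[OF G, of "[]"] by (intro draws_cong refl) simp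
qed

text \<open>This makes the map of cochains well defined. The relations between neighbours are
  \<open>draw_move\<close> and \<open>draw_move_last\<close>, identities that concern the whole sum
  over the legs.\<close>

lemma balC_om:
  assumes V: "vector_space sc" and "R.balC n sc G"
  shows "L.balC n sc (om sc G y)"
  using assms(2)
proof (induction n arbitrary: G y)
  case 0
  show ?case by (simp add: baln_0) (rule multilin_last[OF baln_multilin[OF 0] _ lin_\<Omega>], simp)
next
  case (Suc n)
  note ml = baln_multilin[OF Suc.prems]
  show ?case
  proof (rule baln_ConsI, unfold draws.simps)
    fix x show "L.balC n sc (\<lambda>us p. lincomb sc (\<lambda>(d, c). om sc (\<lambda>vs. G (\<Psi> c x # vs)) d us p) (dr y))"
      by (intro baln_lincomb2 V Suc.IH baln_Cons[OF Suc.prems])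
  next
    fix xs :: "'u list" and p assume "length xs = n"
    then show "lin (scU H) sc (\<lambda>x. lincomb sc (\<lambda>(d, c). om sc (\<lambda>vs. G (\<Psi> c x # vs)) d xs p) (dr y))"
      by (intro lin_lincomb2 V lin_draws_fun multilin_hd[OF ml] lin_\<Psi>) simp
  next
    fix a x x' and xs :: "'u list" and p assume l: "Suc (length xs) = n"
    show "lincomb sc (\<lambda>(d, c). lincomb sc (\<lambda>(d', c'). om sc (\<lambda>vs. G (\<Psi> c (L.t a * x) # \<Psi> c' x' # vs)) d' xs p) (dr d)) (dr y)
      = lincomb sc (\<lambda>(d, c). lincomb sc (\<lambda>(d', c'). om sc (\<lambda>vs. G (\<Psi> c x # \<Psi> c' (L.s a * x') # vs)) d' xs p) (dr d)) (dr y)"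
      by (rule draw_draw_move[OF V]) (use Suc.prems l in simp)
  next
    fix a x p assume n: "n = 0"
    show "lincomb sc (\<lambda>(d, c). G [\<Psi> c (L.t a * x)] (\<Omega> d p)) (dr y) = lincomb sc (\<lambda>(d, c). G [\<Psi> c x] (\<Omega> d (lact P a p))) (dr y)"
      by (rule draw_move_last[OF V]) (use R.balP_last[of 0 sc G "[]"] Suc.prems n in simp)
  qed
qed

lemma cof_lincomb2:
  assumes V: "vector_space sc"
  shows "L.cof sc n i (\<lambda>us p. lincomb sc (\<lambda>(a, b). F a b us p) z) us p = lincomb sc (\<lambda>(a, b). L.cof sc n i (F a b) us p) z"
  unfolding L.cof_def by (simp add: lincomb_swap2[OF V, of _ z])

text \<open>While the coface acts behind the head, the same leg is split off on both sides. Where it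
  acts, the measuring laws for \<Delta> and for the coaction apply.\<close>

lemma cof_om_Suc:
  assumes V: "vector_space sc" and "R.balC (Suc (length us)) sc G" "j \<le> length us"
  shows "dw sc us y (\<lambda>vs d. R.cof sc (length us) (Suc j) G vs (\<Omega> d p)) = L.cof sc (length us) (Suc j) (om sc G y) us p"
  using assms(2-)
proof (induction j arbitrary: us G y)
  case 0
  note G = "0.prems"(1)
  show ?case
  proof (cases us)
    case Nil
    have "R.balP sc (\<lambda>q. G ([] @ [q]))" by (rule R.balP_last) (use G Nil in simp_all)
    from sw_coact[OF V this] show ?thesis by (simp add: Nil L.cof_1_0 R.cof_1_0)
  next
    case (Cons u us')
    note G' = G[unfolded Cons list.size add_Suc_right add_0_right] and ml = baln_multilin[OF G[unfolded Cons list.size add_Suc_right add_0_right]]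
    let ?K = "\<lambda>x y d c1 c2. om sc (\<lambda>vs. G (\<Psi> c1 x # \<Psi> c2 y # vs)) d us' p"
    have "dw sc us y (\<lambda>vs d. R.cof sc (length us) (Suc 0) G vs (\<Omega> d p))
        = lincomb sc (\<lambda>(d, c). dw sc us' d (\<lambda>vs d. lincomb sc (\<lambda>(v, w). G (v # w # vs) (\<Omega> d p)) (R.dl (\<Psi> c u)))) (dr y)"
      by (simp add: Cons R.cof_1)
    also have "\<dots> = lincomb sc (\<lambda>(d, c). dw sc us' d (\<lambda>vs d. lincomb sc (\<lambda>(u1, u2). lincomb sc (\<lambda>(c1, c2).
        G (\<Psi> c1 u1 # \<Psi> c2 u2 # vs) (\<Omega> d p)) (cop c)) (L.dl u))) (dr y)"
      by (intro lincomb_cong2 refl draws_cong sw_coprod V R.balU_coproduct_slot[OF G']) simp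
    also have "\<dots> = lincomb sc (\<lambda>(d, c). lincomb sc (\<lambda>(u1, u2). lincomb sc (\<lambda>(c1, c2). ?K u1 u2 d c1 c2) (cop c)) (L.dl u)) (dr y)"
      by (simp only: draws_lincomb[OF V])
    also have "\<dots> = lincomb sc (\<lambda>(u1, u2). lincomb sc (\<lambda>(d, c). lincomb sc (\<lambda>(c1, c2). ?K u1 u2 d c1 c2) (cop c)) (dr y)) (L.dl u)"
      by (rule lincomb_swap2[OF V])
    \<comment> \<open>The two halves of \<open>c\<close> become two legs of \<open>y\<close>, as
      befits a tensor with one more factor.\<close>
    also have "\<dots> = lincomb sc (\<lambda>(u1, u2). lincomb sc (\<lambda>(d, c). lincomb sc (\<lambda>(d', c'). ?K u1 u2 d' c c') (dr d)) (dr y)) (L.dl u)"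
      by (intro lincomb_cong2 refl draw_split V lin_draws_arg lin_draws_fun multilin_last[OF ml]
          multilin_hd[OF ml] multilin_hd[OF multilin_Cons[OF ml]] lin_measure\<Omega>) simp_all
    also have "\<dots> = L.cof sc (length us) (Suc 0) (om sc G y) us p"
      by (simp add: Cons L.cof_1)
    finally show ?thesis .
  qed
next
  case (Suc j)
  then obtain u us' where us: "us = u # us'" by (cases us) auto
  note G' = Suc.prems(1)[unfolded us list.size add_Suc_right add_0_right]
  have "dw sc us y (\<lambda>vs d. R.cof sc (length us) (Suc (Suc j)) G vs (\<Omega> d p))
      = lincomb sc (\<lambda>(d, c). dw sc us' d (\<lambda>vs d. R.cof sc (length us') (Suc j) (\<lambda>ws. G (\<Psi> c u # ws)) vs (\<Omega> d p))) (dr y)"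
    by (simp add: us R.cof_Cons)
  also have "\<dots> = lincomb sc (\<lambda>(d, c). L.cof sc (length us') (Suc j) (om sc (\<lambda>ws. G (\<Psi> c u # ws)) d) us' p) (dr y)"
    by (intro lincomb_cong2 refl Suc.IH baln_Cons[OF G']) (use Suc.prems us in simp)
  also have "\<dots> = L.cof sc (length us) (Suc (Suc j)) (om sc G y) us p"
    by (simp add: us L.cof_Cons cof_lincomb2[OF V])
  finally show ?case .
qed

text \<open>For \<delta>_0 the inserted 1 uses up a leg, but \<Psi>(c)(1) is the counit of
  \<open>c\<close> times 1, and the counit law of \<open>D\<close> absorbs the leg again.\<close>

lemma cof_om:
  assumes V: "vector_space sc" and G: "R.balC (Suc (length us)) sc G" and i: "i \<le> Suc (length us)"
  shows "dw sc us y (\<lambda>vs d. R.cof sc (length us) i G vs (\<Omega> d p)) = L.cof sc (length us) i (om sc G y) us p"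
proof (cases i)
  case 0
  note ml = baln_multilin[OF G]
  have "lin (scU H') sc (\<lambda>v. om sc (\<lambda>vs. G (v # vs)) d us p)" for d
    by (intro lin_draws_fun V multilin_hd[OF ml] lin_id) simp
  from lin_scale[OF this]
  have "om sc G y (1 # us) p = lincomb sc (\<lambda>(d, c). sc (counitC C c) (om sc (\<lambda>vs. G (1 # vs)) d us p)) (dr y)"
    by (simp add: \<Psi>_one)
  also have "\<dots> = om sc (\<lambda>vs. G (1 # vs)) y us p"
    by (intro draw_counit V lin_draws_arg multilin_last[OF ml] lin_\<Omega>_left) simp
  finally show ?thesis using 0 by (simp add: L.cof_def R.cof_def)
next
  case (Suc j)
  then show ?thesis using cof_om_Suc[OF V G, of j] i by simp
qed

lemma cdg_lincomb2:
  "L.cdg n i (\<lambda>us p. lincomb sc (\<lambda>(a, b). F a b us p) z) us p = lincomb sc (\<lambda>(a, b). L.cdg n i (F a b) us p) z"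
  by (simp add: L.cdg_def)

text \<open>Since \<Psi> and \<psi> respect s and \<epsilon>, the contracted factor is a product of
  two measured elements, whose legs recombine by \<open>draw_mult\<close>. At the last position
  \<open>\<Omega>_lact\<close> takes over.\<close>

lemma cdg_om:
  assumes V: "vector_space sc" and "R.balC n sc G" "length us = Suc n" "i \<le> n"
  shows "dw sc us y (\<lambda>vs d. R.cdg n i G vs (\<Omega> d p)) = L.cdg n i (om sc G y) us p"
  using assms(2-)
proof (induction i arbitrary: n us G y)
  case 0
  note ml = baln_multilin[OF "0.prems"(1)]
  show ?case
  proof (cases n)
    case n: 0
    then obtain u where us: "us = [u]" using "0.prems" by (cases us) auto
    have l: "lin (scP P') sc (G [])" using multilin_last[OF ml _ lin_id] n by simp
    show ?thesis
      by (simp add: n us L.cdg_0_0 R.cdg_0_0 \<Omega>_lact lincomb_comp2[OF l] \<psi>_counit)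
  next
    case (Suc m)
    then obtain u w us' where us: "us = u # w # us'" using "0.prems"
      by (metis length_Suc_conv)
    have m: "length us' = m" using "0.prems" us Suc by simp
    note ml = ml[unfolded Suc]
    have "dw sc us y (\<lambda>vs d. R.cdg n 0 G vs (\<Omega> d p))
        = lincomb sc (\<lambda>(d, c). lincomb sc (\<lambda>(d', c').
            om sc (\<lambda>vs. G ((\<Psi> c (L.s (L.\<epsilon> u)) * \<Psi> c' w) # vs)) d' us' p) (dr d)) (dr y)"
      by (simp add: us Suc R.cdg_0 \<Psi>_s \<psi>_counit)
    also have "\<dots> = lincomb sc (\<lambda>(d, c). om sc (\<lambda>vs. G (\<Psi> c (L.s (L.\<epsilon> u) * w) # vs)) d us' p) (dr y)"
      by (rule draw_mult[OF V, symmetric])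
        (intro lin_draws_arg lin_draws_fun V multilin_last[OF ml] multilin_hd[OF ml] lin_id lin_\<Omega>_left; simp add: m)+
    also have "\<dots> = L.cdg n 0 (om sc G y) us p"
      by (simp add: us Suc L.cdg_0)
    finally show ?thesis .
  qed
next
  case (Suc i)
  then obtain m where m: "n = Suc m" by (cases n) auto
  then obtain u us' where us: "us = u # us'" using Suc.prems by (cases us) auto
  have "dw sc us y (\<lambda>vs d. R.cdg n (Suc i) G vs (\<Omega> d p))
      = lincomb sc (\<lambda>(d, c). dw sc us' d (\<lambda>vs d. R.cdg m i (\<lambda>ws. G (\<Psi> c u # ws)) vs (\<Omega> d p))) (dr y)"
    by (simp add: us m R.cdg_Cons)
  also have "\<dots> = lincomb sc (\<lambda>(d, c). L.cdg m i (om sc (\<lambda>ws. G (\<Psi> c u # ws)) d) us' p) (dr y)"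
    by (intro lincomb_cong2 refl Suc.IH baln_Cons[OF Suc.prems(1)[unfolded m]]) (use Suc.prems us m in simp_all)
  also have "\<dots> = L.cdg n (Suc i) (om sc G y) us p"
    by (simp add: us m L.cdg_Cons cdg_lincomb2)
  finally show ?case .
qed

text \<open>Both sides are expanded until every element of \<open>U\<close> has its own leg. They
  then differ in the order of the legs only: on the left the leg for \<open>up\<close> comes first,
  on the right it comes last, since there \<Omega> is applied to \<open>act P p0 up\<close>.\<close>

lemma cyg_om:
  assumes V: "vector_space sc" and G: "R.balC (Suc (length us)) sc G"
  shows "dw sc (u # us) y (\<lambda>vs d. R.cyg sc G vs (\<Omega> d p)) = L.cyg sc (om sc G y) (u # us) p"
proof -
  note ml = baln_multilin[OF G]
  let ?m = "length us"
  let ?cyi = "\<lambda>vs x v d w1 w2. R.cyi sc G vs x (\<Omega> d v) w1 w2"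
  have "dw sc (u # us) y (\<lambda>vs d. R.cyg sc G vs (\<Omega> d p))
      = lincomb sc (\<lambda>(d, c). dw sc us d (\<lambda>vs d. lincomb sc (\<lambda>(q, p0). lincomb sc (\<lambda>(up, um).
          R.cyi sc G vs q p0 up um) (R.tr (\<Psi> c u))) (R.ca (\<Omega> d p)))) (dr y)"
    by (simp add: R.cyg_def)
  \<comment> \<open>The coaction of \<Omega> provides the leg \<open>e\<close> for \<open>q\<close>,
    and the translation map of \<Psi>(c)(u) splits \<open>c\<close> into \<open>c1\<close> for
    \<open>up\<close> and \<open>c2\<close> for \<open>um\<close>.\<close>
  also have "\<dots> = lincomb sc (\<lambda>(d, c). dw sc us d (\<lambda>vs d. lincomb sc (\<lambda>(q, p0). lincomb sc (\<lambda>(d', e).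
          lincomb sc (\<lambda>(up, um). lincomb sc (\<lambda>(c1, c2). ?cyi vs (\<Psi> e q) p0 d' (\<Psi> c1 up) (\<Psi> c2 um)) (cop c)) (L.tr u)) (dr d)) (L.ca p))) (dr y)"
  proof (intro lincomb_cong2 refl draws_cong)
    fix d c and vs :: "'v list" and d' assume l: "length vs = length us"
    have G': "R.balC (Suc (length vs)) sc G" using G l by simp
    show "lincomb sc (\<lambda>(q, p0). lincomb sc (\<lambda>(up, um). R.cyi sc G vs q p0 up um) (R.tr (\<Psi> c u))) (R.ca (\<Omega> d' p))
      = lincomb sc (\<lambda>(q, p0). lincomb sc (\<lambda>(d', e). lincomb sc (\<lambda>(up, um). lincomb sc (\<lambda>(c1, c2).
          ?cyi vs (\<Psi> e q) p0 d' (\<Psi> c1 up) (\<Psi> c2 um)) (cop c)) (L.tr u)) (dr d')) (L.ca p)"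
      by (subst sw_coact[OF V R.balP_cyi[OF V G']]) (simp only: sw_translation[OF V R.balop_cyi[OF V G']])
  qed
  \<comment> \<open>The sums over \<open>p\<close> and \<open>u\<close> do not involve the legs.
    Once they are outside, the two sides can be compared for fixed \<open>q\<close>,
    \<open>p0\<close>, \<open>up\<close>, \<open>um\<close>.\<close>
  also have "\<dots> = lincomb sc (\<lambda>(q, p0). lincomb sc (\<lambda>(up, um). lincomb sc (\<lambda>(d, c). lincomb sc (\<lambda>(c1, c2).
      dw sc us d (\<lambda>vs d. lincomb sc (\<lambda>(d', e). ?cyi vs (\<Psi> e q) p0 d' (\<Psi> c1 up) (\<Psi> c2 um)) (dr d))) (cop c)) (dr y)) (L.tr u)) (L.ca p)"
  proof -
    have "lincomb sc (\<lambda>(d', e). lincomb sc (\<lambda>(up, um). lincomb sc (\<lambda>(c1, c2). ?cyi vs (\<Psi> e q) p0 d' (\<Psi> c1 up) (\<Psi> c2 um)) (cop c)) (L.tr u)) (dr d)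
      = lincomb sc (\<lambda>(up, um). lincomb sc (\<lambda>(c1, c2). lincomb sc (\<lambda>(d', e). ?cyi vs (\<Psi> e q) p0 d' (\<Psi> c1 up) (\<Psi> c2 um)) (dr d)) (cop c)) (L.tr u)"
      for q p0 c d vs
      by (subst lincomb_swap2[OF V]) (intro lincomb_cong2 refl lincomb_swap2[OF V])
    then show ?thesis
      by (simp only: draws_lincomb[OF V])
        (subst lincomb_swap2[OF V], intro lincomb_cong2 refl lincomb_swap2[OF V])
  qed
  also have "\<dots> = lincomb sc (\<lambda>(q, p0). lincomb sc (\<lambda>(up, um). L.cyi sc (om sc G y) us q p0 up um) (L.tr u)) (L.ca p)"
  proof (intro lincomb_cong2 refl)
    fix q p0 up um
    \<comment> \<open>\<open>?X\<close> is what remains to be summed once the legs of the coproduct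
      of \<open>um\<close> have values \<open>ws\<close> and \<open>w\<close>: the legs for
      \<open>us\<close>, for \<open>q\<close> and the rest of \<open>y\<close>.\<close>
    let ?X = "\<lambda>d1 c1 ws w. dw sc us d1 (\<lambda>vs d. lincomb sc (\<lambda>(d', e).
        G (map2 (*) ws vs @ [w * \<Psi> e q]) (act P' (\<Omega> d' p0) (\<Psi> c1 up))) (dr d))"
    have Xd: "lin (scD D) sc (\<lambda>d1. ?X d1 c1 ws w)" for c1 ws w
      by (intro lin_draws_arg V lin_lincomb_arg lin_dr)
    have Xb: "R.balUn ?m sc (\<lambda>ws w. ?X d1 c1 ws w)" for d1 c1
    proof (intro baln_draws V baln_lincomb2)
      fix vs :: "'v list" and d d' e assume l: "length vs = ?m"
      show "R.balUn ?m sc (\<lambda>ws w. G (map2 (*) ws vs @ [w * \<Psi> e q]) (act P' (\<Omega> d' p0) (\<Psi> c1 up)))"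
        using R.balUn_map2_mult[of vs sc G] G l by simp
    qed
    have "lincomb sc (\<lambda>(d, c). lincomb sc (\<lambda>(c1, c2).
        dw sc us d (\<lambda>vs d. lincomb sc (\<lambda>(d', e). ?cyi vs (\<Psi> e q) p0 d' (\<Psi> c1 up) (\<Psi> c2 um)) (dr d))) (cop c)) (dr y)
      = lincomb sc (\<lambda>(d, c). lincomb sc (\<lambda>(c1, c2). R.ic sc ?m (\<Psi> c2 um) (\<lambda>ws w. ?X d c1 ws w)) (cop c)) (dr y)"
    proof (intro lincomb_cong2 refl)
      fix d c c1 c2
      have "dw sc us d (\<lambda>vs d. lincomb sc (\<lambda>(d', e). ?cyi vs (\<Psi> e q) p0 d' (\<Psi> c1 up) (\<Psi> c2 um)) (dr d))
        = dw sc us d (\<lambda>vs d. R.ic sc ?m (\<Psi> c2 um) (\<lambda>ws w. lincomb sc (\<lambda>(d', e).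
            G (map2 (*) ws vs @ [w * \<Psi> e q]) (act P' (\<Omega> d' p0) (\<Psi> c1 up))) (dr d)))"
        by (intro draws_cong refl) (simp only: R.cyi_def icop_lincomb[OF V])
      then show "dw sc us d (\<lambda>vs d. lincomb sc (\<lambda>(d', e). ?cyi vs (\<Psi> e q) p0 d' (\<Psi> c1 up) (\<Psi> c2 um)) (dr d))
        = R.ic sc ?m (\<Psi> c2 um) (\<lambda>ws w. ?X d c1 ws w)"
        by (simp only: draws_icop[OF V])
    qed
    \<comment> \<open>With \<open>c1\<close> and \<open>c2\<close> separated, \<open>c2\<close>
      alone can be distributed over the factors of the coproduct of \<open>um\<close>.\<close>
    also have "\<dots> = lincomb sc (\<lambda>(d, c1). lincomb sc (\<lambda>(d1, c2). R.ic sc ?m (\<Psi> c2 um) (\<lambda>ws w. ?X d1 c1 ws w)) (dr d)) (dr y)"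
      by (intro draw_split V lin_icop_fun Xd lin_draws_fun lin_lincomb2 lin_compose[OF lin_\<Psi>_left R.lin_icop[OF V Xb]]
          multilin_last[OF ml] lin_compose[OF _ R.lin_act_right] lin_measure\<Omega>) simp
    also have "\<dots> = lincomb sc (\<lambda>(d, c1). L.ic sc ?m um (\<lambda>vs v. lincomb sc (\<lambda>(d1, c2). dw sc vs d1 (\<lambda>ws d2. ?X d2 c1 ws (\<Psi> c2 v))) (dr d))) (dr y)"
      by (intro lincomb_cong2 refl icop_measure V Xb Xd)
    also have "\<dots> = L.ic sc ?m um (\<lambda>vs v. lincomb sc (\<lambda>(d, c1). lincomb sc (\<lambda>(d1, c2). dw sc vs d1 (\<lambda>ws d2. ?X d2 c1 ws (\<Psi> c2 v))) (dr d)) (dr y))"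
      by (simp only: icop_lincomb[OF V])
    also have "\<dots> = L.ic sc ?m um (\<lambda>vs v. om sc G y (map2 (*) vs us @ [v * q]) (act P p0 up))"
    proof (rule icop_cong)
      fix vs :: "'u list" and v assume l: "length vs = ?m"
      let ?zs = "map2 (*) vs us"
      have lz: "length ?zs = ?m" using l by simp
      let ?K = "\<lambda>c1 ws d3 c2. lincomb sc (\<lambda>(d', e). G (ws @ [\<Psi> c2 v * \<Psi> e q]) (act P' (\<Omega> d' p0) (\<Psi> c1 up))) (dr d3)"
      have mK: "multilin ?m (scU H') (scD D) sc (\<lambda>ws d3. ?K c1 ws d3 c2)" for c1 c2
        unfolding multilin_def
        by (intro conjI allI impI lin_lincomb_arg V lin_dr lin_lincomb2 multilin_slot[OF multilin_snoc[OF ml] _ lin_id])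
      have "lincomb sc (\<lambda>(d1, c2). dw sc vs d1 (\<lambda>ws d2. ?X d2 c1 ws (\<Psi> c2 v))) (dr d)
          = dw sc (?zs @ [v * q]) d (\<lambda>ws d'. G ws (act P' (\<Omega> d' p0) (\<Psi> c1 up)))" for d c1
      proof -
        have "lincomb sc (\<lambda>(d1, c2). dw sc vs d1 (\<lambda>ws d2. ?X d2 c1 ws (\<Psi> c2 v))) (dr d)
          = lincomb sc (\<lambda>(d1, c2). dw sc ?zs d1 (\<lambda>ws d3. ?K c1 ws d3 c2)) (dr d)"
          by (intro lincomb_cong2 refl draws_map2_mult[OF V l mK, symmetric])
        \<comment> \<open>The leg of \<open>v\<close> is moved behind the legs of the products,
          where it meets the leg of \<open>q\<close> and merges with it into the leg of
          \<open>v * q\<close>.\<close>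
        also have "\<dots> = dw sc ?zs d (\<lambda>ws d1. lincomb sc (\<lambda>(d3, c2). ?K c1 ws d3 c2) (dr d1))"
        proof (rule draws_draw_swap[OF V lin_\<Psi>_left, symmetric], unfold lz)
          fix ws :: "'v list" and d3 assume "length ws = ?m"
          then show "lin (scC C) sc (?K c1 ws d3)"
            by (intro lin_lincomb2 V multilin_snoc_slot[OF ml] lin_measure\<Omega>)
        qed (rule mK)
        also have "\<dots> = dw sc ?zs d (\<lambda>ws d1. lincomb sc (\<lambda>(d', c). G (ws @ [\<Psi> c (v * q)]) (act P' (\<Omega> d' p0) (\<Psi> c1 up))) (dr d1))"
        proof (intro draws_cong refl draw_mult[OF V, symmetric], unfold lz)
          fix ws :: "'v list" and w assume "length ws = ?m"
          then show "lin (scD D) sc (\<lambda>d. G (ws @ [w]) (act P' (\<Omega> d p0) (\<Psi> c1 up)))"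
            by (intro multilin_last[OF ml] lin_compose[OF _ R.lin_act] lin_measure\<Omega>) simp
        next
          fix ws :: "'v list" and d assume "length ws = ?m"
          then show "lin (scU H') sc (\<lambda>w. G (ws @ [w]) (act P' (\<Omega> d p0) (\<Psi> c1 up)))"
            by (intro multilin_snoc_slot[OF ml] lin_id)
        qed
        finally show ?thesis by (simp add: draws_append)
      qed
      \<comment> \<open>Here \<Omega> splits off the leg of \<open>up\<close> after all others, and
        it is moved to the front.\<close>
      moreover have "om sc G y (?zs @ [v * q]) (act P p0 up)
        = lincomb sc (\<lambda>(d, c1). dw sc (?zs @ [v * q]) d (\<lambda>ws d'. G ws (act P' (\<Omega> d' p0) (\<Psi> c1 up)))) (dr y)"
      proof -
        have "om sc G y (?zs @ [v * q]) (act P p0 up)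
          = dw sc (?zs @ [v * q]) y (\<lambda>ws d. lincomb sc (\<lambda>(d', c1). G ws (act P' (\<Omega> d' p0) (\<Psi> c1 up))) (dr d))"
          unfolding \<Omega>_act
          by (intro draws_cong refl lincomb_comp2 multilin_last[OF ml _ lin_id]) (simp add: l)
        also have "\<dots> = lincomb sc (\<lambda>(d, c1). dw sc (?zs @ [v * q]) d (\<lambda>ws d'. G ws (act P' (\<Omega> d' p0) (\<Psi> c1 up)))) (dr y)"
        proof (rule draws_draw_swap[OF V lin_\<Psi>_left])
          have n: "length (?zs @ [v * q]) = Suc ?m" by (simp add: l)
          show "multilin (length (?zs @ [v * q])) (scU H') (scD D) sc (\<lambda>ws d'. G ws (act P' (\<Omega> d' p0) (\<Psi> c1 up)))" for c1
            unfolding n multilin_def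
            by (intro conjI allI impI multilin_slot[OF ml _ lin_id] multilin_last[OF ml] lin_compose[OF _ R.lin_act] lin_measure\<Omega>)
          show "lin (scC C) sc (\<lambda>c1. G ws (act P' (\<Omega> d' p0) (\<Psi> c1 up)))" if "length ws = length (?zs @ [v * q])" for ws d'
            using that unfolding n by (intro multilin_last[OF ml] lin_compose[OF _ R.lin_act_right] lin_measure\<Omega>)
        qed
        finally show ?thesis .
      qed
      ultimately show "lincomb sc (\<lambda>(d, c1). lincomb sc (\<lambda>(d1, c2). dw sc vs d1 (\<lambda>ws d2. ?X d2 c1 ws (\<Psi> c2 v))) (dr d)) (dr y)
        = om sc G y (?zs @ [v * q]) (act P p0 up)" by simp
    qed
    finally show "lincomb sc (\<lambda>(d, c). lincomb sc (\<lambda>(c1, c2).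
        dw sc us d (\<lambda>vs d. lincomb sc (\<lambda>(d', e). ?cyi vs (\<Psi> e q) p0 d' (\<Psi> c1 up) (\<Psi> c2 um)) (dr d))) (cop c)) (dr y)
      = L.cyi sc (om sc G y) us q p0 up um" by (simp add: L.cyi_def)
  qed
  also have "\<dots> = L.cyg sc (om sc G y) (u # us) p" by (simp add: L.cyg_def)
  finally show ?thesis .
qed

end

section \<open>Induced maps on cohomology\<close>

lemma k_linear_closed: "k_linear M N f \<Longrightarrow> x \<in> carrier M \<Longrightarrow> f x \<in> carrier N"
  and k_linear_add: "k_linear M N f \<Longrightarrow> x \<in> carrier M \<Longrightarrow> y \<in> carrier M \<Longrightarrow> f (x \<oplus>\<^bsub>M\<^esub> y) = f x \<oplus>\<^bsub>N\<^esub> f y"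
  and k_linear_smult: "k_linear M N f \<Longrightarrow> x \<in> carrier M \<Longrightarrow> f (c \<odot>\<^bsub>M\<^esub> x) = c \<odot>\<^bsub>N\<^esub> f x"
  by (auto simp: k_linear_def)

lemma k_linear_zero:
  assumes "vsp M" "vsp N" "k_linear M N f"
  shows "f \<zero>\<^bsub>M\<^esub> = \<zero>\<^bsub>N\<^esub>"
proof -
  interpret M: vsp M by (rule assms)
  interpret N: vsp N by (rule assms)
  show ?thesis
    using k_linear_smult[OF assms(3) M.zero_closed, of 0] k_linear_closed[OF assms(3) M.zero_closed]
    by (simp add: M.smult_zero_left N.smult_zero_left)
qed

lemma k_linear_finsum:
  assumes "vsp M" "vsp N" and f: "k_linear M N f" and A: "finite A" "\<And>i. i \<in> A \<Longrightarrow> g i \<in> carrier M"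
  shows "f (finsum M g A) = finsum N (\<lambda>i. f (g i)) A"
proof -
  interpret M: vsp M by (rule assms)
  interpret N: vsp N by (rule assms)
  show ?thesis using A
    by (induction A rule: finite_induct)
      (auto simp: k_linear_zero[OF assms(1-3)] k_linear_add[OF f] k_linear_closed[OF f] Pi_def)
qed

lemma k_linear_comp: "k_linear M N f \<Longrightarrow> k_linear N L g \<Longrightarrow> k_linear M L (\<lambda>x. g (f x))"
  by (auto simp: k_linear_def Pi_def)

lemma k_linear_ident: "k_linear M M (\<lambda>x. x)"
  by (auto simp: k_linear_def)

lemma k_linear_funpow: "k_linear M M f \<Longrightarrow> k_linear M M (\<lambda>x. (f ^^ i) x)"
  by (induction i) (auto simp: k_linear_def Pi_def)

lemma k_linear_cong:
  assumes "vsp M" "k_linear M N f" "\<And>x. x \<in> carrier M \<Longrightarrow> f x = g x"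
  shows "k_linear M N g"
proof -
  interpret vsp M by (rule assms)
  show ?thesis using assms(2,3) by (auto simp: k_linear_def Pi_def smult_closed)
qed

context
  fixes M :: "('k::field, 'v) module" and N :: "('k, 'w) module"
  assumes N: "vsp N"
begin

interpretation N: vsp N by (rule N)

lemma k_linear_const_zero: "k_linear M N (\<lambda>x. \<zero>\<^bsub>N\<^esub>)"
  by (auto simp: k_linear_def N.smult_zero_right)

lemma k_linear_plus: "k_linear M N f \<Longrightarrow> k_linear M N g \<Longrightarrow> k_linear M N (\<lambda>x. f x \<oplus>\<^bsub>N\<^esub> g x)"
  by (auto simp: k_linear_def Pi_def N.smult_r_distr N.a_ac)

lemma k_linear_scaled: "k_linear M N f \<Longrightarrow> k_linear M N (\<lambda>x. c \<odot>\<^bsub>N\<^esub> f x)"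
  by (auto simp: k_linear_def Pi_def N.smult_closed N.smult_r_distr N.smult_assoc[symmetric] mult.commute)

lemma k_linear_sum:
  assumes M: "vsp M" and A: "finite A" "\<And>i. i \<in> A \<Longrightarrow> k_linear M N (f i)"
  shows "k_linear M N (\<lambda>x. \<Oplus>\<^bsub>N\<^esub>i\<in>A. f i x)"
  using A
proof (induction A rule: finite_induct)
  case (insert i A)
  have "k_linear M N (\<lambda>x. f i x \<oplus>\<^bsub>N\<^esub> (\<Oplus>\<^bsub>N\<^esub>j\<in>A. f j x))"
    using insert by (intro k_linear_plus) auto
  moreover have "f i x \<oplus>\<^bsub>N\<^esub> (\<Oplus>\<^bsub>N\<^esub>j\<in>A. f j x) = (\<Oplus>\<^bsub>N\<^esub>j\<in>insert i A. f j x)" if "x \<in> carrier M" for x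
    using insert that by (subst N.finsum_insert) (auto intro: k_linear_closed)
  ultimately show ?case by (rule k_linear_cong[OF M])
qed (simp add: k_linear_const_zero)

end

lemma subsp_image:
  assumes M: "vsp M" and N: "vsp N" and f: "k_linear M N f"
  shows "subsp N (f ` carrier M)"
proof -
  interpret M: vsp M by (rule M)
  show ?thesis
    unfolding subsp_def
    using k_linear_zero[OF M N f, symmetric] k_linear_closed[OF f]
    by (auto simp: k_linear_add[OF f, symmetric] k_linear_smult[OF f, symmetric] M.smult_closed)
qed

lemma subsp_kernel:
  assumes M: "vsp M" and N: "vsp N" and f: "k_linear M N f"
  shows "subsp M {x \<in> carrier M. f x = \<zero>\<^bsub>N\<^esub>}"
proof -
  interpret M: vsp M by (rule M)
  interpret N: vsp N by (rule N)
  show ?thesis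
    unfolding subsp_def
    by (auto simp: k_linear_zero[OF M N f] k_linear_add[OF f] k_linear_smult[OF f] M.smult_closed N.smult_zero_right)
qed

lemma subsp_coboundaries:
  assumes X: "\<And>n. vsp (X n)" and d: "\<And>n. k_linear (X n) (X (Suc n)) (d n)"
  shows "subsp (X n) (coboundaries X d n)"
proof (cases n)
  case 0
  interpret vsp "X 0" by (rule X)
  show ?thesis using 0 by (simp add: coboundaries_def subsp_def smult_zero_right)
next
  case (Suc m)
  then show ?thesis using subsp_image[OF X X d] by (simp add: coboundaries_def)
qed

text \<open>\<open>F\<close> picks some cocycle in each class. The choice is immaterial
  (\<open>indep\<close>) because \<open>f\<close>, commuting with the differentials, sends
  coboundaries to coboundaries.\<close>

lemma induces_on_cohomologyI:
  assumes X: "\<And>n. vsp (X n)" and Y: "\<And>n. vsp (Y n)"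
    and d: "\<And>n. k_linear (X n) (X (Suc n)) (d n)" and e: "\<And>n. k_linear (Y n) (Y (Suc n)) (e n)"
    and f: "\<And>n. k_linear (X n) (Y n) (f n)"
    and comm: "\<And>n x. x \<in> carrier (X n) \<Longrightarrow> f (Suc n) (d n x) = e n (f n x)"
  shows "induces_on_cohomology X d Y e f"
  unfolding induces_on_cohomology_def
proof
  fix n
  interpret X: vsp "X n" by (rule X)
  interpret Y: vsp "Y n" by (rule Y)
  let ?Z = "cocycles X d n" and ?W = "coboundaries X d n" and ?Z' = "cocycles Y e n" and ?W' = "coboundaries Y e n"
  let ?cl = "cohomology_class X d n" and ?cl' = "cohomology_class Y e n"
  have Z: "subsp (X n) ?Z" unfolding cocycles_def by (rule subsp_kernel[OF X X d])
  have Z': "subsp (Y n) ?Z'" unfolding cocycles_def by (rule subsp_kernel[OF Y Y e])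
  have W: "subsp (X n) ?W" and W': "subsp (Y n) ?W'"
    by (rule subsp_coboundaries, rule X, rule d, rule subsp_coboundaries, rule Y, rule e)
  have fZ: "f n z \<in> ?Z'" if "z \<in> ?Z" for z
    using that k_linear_closed[OF f] comm[of z n] k_linear_zero[OF X Y f, of "Suc n"] by (auto simp: cocycles_def)
  have fW: "f n w \<in> ?W'" if "w \<in> ?W" for w
    using that k_linear_zero[OF X Y f] k_linear_closed[OF f] comm
    by (auto simp: coboundaries_def split: nat.splits)
  have ZX: "z \<in> carrier (X n)" if "z \<in> ?Z" for z using that by (simp add: cocycles_def)
  have ZY: "z \<in> carrier (Y n)" if "z \<in> ?Z'" for z using that by (simp add: cocycles_def)
  have WX: "w \<in> carrier (X n)" if "w \<in> ?W" for w using that W by (auto simp: subsp_def)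
  have indep: "?cl' (f n z) = ?cl' (f n z')" if "z \<in> ?Z" "z' \<in> ?Z" "?cl z = ?cl z'" for z z'
  proof -
    have "z \<in> ?cl z'" using X.mem_coset_self[OF W ZX[OF that(1)]] that(3) by (simp add: cohomology_class_def)
    then obtain w where w: "w \<in> ?W" "z = w \<oplus>\<^bsub>X n\<^esub> z'" by (auto simp: cohomology_class_def X.coset_eq)
    then have "f n z = f n w \<oplus>\<^bsub>Y n\<^esub> f n z'" using k_linear_add[OF f] WX ZX that by simp
    then show ?thesis
      using Y.coset_eqI[OF W' fW[OF w(1)] ZY[OF fZ[OF that(2)]]] by (simp add: cohomology_class_def)
  qed
  define F where "F A = ?cl' (f n (SOME z. z \<in> ?Z \<and> ?cl z = A))" for A
  have F: "F (?cl z) = ?cl' (f n z)" if z: "z \<in> ?Z" for z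
  proof -
    have "(SOME z'. z' \<in> ?Z \<and> ?cl z' = ?cl z) \<in> ?Z \<and> ?cl (SOME z'. z' \<in> ?Z \<and> ?cl z' = ?cl z) = ?cl z"
      by (rule someI[of _ z]) (simp add: z)
    then show ?thesis unfolding F_def by (intro indep) (simp_all add: z)
  qed
  have "k_linear (cohomology X d n) (cohomology Y e n) F"
    unfolding k_linear_def
  proof (intro conjI ballI allI)
    show "F \<in> carrier (cohomology X d n) \<rightarrow> carrier (cohomology Y e n)"
      using F fZ by (auto simp: cohomology_def X.quotient_carrier Y.quotient_carrier cohomology_class_def)
  next
    fix A B assume "A \<in> carrier (cohomology X d n)" "B \<in> carrier (cohomology X d n)"
    then obtain a b where a: "a \<in> ?Z" "A = ?cl a" and b: "b \<in> ?Z" "B = ?cl b"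
      by (auto simp: cohomology_def X.quotient_carrier cohomology_class_def)
    have "A \<oplus>\<^bsub>cohomology X d n\<^esub> B = ?cl (a \<oplus>\<^bsub>X n\<^esub> b)"
      using a b ZX by (simp add: cohomology_def cohomology_class_def X.quotient_add[OF W])
    moreover have "a \<oplus>\<^bsub>X n\<^esub> b \<in> ?Z" using Z a b by (simp add: subsp_def)
    moreover have "F A \<oplus>\<^bsub>cohomology Y e n\<^esub> F B = ?cl' (f n a \<oplus>\<^bsub>Y n\<^esub> f n b)"
      using a b fZ ZY F by (simp add: cohomology_def cohomology_class_def Y.quotient_add[OF W'])
    ultimately show "F (A \<oplus>\<^bsub>cohomology X d n\<^esub> B) = F A \<oplus>\<^bsub>cohomology Y e n\<^esub> F B"
      using F a b ZX by (simp add: k_linear_add[OF f])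
  next
    fix c A assume "A \<in> carrier (cohomology X d n)"
    then obtain a where a: "a \<in> ?Z" "A = ?cl a"
      by (auto simp: cohomology_def X.quotient_carrier cohomology_class_def)
    have "c \<odot>\<^bsub>cohomology X d n\<^esub> A = ?cl (c \<odot>\<^bsub>X n\<^esub> a)"
      using a ZX by (simp add: cohomology_def cohomology_class_def X.quotient_smult[OF W])
    moreover have "c \<odot>\<^bsub>X n\<^esub> a \<in> ?Z" using Z a by (simp add: subsp_def)
    moreover have "c \<odot>\<^bsub>cohomology Y e n\<^esub> F A = ?cl' (c \<odot>\<^bsub>Y n\<^esub> f n a)"
      using a fZ ZY F by (simp add: cohomology_def cohomology_class_def Y.quotient_smult[OF W'])
    ultimately show "F (c \<odot>\<^bsub>cohomology X d n\<^esub> A) = c \<odot>\<^bsub>cohomology Y e n\<^esub> F A"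
      using F a ZX by (simp add: k_linear_smult[OF f])
  qed
  then show "\<exists>F. k_linear (cohomology X d n) (cohomology Y e n) F
      \<and> (\<forall>z\<in>cocycles X d n. f n z \<in> cocycles Y e n \<and> F (cohomology_class X d n z) = cohomology_class Y e n (f n z))"
    using F fZ by blast
qed

text \<open>\<open>cocyclic_morphism\<close> speaks about the morphism only; this records the
  linearity of the operators themselves, from which that of the differentials follows.\<close>

definition linear_cocyclic :: "('k::field, 'v) cocyclic \<Rightarrow> bool" where
  "linear_cocyclic M \<longleftrightarrow> (\<forall>n. vsp (level M n))
     \<and> (\<forall>n i. i \<le> Suc n \<longrightarrow> k_linear (level M n) (level M (Suc n)) (coface M n i))
     \<and> (\<forall>n. k_linear (level M n) (level M n) (cyc M n))"

context
  fixes M :: "('k::field, 'v) cocyclic"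
  assumes M: "linear_cocyclic M"
begin

lemma vsp_level: "vsp (level M n)"
  and linear_coface: "i \<le> Suc n \<Longrightarrow> k_linear (level M n) (level M (Suc n)) (coface M n i)"
  and linear_cyc: "k_linear (level M n) (level M n) (cyc M n)"
  using M by (simp_all add: linear_cocyclic_def)

lemma linear_hoch_d: "k_linear (level M n) (level M (Suc n)) (hoch_d M n)"
  unfolding hoch_d_def by (intro k_linear_sum k_linear_scaled vsp_level linear_coface) simp_all

lemma linear_hoch_d': "k_linear (level M n) (level M (Suc n)) (hoch_d' M n)"
  unfolding hoch_d'_def by (intro k_linear_sum k_linear_scaled vsp_level linear_coface) simp_all

lemma linear_signed_cyc: "k_linear (level M n) (level M n) (signed_cyc M n)"
  unfolding signed_cyc_def by (intro k_linear_scaled vsp_level linear_cyc)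

lemma linear_cyc_vert: "k_linear (level M n) (level M (Suc n)) (cyc_vert M p n)"
  unfolding cyc_vert_def
  by (cases "even p") (simp_all add: linear_hoch_d k_linear_scaled vsp_level linear_hoch_d')

lemma linear_cyc_horiz: "k_linear (level M n) (level M n) (cyc_horiz M p n)"
proof (cases "even p")
  case True
  then show ?thesis unfolding cyc_horiz_def
    by simp (intro k_linear_plus k_linear_scaled k_linear_ident vsp_level linear_signed_cyc)
next
  case False
  then show ?thesis unfolding cyc_horiz_def
    by simp (intro k_linear_sum k_linear_funpow vsp_level linear_signed_cyc; simp)
qed

lemma vsp_cyc_tot: "vsp (cyc_tot M n)"
proof -
  have L: "vsp (level M q)" for q by (rule vsp_level)
  have lev: "abelian_group (level M q)" for q using L vsp.axioms(1) by blast
  note g = abelian_groupE[OF lev]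
  have mem: "x q \<in> carrier (level M q)" if "x \<in> (\<Pi>\<^sub>E q\<in>{..n}. carrier (level M q))" "q \<le> n" for x q
    using that by (auto simp: PiE_mem)
  have "abelian_group (cyc_tot M n)"
  proof (rule abelian_groupI)
    fix x assume x: "x \<in> carrier (cyc_tot M n)"
    then have xq: "x q \<in> carrier (level M q)" if "q \<le> n" for q
      using mem that by (simp add: cyc_tot_def)
    show "\<exists>y\<in>carrier (cyc_tot M n). y \<oplus>\<^bsub>cyc_tot M n\<^esub> x = \<zero>\<^bsub>cyc_tot M n\<^esub>"
      by (intro bexI[of _ "\<lambda>q\<in>{..n}. \<ominus>\<^bsub>level M q\<^esub> x q"])
        (auto simp: cyc_tot_def xq abelian_group.l_neg[OF lev] abelian_group.a_inv_closed[OF lev] intro!: restrict_ext)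
    show "\<zero>\<^bsub>cyc_tot M n\<^esub> \<oplus>\<^bsub>cyc_tot M n\<^esub> x = x"
      using x xq by (auto simp: cyc_tot_def g(1,2,5) intro!: PiE_ext[of _ "{..n}" "\<lambda>q. carrier (level M q)"])
  qed (auto simp: cyc_tot_def mem g(1,2,3) intro!: restrict_ext g(4))
  moreover have "1 \<odot>\<^bsub>cyc_tot M n\<^esub> x = x" if "x \<in> carrier (cyc_tot M n)" for x
    using that mem
    by (auto simp: cyc_tot_def vsp.smult_one[OF L] intro!: PiE_ext[of _ "{..n}" "\<lambda>q. carrier (level M q)"])
  ultimately show ?thesis
    by (intro vsp.intro vsp_axioms.intro)
      (auto simp: cyc_tot_def mem vsp.smult_closed[OF L] vsp.smult_l_distr[OF L] vsp.smult_r_distr[OF L]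
        vsp.smult_assoc[OF L] intro!: restrict_ext)
qed

lemma linear_cyc_tot_proj: "q \<le> n \<Longrightarrow> k_linear (cyc_tot M n) (level M q) (\<lambda>x. x q)"
  by (auto simp: k_linear_def cyc_tot_def PiE_mem)

text \<open>Together with the linear projections, this reduces linearity into the total complex to
  its components.\<close>

lemma linear_cyc_tot_tuple:
  assumes "\<And>q. q \<le> n \<Longrightarrow> k_linear N (level M q) (g q)"
  shows "k_linear N (cyc_tot M n) (\<lambda>x. \<lambda>q\<in>{..n}. g q x)"
  using assms by (auto simp: k_linear_def cyc_tot_def Pi_def intro!: restrict_ext)

lemma linear_cyc_tot_d: "k_linear (cyc_tot M n) (cyc_tot M (Suc n)) (cyc_tot_d M n)"
  unfolding cyc_tot_d_def
proof (rule linear_cyc_tot_tuple, rule k_linear_plus[OF vsp_level])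
  fix q assume q: "q \<le> Suc n"
  show "k_linear (cyc_tot M n) (level M q) (\<lambda>x. if q = 0 then \<zero>\<^bsub>level M q\<^esub> else cyc_vert M (Suc n - q) (q - 1) (x (q - 1)))"
  proof (cases q)
    case (Suc q')
    then show ?thesis
      using k_linear_comp[OF linear_cyc_tot_proj linear_cyc_vert, of q' n "n - q'"] q by simp
  qed (simp add: k_linear_const_zero vsp_level)
  show "k_linear (cyc_tot M n) (level M q) (\<lambda>x. if q = Suc n then \<zero>\<^bsub>level M q\<^esub> else cyc_horiz M (n - q) q (x q))"
    using k_linear_comp[OF linear_cyc_tot_proj linear_cyc_horiz, of q n "n - q"] q
    by (cases "q = Suc n") (simp_all add: k_linear_const_zero vsp_level)
qed

end

section \<open>Morphisms of cocyclic modules and the differentials\<close>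

context
  fixes M :: "('k::field, 'v) cocyclic" and N :: "('k, 'w) cocyclic" and f :: "nat \<Rightarrow> 'v \<Rightarrow> 'w"
  assumes M: "linear_cocyclic M" and N: "linear_cocyclic N" and f: "cocyclic_morphism M N f"
begin

lemma mor_linear: "k_linear (level M n) (level N n) (f n)"
  and mor_coface: "i \<le> Suc n \<Longrightarrow> x \<in> carrier (level M n) \<Longrightarrow> f (Suc n) (coface M n i x) = coface N n i (f n x)"
  and mor_cyc: "x \<in> carrier (level M n) \<Longrightarrow> f n (cyc M n x) = cyc N n (f n x)"
  using f by (simp_all add: cocyclic_morphism_def)

lemmas mor_closed = k_linear_closed[OF mor_linear]
lemmas vM = vsp_level[OF M] and vN = vsp_level[OF N]

text \<open>The index set is left open so that one argument serves both b, with all cofaces, and b',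
  without the last.\<close>

lemma mor_signed_sum:
  assumes x: "x \<in> carrier (level M n)" and A: "finite A" "A \<subseteq> {..Suc n}"
  shows "f (Suc n) (\<Oplus>\<^bsub>level M (Suc n)\<^esub>i\<in>A. (- 1) ^ i \<odot>\<^bsub>level M (Suc n)\<^esub> coface M n i x)
    = (\<Oplus>\<^bsub>level N (Suc n)\<^esub>i\<in>A. (- 1) ^ i \<odot>\<^bsub>level N (Suc n)\<^esub> coface N n i (f n x))"
proof -
  interpret N: vsp "level N (Suc n)" by (rule vN)
  have c: "coface M n i x \<in> carrier (level M (Suc n))" if "i \<in> A" for i
    using k_linear_closed[OF linear_coface[OF M] x] that A by auto
  have "f (Suc n) (\<Oplus>\<^bsub>level M (Suc n)\<^esub>i\<in>A. (- 1) ^ i \<odot>\<^bsub>level M (Suc n)\<^esub> coface M n i x)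
    = (\<Oplus>\<^bsub>level N (Suc n)\<^esub>i\<in>A. f (Suc n) ((- 1) ^ i \<odot>\<^bsub>level M (Suc n)\<^esub> coface M n i x))"
    by (intro k_linear_finsum[OF vM vN mor_linear] A vsp.smult_closed[OF vM] c)
  also have "\<dots> = (\<Oplus>\<^bsub>level N (Suc n)\<^esub>i\<in>A. (- 1) ^ i \<odot>\<^bsub>level N (Suc n)\<^esub> coface N n i (f n x))"
    using A x c
    by (intro N.finsum_cong')
      (auto simp: k_linear_smult[OF mor_linear] mor_coface subset_iff
        intro!: N.smult_closed k_linear_closed[OF linear_coface[OF N]] mor_closed)
  finally show ?thesis .
qed

lemma mor_hoch_d: "x \<in> carrier (level M n) \<Longrightarrow> f (Suc n) (hoch_d M n x) = hoch_d N n (f n x)"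
  unfolding hoch_d_def by (rule mor_signed_sum) auto

lemma mor_hoch_d': "x \<in> carrier (level M n) \<Longrightarrow> f (Suc n) (hoch_d' M n x) = hoch_d' N n (f n x)"
  unfolding hoch_d'_def by (rule mor_signed_sum) auto

lemma mor_signed_cyc: "x \<in> carrier (level M n) \<Longrightarrow> f n (signed_cyc M n x) = signed_cyc N n (f n x)"
  unfolding signed_cyc_def
  by (simp add: k_linear_smult[OF mor_linear] k_linear_closed[OF linear_cyc[OF M]] mor_cyc)

lemma mor_signed_cyc_pow:
  "x \<in> carrier (level M n) \<Longrightarrow> f n ((signed_cyc M n ^^ i) x) = (signed_cyc N n ^^ i) (f n x)"
  using k_linear_closed[OF k_linear_funpow[OF linear_signed_cyc[OF M]]]
  by (induction i) (auto simp: mor_signed_cyc)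

lemma mor_cyc_vert: "x \<in> carrier (level M n) \<Longrightarrow> f (Suc n) (cyc_vert M p n x) = cyc_vert N p n (f n x)"
  unfolding cyc_vert_def
  by (simp add: mor_hoch_d mor_hoch_d' k_linear_smult[OF mor_linear] k_linear_closed[OF linear_hoch_d'[OF M]])

lemma mor_cyc_horiz: "x \<in> carrier (level M n) \<Longrightarrow> f n (cyc_horiz M p n x) = cyc_horiz N p n (f n x)"
  unfolding cyc_horiz_def
  by (simp add: k_linear_add[OF mor_linear] k_linear_smult[OF mor_linear] vsp.smult_closed[OF vM]
      k_linear_closed[OF linear_signed_cyc[OF M]] mor_signed_cyc k_linear_finsum[OF vM vN mor_linear]
      k_linear_closed[OF k_linear_funpow[OF linear_signed_cyc[OF M]]] mor_signed_cyc_pow)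

lemma cocyclic_morphism_induces_on_HH: "induces_on_HH M N f"
  unfolding induces_on_HH_def
  by (intro induces_on_cohomologyI vM vN linear_hoch_d M N mor_linear mor_hoch_d)

lemma cocyclic_morphism_induces_on_HC: "induces_on_HC M N f"
  unfolding induces_on_HC_def
proof (intro induces_on_cohomologyI vsp_cyc_tot linear_cyc_tot_d M N)
  fix n
  show "k_linear (cyc_tot M n) (cyc_tot N n) (\<lambda>x. \<lambda>q\<in>{..n}. f q (x q))"
    by (intro linear_cyc_tot_tuple[OF N] k_linear_comp[OF linear_cyc_tot_proj[OF M] mor_linear])
next
  fix n x assume x: "x \<in> carrier (cyc_tot M n)"
  have xq: "x q \<in> carrier (level M q)" if "q \<le> n" for q
    using x that by (auto simp: cyc_tot_def PiE_mem)
  show "(\<lambda>q\<in>{..Suc n}. f q (cyc_tot_d M n x q)) = cyc_tot_d N n (\<lambda>q\<in>{..n}. f q (x q))"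
    unfolding cyc_tot_d_def
  proof (rule restrict_ext)
    fix q assume "q \<in> {..Suc n}"
    then have q: "q \<le> Suc n" by simp
    let ?v = "if q = 0 then \<zero>\<^bsub>level M q\<^esub> else cyc_vert M (Suc n - q) (q - 1) (x (q - 1))"
    let ?h = "if q = Suc n then \<zero>\<^bsub>level M q\<^esub> else cyc_horiz M (n - q) q (x q)"
    \<comment> \<open>Two entries are exceptional: no vertical map ends in degree 0, and
      \<open>x\<close> has no entry in degree n + 1. There the summand is zero, and \<open>f\<close>
      maps zero to zero.\<close>
    have v: "?v \<in> carrier (level M q)"
      "f q ?v = (if q = 0 then \<zero>\<^bsub>level N q\<^esub> else cyc_vert N (Suc n - q) (q - 1) (f (q - 1) (x (q - 1))))"
      using q xq[of "q - 1"] k_linear_closed[OF linear_cyc_vert[OF M], of "x (q - 1)" "q - 1"]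
        mor_cyc_vert[of "x (q - 1)" "q - 1"]
      by (cases q; simp add: k_linear_zero[OF vM vN mor_linear] abelian_groupE(2)[OF vsp.axioms(1)[OF vM]])+
    have h: "?h \<in> carrier (level M q)"
      "f q ?h = (if q = Suc n then \<zero>\<^bsub>level N q\<^esub> else cyc_horiz N (n - q) q (f q (x q)))"
      using q xq[of q] k_linear_closed[OF linear_cyc_horiz[OF M], of "x q" q] mor_cyc_horiz[of "x q" q]
      by (cases "q = Suc n"; simp add: k_linear_zero[OF vM vN mor_linear] abelian_groupE(2)[OF vsp.axioms(1)[OF vM]])+
    have "f q (?v \<oplus>\<^bsub>level M q\<^esub> ?h) = f q ?v \<oplus>\<^bsub>level N q\<^esub> f q ?h"
      by (rule k_linear_add[OF mor_linear v(1) h(1)])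
    then show "f q ((\<lambda>q\<in>{..Suc n}. (if q = 0 then \<zero>\<^bsub>level M q\<^esub> else cyc_vert M (Suc n - q) (q - 1) (x (q - 1)))
          \<oplus>\<^bsub>level M q\<^esub> (if q = Suc n then \<zero>\<^bsub>level M q\<^esub> else cyc_horiz M (n - q) q (x q))) q)
      = (if q = 0 then \<zero>\<^bsub>level N q\<^esub> else cyc_vert N (Suc n - q) (q - 1) ((\<lambda>q\<in>{..n}. f q (x q)) (q - 1)))
          \<oplus>\<^bsub>level N q\<^esub> (if q = Suc n then \<zero>\<^bsub>level N q\<^esub> else cyc_horiz N (n - q) q ((\<lambda>q\<in>{..n}. f q (x q)) q))"
      using q unfolding v(2) h(2) by (cases q; cases "q = Suc n") simp_all
  qed
qed

end


section \<open>The morphism of cocyclic modules\<close>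

context sayd
begin

lemma linear_hopf_coface: "i \<le> Suc n \<Longrightarrow> k_linear (Cn H P n) (Cn H P (Suc n)) (hopf_coface H P n i)"
  by (rule k_linear_of_nf[OF Cn_fquot Cn_fquot hopf_coface_nf lincomb_lin[OF vector_space_free]])

lemma linear_hopf_cyc: "k_linear (Cn H P n) (Cn H P n) (hopf_cyc H P n)"
proof (cases n)
  case 0
  have "hopf_cyc H P 0 = (\<lambda>X. X)" by (rule ext) (simp add: hopf_cyc_def)
  then show ?thesis using 0 by (simp add: k_linear_ident)
next
  case (Suc m)
  then show ?thesis
    using k_linear_of_nf[OF Cn_fquot Cn_fquot hopf_cyc_nf lincomb_lin[OF vector_space_free]] by simp
qed

lemma linear_hopf_cocyclic: "linear_cocyclic (hopf_cocyclic H P)"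
  by (simp add: linear_cocyclic_def hopf_cocyclic_def vsp_fquot[OF Cn_fquot] linear_hopf_coface linear_hopf_cyc)

end

context measuring
begin

lemma Omega_gen_nf:
  assumes us: "length us = n"
  shows "Omega_gen C D H' P' \<Psi> \<Omega> y n us p \<in> carrier (Cn H' P' n)
    \<and> nf (Cn H' P' n) (Omega_gen C D H' P' \<Psi> \<Omega> y n us p) = om free_scale (R.tC n) y us p"
proof -
  note Vf = vector_space_free
  have ml: "multilin (length us) (scU H') (scD D) free_scale (\<lambda>vs d. R.tC n vs (\<Omega> d p))"
    unfolding us by (rule multilin_\<Omega>[OF baln_multilin[OF R.tn_Cn]])
  have b: "baln n (scC C) (scC C) (scC C) (scD D) (scD D) free_scale (\<lambda>ys y0. R.tC n (map2 \<Psi> ys us) (\<Omega> y0 p))"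
    using multilin_map2[where G = "\<lambda>vs d. R.tC n vs (\<Omega> d p)", OF ml lin_\<Psi>_left] us
    by (intro baln_multilinear) simp
  have c: "\<forall>ys y0. length ys = n \<longrightarrow> tens (Cn H' P' n) (map2 \<Psi> ys us, \<Omega> y0 p) \<in> carrier (Cn H' P' n)"
    by (intro allI impI R.tens_Cn) (simp add: us)
  note N = nf_liftn[OF iter_coact_carrier[unfolded CnD_def] R.Cn_fquot c b, folded CnD_def]
  show ?thesis
    unfolding Omega_gen_def Let_def
    using N lincomb_iter_coact[OF Vf lin_\<Psi>_left ml] us by simp
qed

lemma Omega_bar_nf:
  assumes X: "X \<in> carrier (Cn H P n)"
  shows "Omega_bar C D H' P' \<Psi> \<Omega> y n X \<in> carrier (Cn H' P' n)
    \<and> nf (Cn H' P' n) (Omega_bar C D H' P' \<Psi> \<Omega> y n X)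
      = lincomb free_scale (\<lambda>(us, p). om free_scale (R.tC n) y us p) (nf (Cn H P n) X)"
  unfolding Omega_bar_def Cn_def[of H P n]
  by (rule lift_generators[OF X[unfolded Cn_def] R.Cn_fquot Omega_gen_nf balC_om[OF vector_space_free R.tn_Cn]])

lemma Omega_bar_tens:
  assumes us: "length us = n"
  shows "Omega_bar C D H' P' \<Psi> \<Omega> y n (tens (Cn H P n) (us, p)) = Omega_gen C D H' P' \<Psi> \<Omega> y n us p"
proof -
  note B = Omega_bar_nf[OF L.tens_Cn[OF us], of y p] and G = Omega_gen_nf[OF us, of y p]
  show ?thesis
    by (rule nf_inj[OF R.Cn_fquot[where n = n]])
      (simp_all add: B G L.lincomb_tC[OF vector_space_free balC_om[OF vector_space_free R.tn_Cn]])
qed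

lemma lincomb_om:
  "vector_space sc \<Longrightarrow> R.balC n sc F \<Longrightarrow>
    lincomb sc (\<lambda>(vs, q). F vs q) (om free_scale (R.tC n) y us p) = om sc F y us p"
  by (simp add: draws_comp[OF lincomb_lin] R.lincomb_tC)

text \<open>In normal forms, both sides of each compatibility are sums over the same representative
  of \<open>X\<close>. It remains to compare the terms, which is \<open>cof_om\<close>,
  \<open>cdg_om\<close> or \<open>cyg_om\<close> for the class map \<open>R.tC\<close>.\<close>

lemma Omega_bar_morphism:
  "cocyclic_morphism (hopf_cocyclic H P) (hopf_cocyclic H' P') (Omega_bar C D H' P' \<Psi> \<Omega> y)"
  (is "cocyclic_morphism _ _ ?f")
  unfolding cocyclic_morphism_def
proof (intro conjI allI impI)
  note Vf = vector_space_free
  let ?e = "\<lambda>n. om free_scale (R.tC n) y"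
  have e: "L.balC n free_scale (?e n)" for n by (rule balC_om[OF Vf R.tn_Cn])
  fix n
  show "k_linear (level (hopf_cocyclic H P) n) (level (hopf_cocyclic H' P') n) (?f n)"
    unfolding hopf_cocyclic_def
    using k_linear_of_nf[OF L.Cn_fquot R.Cn_fquot Omega_bar_nf lincomb_lin[OF Vf]] by simp
  fix i X
  show "?f (Suc n) (coface (hopf_cocyclic H P) n i X) = coface (hopf_cocyclic H' P') n i (?f n X)"
    if "i \<le> Suc n" "X \<in> carrier (level (hopf_cocyclic H P) n)"
  proof -
    have i: "i \<le> Suc n" and X: "X \<in> carrier (Cn H P n)" using that by (simp_all add: hopf_cocyclic_def)
    note A = Omega_bar_nf[OF X, of y] and B = L.hopf_coface_nf[OF X i]
    note A' = Omega_bar_nf[OF B[THEN conjunct1], of y] and B' = R.hopf_coface_nf[OF A[THEN conjunct1] i]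
    have "nf (Cn H' P' (Suc n)) (?f (Suc n) (hopf_coface H P n i X))
        = lincomb free_scale (\<lambda>(us, p). L.cof free_scale n i (?e (Suc n)) us p) (nf (Cn H P n) X)"
      by (simp add: A' B lincomb_lincomb2[OF Vf] L.lincomb_cof[OF Vf e])
    also have "\<dots> = lincomb free_scale (\<lambda>(us, p). om free_scale (R.cof free_scale n i (R.tC (Suc n))) y us p) (nf (Cn H P n) X)"
      \<comment> \<open>The termwise identity holds for lists of length \<open>n\<close>, and the
        keys of the normal form of \<open>X\<close> contain no others.\<close>
      using length_nf_keys[OF X[unfolded Cn_def], folded Cn_def] cof_om[OF Vf, symmetric] R.tn_Cn i
      by (intro lincomb_cong2 refl) blast
    also have "\<dots> = nf (Cn H' P' (Suc n)) (hopf_coface H' P' n i (?f n X))"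
      by (simp add: A B' lincomb_lincomb2[OF Vf] lincomb_om[OF Vf R.balC_cof[OF Vf R.tn_Cn i]])
    finally show ?thesis
      using nf_inj[OF R.Cn_fquot A'[THEN conjunct1] B'[THEN conjunct1]] by (simp add: hopf_cocyclic_def)
  qed
  show "?f n (codegen (hopf_cocyclic H P) n i X) = codegen (hopf_cocyclic H' P') n i (?f (Suc n) X)"
    if "i \<le> n" "X \<in> carrier (level (hopf_cocyclic H P) (Suc n))"
  proof -
    have i: "i \<le> n" and X: "X \<in> carrier (Cn H P (Suc n))" using that by (simp_all add: hopf_cocyclic_def)
    note A = Omega_bar_nf[OF X, of y] and B = L.hopf_codegen_nf[OF X i]
    note A' = Omega_bar_nf[OF B[THEN conjunct1], of y] and B' = R.hopf_codegen_nf[OF A[THEN conjunct1] i]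
    have "nf (Cn H' P' n) (?f n (hopf_codegen H P n i X))
        = lincomb free_scale (\<lambda>(us, p). L.cdg n i (?e n) us p) (nf (Cn H P (Suc n)) X)"
      by (simp add: A' B lincomb_lincomb2[OF Vf] L.lincomb_cdg[OF Vf e])
    also have "\<dots> = lincomb free_scale (\<lambda>(us, p). om free_scale (R.cdg n i (R.tC n)) y us p) (nf (Cn H P (Suc n)) X)"
      using length_nf_keys[OF X[unfolded Cn_def], folded Cn_def] cdg_om[OF Vf R.tn_Cn _ i, symmetric]
      by (intro lincomb_cong2 refl) blast
    also have "\<dots> = nf (Cn H' P' n) (hopf_codegen H' P' n i (?f (Suc n) X))"
      by (simp add: A B' lincomb_lincomb2[OF Vf] lincomb_om[OF Vf R.balC_cdg[OF R.tn_Cn i]])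
    finally show ?thesis
      using nf_inj[OF R.Cn_fquot A'[THEN conjunct1] B'[THEN conjunct1]] by (simp add: hopf_cocyclic_def)
  qed
  show "?f n (cyc (hopf_cocyclic H P) n X) = cyc (hopf_cocyclic H' P') n (?f n X)"
    if "X \<in> carrier (level (hopf_cocyclic H P) n)"
  proof (cases n)
    case 0
    then show ?thesis by (simp add: hopf_cocyclic_def hopf_cyc_def)
  next
    case (Suc m)
    have X: "X \<in> carrier (Cn H P (Suc m))" using that Suc by (simp add: hopf_cocyclic_def)
    note A = Omega_bar_nf[OF X, of y] and B = L.hopf_cyc_nf[OF X]
    note A' = Omega_bar_nf[OF B[THEN conjunct1], of y] and B' = R.hopf_cyc_nf[OF A[THEN conjunct1]]
    \<comment> \<open>\<open>cyg_om\<close> is stated for a list with a head, since \<tau> treats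
      the first factor separately; in degree 0, \<tau> is the identity.\<close>
    have g: "lincomb free_scale (\<lambda>(us, p). ?e (Suc m) us p) (L.cyg free_scale (L.tC (Suc m)) us p)
        = om free_scale (R.cyg free_scale (R.tC (Suc m))) y us p" if us: "length us = Suc m" for us p
    proof -
      obtain u us' where us': "us = u # us'" "length us' = m" using us by (metis length_Suc_conv)
      show ?thesis
        using L.lincomb_cyg[OF Vf, of us' "?e (Suc m)" u p] e[of "Suc m"]
          cyg_om[OF Vf, of us' "R.tC (Suc m)" u y p] R.tn_Cn[of "Suc m"] us' by simp
    qed
    have "nf (Cn H' P' (Suc m)) (?f (Suc m) (hopf_cyc H P (Suc m) X))
        = lincomb free_scale (\<lambda>(us, p). lincomb free_scale (\<lambda>(us, p). ?e (Suc m) us p) (L.cyg free_scale (L.tC (Suc m)) us p)) (nf (Cn H P (Suc m)) X)"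
      by (simp add: A' B lincomb_lincomb2[OF Vf])
    also have "\<dots> = lincomb free_scale (\<lambda>(us, p). om free_scale (R.cyg free_scale (R.tC (Suc m))) y us p) (nf (Cn H P (Suc m)) X)"
      using length_nf_keys[OF X[unfolded Cn_def], folded Cn_def] g
      by (intro lincomb_cong2 refl) blast
    also have "\<dots> = nf (Cn H' P' (Suc m)) (hopf_cyc H' P' (Suc m) (?f (Suc m) X))"
      by (simp add: A B' lincomb_lincomb2[OF Vf] lincomb_om[OF Vf R.balC_cyg[OF Vf R.tn_Cn]])
    finally show ?thesis
      using nf_inj[OF R.Cn_fquot A'[THEN conjunct1] B'[THEN conjunct1]] Suc by (simp add: hopf_cocyclic_def)
  qed
qed

end

theorem proposition6p3:
  fixes H :: "('k::field, 'u::{ring,monoid_mult}, 'a::{ring,monoid_mult}) hopf"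
    and H' :: "('k, 'v::{ring,monoid_mult}, 'b::{ring,monoid_mult}) hopf"
    and P :: "('k, 'u, 'a, 'p::ab_group_add) saydm"
    and P' :: "('k, 'v, 'b, 'q::ab_group_add) saydm"
    and C :: "('k, 'c::ab_group_add) coalg"
    and D :: "('k, 'c, 'd::ab_group_add) comod"
    and \<Psi> :: "'c \<Rightarrow> 'u \<Rightarrow> 'v" and \<psi> :: "'c \<Rightarrow> 'a \<Rightarrow> 'b" and \<Omega> :: "'d \<Rightarrow> 'p \<Rightarrow> 'q"
    and y :: 'd
  assumes "hopf_algebroid H" and "hopf_algebroid H'"
    and "sayd_module H P" and "sayd_module H' P'"
    and "coalgebra C" and "cocommutative C"
    and "hopf_measuring C H H' \<Psi> \<psi>"
    and "comodule_measuring C D H H' P P' \<Psi> \<Omega>"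
  shows "(\<forall>n us p. length us = n \<longrightarrow>
            Omega_bar C D H' P' \<Psi> \<Omega> y n (tens (Cn H P n) (us, p))
              = Omega_gen C D H' P' \<Psi> \<Omega> y n us p)
       \<and> cocyclic_morphism (hopf_cocyclic H P) (hopf_cocyclic H' P') (Omega_bar C D H' P' \<Psi> \<Omega> y)
       \<and> induces_on_HH (hopf_cocyclic H P) (hopf_cocyclic H' P') (Omega_bar C D H' P' \<Psi> \<Omega> y)
       \<and> induces_on_HC (hopf_cocyclic H P) (hopf_cocyclic H' P') (Omega_bar C D H' P' \<Psi> \<Omega> y)"
proof -
  have "right_comodule C D" using assms(8) by (simp add: comodule_measuring_def)
  then interpret measuring C D H P H' P' \<Psi> \<psi> \<Omega>
    using assms by unfold_locales
  note mor = Omega_bar_morphism[of y]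
  show ?thesis
    using Omega_bar_tens mor
      cocyclic_morphism_induces_on_HH[OF L.linear_hopf_cocyclic R.linear_hopf_cocyclic mor]
      cocyclic_morphism_induces_on_HC[OF L.linear_hopf_cocyclic R.linear_hopf_cocyclic mor] by blast
qed

end
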